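(* Let $S$ be a commutative semiring with $1_S\neq0_S$, let $A$ be an $S$-semimodule such that $A_S$ is uniformly finitely presented and projective, and consider the isomorphism of semirings $h:S^*\simeq S$, $f\mapsto f(1_S)$. 1. If $(A,\mu,\eta)$ is an $S$-semialgebra, then $(A^*,\ \mathfrak{h}_{(A,A)}^{-1}\circ\mu^*,\ h\circ\eta^* )$ is an $S$-semicoalgebra. 2. If $(A,\mu,\eta,\Delta,\varepsilon)$ is an $S$-bisemialgebra, then $(A^*,\ \Delta^*\circ\mathfrak{h}_{(A,A)},\ \varepsilon^*\circ h^{-1},\ \mathfrak{h}_{(A,A)}^{-1}\circ\mu^*,\ h\circ\eta^* )$ is an $S$-bisemialgebra. 3. If $(A,\mu,\eta,\Delta,\varepsilon,\mathfrak{a})$ is a Hopf $S$-semialgebra, then $(A^*,\ \Delta^*\circ\mathfrak{h}_{(A,A)},\ \varepsilon^*\circ h^{-1},\ \mathfrak{h}_{(A,A)}^{-1}\circ\mu^*,\ h\circ\eta^*,\ \mathfrak{a}^* )$ is a Hopf $S$-semialgebra.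
   Context: Semirings are unital; semimodules are modules not necessarily with subtraction. $\mathbb{S}_S$ is the category of $S$-semimodules, symmetric monoidal under the natural tensor product $\otimes_S$. $S$-semialgebras $(A,\mu,\eta)$ and $S$-semicoalgebras $(A,\Delta,\varepsilon)$ are monoids and comonoids in $\mathbb{S}_S$. An $S$-bisemialgebra is $(A,\mu,\eta,\Delta,\varepsilon)$ with $\Delta,\varepsilon$ semialgebra morphisms. A Hopf $S$-semialgebra is an $S$-bisemialgebra with an $S$-linear $\mathfrak{a}:A\to A$ such that $\sum\mathfrak{a}(a_1)a_2=\varepsilon(a)1_A=\sum a_1\mathfrak{a}(a_2)$. $(-)^*=\mathrm{Hom}_S(-,S)$. $\mathfrak{h}_{(X,Y)}:X^*\otimes_S Y^*\to(X\otimes_S Y)^*$ is the canonical map $f\otimes g\mapsto[x\otimes y\mapsto f(x)g(y)]$; under the hypotheses on $A$, $\mathfrak{h}_{(A,A)}$ is an isomorphism. An $S$-linear map $f:M\to N$ is uniform iff it is both: - $i$-uniform: $f(M)=\{n\in N\mid n+f(m)=f(m')\text{ for some }m,m'\in M\}$; - $k$-uniform: $f(m)=f(m')$ implies $m+k=m'+k'$ for some $k,k'\in\mathrm{Ker}(f)$. $X$ is uniformly finitely generated iff there is a uniform surjective $S$-linear map $S^n\to X$ for some finite $n$. $X$ is uniformly finitely presented iff it is uniformly finitely generated and for every exact sequence of $S$-semimodules $0\to K\xrightarrow{f}S^n\xrightarrow{g}X\to0$ (i.e. $f$ injective, $f(K)=\mathrm{Ker}(g)$, $g$ surjective and $k$-uniform),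 $K$ is finitely generated. $X$ is projective iff it is a retract of a free $S$-semimodule. *)

theory Defs
  imports "HOL-Library.FuncSet" "HOL-Library.Multiset" "HOL-Algebra.AbelCoset"
    "HOL-Algebra.Module"
begin

section \<open>Semimodules over a commutative semiring\<close>

text \<open>
  Semimodules reuse the \<^type>\<open>module_ext\<close> record of HOL-Algebra. Its ring multiplication and
  unit play no role and are left \<^term>\<open>undefined\<close> in the constructions below.
\<close>

locale commutative_semiring = semiring S + comm_monoid S for S (structure)

locale semimodule = S?: commutative_semiring S + M?: abelian_monoid M
  for S (structure) and M (structure) +
  assumes smult_closed:
      "\<lbrakk>s \<in> carrier S; x \<in> carrier M\<rbrakk> \<Longrightarrow> s \<odot>\<^bsub>M\<^esub> x \<in> carrier M"
    and smult_l_distr: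
      "\<lbrakk>s \<in> carrier S; t \<in> carrier S; x \<in> carrier M\<rbrakk> \<Longrightarrow>
        (s \<oplus>\<^bsub>S\<^esub> t) \<odot>\<^bsub>M\<^esub> x = s \<odot>\<^bsub>M\<^esub> x \<oplus>\<^bsub>M\<^esub> t \<odot>\<^bsub>M\<^esub> x"
    and smult_r_distr:
      "\<lbrakk>s \<in> carrier S; x \<in> carrier M; y \<in> carrier M\<rbrakk> \<Longrightarrow>
        s \<odot>\<^bsub>M\<^esub> (x \<oplus>\<^bsub>M\<^esub> y) = s \<odot>\<^bsub>M\<^esub> x \<oplus>\<^bsub>M\<^esub> s \<odot>\<^bsub>M\<^esub> y"
    and smult_assoc1:
      "\<lbrakk>s \<in> carrier S; t \<in> carrier S; x \<in> carrier M\<rbrakk> \<Longrightarrow>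
        (s \<otimes>\<^bsub>S\<^esub> t) \<odot>\<^bsub>M\<^esub> x = s \<odot>\<^bsub>M\<^esub> (t \<odot>\<^bsub>M\<^esub> x)"
    and smult_one: "x \<in> carrier M \<Longrightarrow> \<one>\<^bsub>S\<^esub> \<odot>\<^bsub>M\<^esub> x = x"
    and smult_l_null: "x \<in> carrier M \<Longrightarrow> \<zero>\<^bsub>S\<^esub> \<odot>\<^bsub>M\<^esub> x = \<zero>\<^bsub>M\<^esub>"
    and smult_r_null: "s \<in> carrier S \<Longrightarrow> s \<odot>\<^bsub>M\<^esub> \<zero>\<^bsub>M\<^esub> = \<zero>\<^bsub>M\<^esub>"

text \<open>
  Between semimodules, such maps preserve zero because \<^term>\<open>\<zero>\<^bsub>S\<^esub> \<odot>\<^bsub>M\<^esub> x = \<zero>\<^bsub>M\<^esub>\<close>.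
  Values off the carrier are unconstrained, and equality of morphisms is always stated
  pointwise on the carrier.
\<close>

definition linear_maps ::
  "('s, 'r) ring_scheme \<Rightarrow> ('s, 'a, 'm) module_scheme \<Rightarrow> ('s, 'b, 'n) module_scheme \<Rightarrow> ('a \<Rightarrow> 'b) set"
  where "linear_maps S M N =
    {f \<in> carrier M \<rightarrow> carrier N.
      (\<forall>x\<in>carrier M. \<forall>y\<in>carrier M. f (x \<oplus>\<^bsub>M\<^esub> y) = f x \<oplus>\<^bsub>N\<^esub> f y) \<and>
      (\<forall>s\<in>carrier S. \<forall>x\<in>carrier M. f (s \<odot>\<^bsub>M\<^esub> x) = s \<odot>\<^bsub>N\<^esub> f x)}"

definition regular :: "('s, 'r) ring_scheme \<Rightarrow> ('s, 's) module"
  where "regular S =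
    \<lparr>carrier = carrier S, mult = mult S, one = \<one>\<^bsub>S\<^esub>, zero = \<zero>\<^bsub>S\<^esub>, add = add S, smult = mult S\<rparr>"

definition free_semimodule :: "('s, 'r) ring_scheme \<Rightarrow> 'i set \<Rightarrow> ('s, 'i \<Rightarrow> 's) module"
  where "free_semimodule S I =
    \<lparr>carrier = {v \<in> I \<rightarrow>\<^sub>E carrier S. finite {i \<in> I. v i \<noteq> \<zero>\<^bsub>S\<^esub>}},
     mult = undefined, one = undefined,
     zero = (\<lambda>i\<in>I. \<zero>\<^bsub>S\<^esub>),
     add = (\<lambda>v w. \<lambda>i\<in>I. v i \<oplus>\<^bsub>S\<^esub> w i),
     smult = (\<lambda>s v. \<lambda>i\<in>I. s \<otimes>\<^bsub>S\<^esub> v i)\<rparr>"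

abbreviation free_rank :: "('s, 'r) ring_scheme \<Rightarrow> nat \<Rightarrow> ('s, nat \<Rightarrow> 's) module"
  where "free_rank S n \<equiv> free_semimodule S {..<n}"


section \<open>Uniform morphisms, finiteness conditions, projectivity\<close>

definition i_uniform ::
  "('a, 'm) ring_scheme \<Rightarrow> ('b, 'n) ring_scheme \<Rightarrow> ('a \<Rightarrow> 'b) \<Rightarrow> bool"
  where "i_uniform M N f \<longleftrightarrow>
    f ` carrier M =
      {n \<in> carrier N. \<exists>m\<in>carrier M. \<exists>m'\<in>carrier M. n \<oplus>\<^bsub>N\<^esub> f m = f m'}"

definition k_uniform ::
  "('a, 'm) ring_scheme \<Rightarrow> ('b, 'n) ring_scheme \<Rightarrow> ('a \<Rightarrow> 'b) \<Rightarrow> bool"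
  where "k_uniform M N f \<longleftrightarrow>
    (\<forall>m\<in>carrier M. \<forall>m'\<in>carrier M. f m = f m' \<longrightarrow>
      (\<exists>k\<in>a_kernel M N f. \<exists>k'\<in>a_kernel M N f. m \<oplus>\<^bsub>M\<^esub> k = m' \<oplus>\<^bsub>M\<^esub> k'))"

definition uniform ::
  "('a, 'm) ring_scheme \<Rightarrow> ('b, 'n) ring_scheme \<Rightarrow> ('a \<Rightarrow> 'b) \<Rightarrow> bool"
  where "uniform M N f \<longleftrightarrow> i_uniform M N f \<and> k_uniform M N f"

definition finitely_generated ::
  "('s, 'r) ring_scheme \<Rightarrow> ('s, 'a, 'm) module_scheme \<Rightarrow> bool"
  where "finitely_generated S X \<longleftrightarrow>
    (\<exists>n. \<exists>g\<in>linear_maps S (free_rank S n) X. g ` carrier (free_rank S n) = carrier X)"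

definition uniformly_finitely_generated ::
  "('s, 'r) ring_scheme \<Rightarrow> ('s, 'a, 'm) module_scheme \<Rightarrow> bool"
  where "uniformly_finitely_generated S X \<longleftrightarrow>
    (\<exists>n. \<exists>g\<in>linear_maps S (free_rank S n) X.
      g ` carrier (free_rank S n) = carrier X \<and> uniform (free_rank S n) X g)"

text \<open>Exactness of \<open>0 \<rightarrow> K \<rightarrow> L \<rightarrow> X \<rightarrow> 0\<close>.\<close>

definition short_exact ::
  "('s, 'r) ring_scheme \<Rightarrow> ('s, 'k, 'm) module_scheme \<Rightarrow> ('s, 'l, 'n) module_scheme \<Rightarrow>
    ('s, 'a, 'p) module_scheme \<Rightarrow> ('k \<Rightarrow> 'l) \<Rightarrow> ('l \<Rightarrow> 'a) \<Rightarrow> bool"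
  where "short_exact S K L X f g \<longleftrightarrow>
    f \<in> linear_maps S K L \<and> g \<in> linear_maps S L X \<and>
    inj_on f (carrier K) \<and> f ` carrier K = a_kernel L X g \<and>
    g ` carrier L = carrier X \<and> k_uniform L X g"

text \<open>
  The semimodule \<open>K\<close> ranges over the element type of \<open>S\<^sup>n\<close>. This is no restriction: the left map
  of an exact sequence is injective, so every such \<open>K\<close> is isomorphic to a subsemimodule of \<open>S\<^sup>n\<close>.
\<close>

definition uniformly_finitely_presented ::
  "('s, 'r) ring_scheme \<Rightarrow> ('s, 'a, 'm) module_scheme \<Rightarrow> bool"
  where "uniformly_finitely_presented S X \<longleftrightarrow>
    uniformly_finitely_generated S X \<and>
    (\<forall>n (K :: ('s, nat \<Rightarrow> 's) module) f g.
      semimodule S K \<and> short_exact S K (free_rank S n) X f g \<longrightarrow> finitely_generated S K)"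

definition retract_of ::
  "('s, 'r) ring_scheme \<Rightarrow> ('s, 'a, 'm) module_scheme \<Rightarrow> ('s, 'b, 'n) module_scheme \<Rightarrow> bool"
  where "retract_of S X F \<longleftrightarrow>
    (\<exists>i\<in>linear_maps S X F. \<exists>p\<in>linear_maps S F X. \<forall>x\<in>carrier X. p (i x) = x)"

text \<open>
  The type argument is the type from which the basis of the free semimodule is drawn. A theorem
  assuming \<open>projective TYPE('i) S X\<close> for a type variable \<open>'i\<close> occurring nowhere else covers
  retracts of free semimodules on arbitrary bases.
\<close>

definition projective ::
  "'i itself \<Rightarrow> ('s, 'r) ring_scheme \<Rightarrow> ('s, 'a, 'm) module_scheme \<Rightarrow> bool"
  where "projective (_ :: 'i itself) S X \<longleftrightarrow>
    (\<exists>I :: 'i set. retract_of S X (free_semimodule S I))"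


section \<open>The tensor product\<close>

text \<open>
  \<open>M \<otimes>\<^sub>S N\<close> is the free commutative monoid on \<open>M \<times> N\<close>, i.e. the finite multisets of pairs, modulo
  the least congruence that makes \<open>(x, y) \<mapsto> x \<otimes> y\<close> additive (including preservation of
  zero) in each argument and \<open>S\<close>-balanced. Sums are not made cancellative.
\<close>

type_synonym ('a, 'b) tensor = "('a \<times> 'b) multiset set"

definition formal_sums ::
  "('a, 'm) ring_scheme \<Rightarrow> ('b, 'n) ring_scheme \<Rightarrow> ('a \<times> 'b) multiset set"
  where "formal_sums M N = {m. set_mset m \<subseteq> carrier M \<times> carrier N}"

inductive_set tensor_cong ::
  "('s, 'r) ring_scheme \<Rightarrow> ('s, 'a, 'm) module_scheme \<Rightarrow> ('s, 'b, 'n) module_scheme \<Rightarrow>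
    (('a \<times> 'b) multiset \<times> ('a \<times> 'b) multiset) set"
  for S :: "('s, 'r) ring_scheme" and M :: "('s, 'a, 'm) module_scheme"
    and N :: "('s, 'b, 'n) module_scheme"
  where
    refl: "m \<in> formal_sums M N \<Longrightarrow> (m, m) \<in> tensor_cong S M N"
  | sym: "(m, m') \<in> tensor_cong S M N \<Longrightarrow> (m', m) \<in> tensor_cong S M N"
  | trans: "\<lbrakk>(m, m') \<in> tensor_cong S M N; (m', m'') \<in> tensor_cong S M N\<rbrakk> \<Longrightarrow>
      (m, m'') \<in> tensor_cong S M N"
  | plus: "\<lbrakk>(m, m') \<in> tensor_cong S M N; (n, n') \<in> tensor_cong S M N\<rbrakk> \<Longrightarrow>
      (m + n, m' + n') \<in> tensor_cong S M N"
  | add_left: "\<lbrakk>x \<in> carrier M; x' \<in> carrier M; y \<in> carrier N\<rbrakk> \<Longrightarrow>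
      ({#(x \<oplus>\<^bsub>M\<^esub> x', y)#}, {#(x, y), (x', y)#}) \<in> tensor_cong S M N"
  | add_right: "\<lbrakk>x \<in> carrier M; y \<in> carrier N; y' \<in> carrier N\<rbrakk> \<Longrightarrow>
      ({#(x, y \<oplus>\<^bsub>N\<^esub> y')#}, {#(x, y), (x, y')#}) \<in> tensor_cong S M N"
  | zero_left: "y \<in> carrier N \<Longrightarrow> ({#(\<zero>\<^bsub>M\<^esub>, y)#}, {#}) \<in> tensor_cong S M N"
  | zero_right: "x \<in> carrier M \<Longrightarrow> ({#(x, \<zero>\<^bsub>N\<^esub>)#}, {#}) \<in> tensor_cong S M N"
  | balanced: "\<lbrakk>s \<in> carrier S; x \<in> carrier M; y \<in> carrier N\<rbrakk> \<Longrightarrow>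
      ({#(s \<odot>\<^bsub>M\<^esub> x, y)#}, {#(x, s \<odot>\<^bsub>N\<^esub> y)#}) \<in> tensor_cong S M N"

definition tensor ::
  "('s, 'r) ring_scheme \<Rightarrow> ('s, 'a, 'm) module_scheme \<Rightarrow> ('s, 'b, 'n) module_scheme \<Rightarrow>
    ('s, ('a, 'b) tensor) module"
  where "tensor S M N =
    \<lparr>carrier = formal_sums M N // tensor_cong S M N,
     mult = undefined, one = undefined,
     zero = tensor_cong S M N `` {{#}},
     add = (\<lambda>X Y. \<Union>m\<in>X. \<Union>n\<in>Y. tensor_cong S M N `` {m + n}),
     smult = (\<lambda>s X. \<Union>m\<in>X. tensor_cong S M N `` {image_mset (\<lambda>(x, y). (s \<odot>\<^bsub>M\<^esub> x, y)) m})\<rparr>"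

definition pure_tensor ::
  "('s, 'r) ring_scheme \<Rightarrow> ('s, 'a, 'm) module_scheme \<Rightarrow> ('s, 'b, 'n) module_scheme \<Rightarrow>
    'a \<Rightarrow> 'b \<Rightarrow> ('a, 'b) tensor"
  where "pure_tensor S M N x y = tensor_cong S M N `` {{#(x, y)#}}"

text \<open>
  The additive map \<open>\<Sum> x\<^sub>i \<otimes> y\<^sub>i \<mapsto> \<Sum> \<beta> x\<^sub>i y\<^sub>i\<close> into \<open>P\<close> induced by a bilinear map \<open>\<beta>\<close>; the value
  does not depend on the representative.
\<close>

definition formal_sum_value ::
  "('p, 'z) ring_scheme \<Rightarrow> ('a \<Rightarrow> 'b \<Rightarrow> 'p) \<Rightarrow> ('a \<times> 'b) multiset \<Rightarrow> 'p"
  where "formal_sum_value P \<beta> m =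
    (\<Oplus>\<^bsub>P\<^esub>q\<in>set_mset m. [count m q] \<cdot>\<^bsub>P\<^esub> \<beta> (fst q) (snd q))"

definition tensor_lift ::
  "('p, 'z) ring_scheme \<Rightarrow> ('a \<Rightarrow> 'b \<Rightarrow> 'p) \<Rightarrow> ('a, 'b) tensor \<Rightarrow> 'p"
  where "tensor_lift P \<beta> X = the_elem (formal_sum_value P \<beta> ` X)"

text \<open>\<open>f \<otimes> g\<close>, where \<open>P\<close> and \<open>Q\<close> are the codomains of \<open>f\<close> and \<open>g\<close>.\<close>

definition tensor_map ::
  "('s, 'r) ring_scheme \<Rightarrow> ('s, 'c, 'p) module_scheme \<Rightarrow> ('s, 'd, 'q) module_scheme \<Rightarrow>
    ('a \<Rightarrow> 'c) \<Rightarrow> ('b \<Rightarrow> 'd) \<Rightarrow> ('a, 'b) tensor \<Rightarrow> ('c, 'd) tensor"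
  where "tensor_map S P Q f g =
    tensor_lift (tensor S P Q) (\<lambda>x y. pure_tensor S P Q (f x) (g y))"

text \<open>
  The coherence maps of the monoidal category: \<open>(x \<otimes> y) \<otimes> z \<mapsto> x \<otimes> (y \<otimes> z)\<close>,
  \<open>s \<otimes> x \<mapsto> s x\<close>, \<open>x \<otimes> s \<mapsto> s x\<close>, and
  \<open>(x \<otimes> y) \<otimes> (x' \<otimes> y') \<mapsto> (x \<otimes> x') \<otimes> (y \<otimes> y')\<close>.
\<close>

definition associator ::
  "('s, 'r) ring_scheme \<Rightarrow> ('s, 'a, 'm) module_scheme \<Rightarrow> ('s, 'b, 'n) module_scheme \<Rightarrow>
    ('s, 'c, 'p) module_scheme \<Rightarrow> (('a, 'b) tensor, 'c) tensor \<Rightarrow> ('a, ('b, 'c) tensor) tensor"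
  where "associator S M N P =
    tensor_lift (tensor S M (tensor S N P))
      (\<lambda>X z. tensor_lift (tensor S M (tensor S N P))
        (\<lambda>x y. pure_tensor S M (tensor S N P) x (pure_tensor S N P y z)) X)"

definition left_unitor :: "('s, 'a, 'm) module_scheme \<Rightarrow> ('s, 'a) tensor \<Rightarrow> 'a"
  where "left_unitor M = tensor_lift M (\<lambda>s x. s \<odot>\<^bsub>M\<^esub> x)"

definition right_unitor :: "('s, 'a, 'm) module_scheme \<Rightarrow> ('a, 's) tensor \<Rightarrow> 'a"
  where "right_unitor M = tensor_lift M (\<lambda>x s. s \<odot>\<^bsub>M\<^esub> x)"

definition interchange ::
  "('s, 'r) ring_scheme \<Rightarrow> ('s, 'a, 'm) module_scheme \<Rightarrow> ('s, 'b, 'n) module_scheme \<Rightarrow>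
    (('a, 'b) tensor, ('a, 'b) tensor) tensor \<Rightarrow> (('a, 'a) tensor, ('b, 'b) tensor) tensor"
  where "interchange S M N =
    (let T = tensor S (tensor S M M) (tensor S N N) in
     tensor_lift T (\<lambda>X Y.
       tensor_lift T (\<lambda>x y.
         tensor_lift T (\<lambda>x' y'.
           pure_tensor S (tensor S M M) (tensor S N N)
             (pure_tensor S M M x x') (pure_tensor S N N y y')) Y) X))"


section \<open>Semialgebras, semicoalgebras, bisemialgebras, Hopf semialgebras\<close>

text \<open>Unit and counit are morphisms \<open>\<eta> : S \<rightarrow> A\<close> and \<open>\<epsilon> : A \<rightarrow> S\<close>.\<close>

definition semialgebra ::
  "('s, 'r) ring_scheme \<Rightarrow> ('s, 'a, 'm) module_scheme \<Rightarrow>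
    (('a, 'a) tensor \<Rightarrow> 'a) \<Rightarrow> ('s \<Rightarrow> 'a) \<Rightarrow> bool"
  where "semialgebra S A \<mu> \<eta> \<longleftrightarrow>
    semimodule S A \<and>
    \<mu> \<in> linear_maps S (tensor S A A) A \<and>
    \<eta> \<in> linear_maps S (regular S) A \<and>
    (\<forall>t\<in>carrier (tensor S (tensor S A A) A).
      \<mu> (tensor_map S A A \<mu> id t) = \<mu> (tensor_map S A A id \<mu> (associator S A A A t))) \<and>
    (\<forall>t\<in>carrier (tensor S (regular S) A). \<mu> (tensor_map S A A \<eta> id t) = left_unitor A t) \<and>
    (\<forall>t\<in>carrier (tensor S A (regular S)). \<mu> (tensor_map S A A id \<eta> t) = right_unitor A t)"

definition semicoalgebra ::
  "('s, 'r) ring_scheme \<Rightarrow> ('s, 'a, 'm) module_scheme \<Rightarrow>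
    ('a \<Rightarrow> ('a, 'a) tensor) \<Rightarrow> ('a \<Rightarrow> 's) \<Rightarrow> bool"
  where "semicoalgebra S A \<Delta> \<epsilon> \<longleftrightarrow>
    semimodule S A \<and>
    \<Delta> \<in> linear_maps S A (tensor S A A) \<and>
    \<epsilon> \<in> linear_maps S A (regular S) \<and>
    (\<forall>a\<in>carrier A.
      associator S A A A (tensor_map S (tensor S A A) A \<Delta> id (\<Delta> a)) =
      tensor_map S A (tensor S A A) id \<Delta> (\<Delta> a)) \<and>
    (\<forall>a\<in>carrier A. left_unitor A (tensor_map S (regular S) A \<epsilon> id (\<Delta> a)) = a) \<and>
    (\<forall>a\<in>carrier A. right_unitor A (tensor_map S A (regular S) id \<epsilon> (\<Delta> a)) = a)"

definition semialgebra_morphism ::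
  "('s, 'r) ring_scheme \<Rightarrow>
    ('s, 'a, 'm) module_scheme \<Rightarrow> (('a, 'a) tensor \<Rightarrow> 'a) \<Rightarrow> ('s \<Rightarrow> 'a) \<Rightarrow>
    ('s, 'b, 'n) module_scheme \<Rightarrow> (('b, 'b) tensor \<Rightarrow> 'b) \<Rightarrow> ('s \<Rightarrow> 'b) \<Rightarrow>
    ('a \<Rightarrow> 'b) \<Rightarrow> bool"
  where "semialgebra_morphism S A \<mu> \<eta> B \<nu> \<theta> f \<longleftrightarrow>
    f \<in> linear_maps S A B \<and>
    (\<forall>t\<in>carrier (tensor S A A). f (\<mu> t) = \<nu> (tensor_map S B B f f t)) \<and>
    (\<forall>s\<in>carrier S. f (\<eta> s) = \<theta> s)"

text \<open>
  The semialgebra structures on \<open>A \<otimes> A\<close>, with product \<open>(a \<otimes> b) (a' \<otimes> b') = a a' \<otimes> b b'\<close>,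
  and on \<open>S\<close>, with product the unitor \<open>S \<otimes> S \<rightarrow> S\<close> and unit the identity.
\<close>

definition tensor_square_mult ::
  "('s, 'r) ring_scheme \<Rightarrow> ('s, 'a, 'm) module_scheme \<Rightarrow> (('a, 'a) tensor \<Rightarrow> 'a) \<Rightarrow>
    (('a, 'a) tensor, ('a, 'a) tensor) tensor \<Rightarrow> ('a, 'a) tensor"
  where "tensor_square_mult S A \<mu> = tensor_map S A A \<mu> \<mu> \<circ> interchange S A A"

definition tensor_square_unit ::
  "('s, 'r) ring_scheme \<Rightarrow> ('s, 'a, 'm) module_scheme \<Rightarrow> ('s \<Rightarrow> 'a) \<Rightarrow> 's \<Rightarrow> ('a, 'a) tensor"
  where "tensor_square_unit S A \<eta> s =
    tensor_map S A A \<eta> \<eta> (pure_tensor S (regular S) (regular S) s \<one>\<^bsub>S\<^esub>)"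

definition bisemialgebra ::
  "('s, 'r) ring_scheme \<Rightarrow> ('s, 'a, 'm) module_scheme \<Rightarrow>
    (('a, 'a) tensor \<Rightarrow> 'a) \<Rightarrow> ('s \<Rightarrow> 'a) \<Rightarrow> ('a \<Rightarrow> ('a, 'a) tensor) \<Rightarrow> ('a \<Rightarrow> 's) \<Rightarrow> bool"
  where "bisemialgebra S A \<mu> \<eta> \<Delta> \<epsilon> \<longleftrightarrow>
    semialgebra S A \<mu> \<eta> \<and>
    semicoalgebra S A \<Delta> \<epsilon> \<and>
    semialgebra_morphism S A \<mu> \<eta>
      (tensor S A A) (tensor_square_mult S A \<mu>) (tensor_square_unit S A \<eta>) \<Delta> \<and>
    semialgebra_morphism S A \<mu> \<eta> (regular S) (left_unitor (regular S)) id \<epsilon>"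

text \<open>
  \<open>\<mu> ((f \<otimes> g) (\<Delta> a))\<close> is \<open>\<Sum> f(a\<^sub>1) g(a\<^sub>2)\<close> in Sweedler notation, and \<open>\<eta> (\<epsilon> a)\<close> is \<open>\<epsilon>(a) 1\<^sub>A\<close>.
\<close>

definition hopf_semialgebra ::
  "('s, 'r) ring_scheme \<Rightarrow> ('s, 'a, 'm) module_scheme \<Rightarrow>
    (('a, 'a) tensor \<Rightarrow> 'a) \<Rightarrow> ('s \<Rightarrow> 'a) \<Rightarrow> ('a \<Rightarrow> ('a, 'a) tensor) \<Rightarrow> ('a \<Rightarrow> 's) \<Rightarrow>
    ('a \<Rightarrow> 'a) \<Rightarrow> bool"
  where "hopf_semialgebra S A \<mu> \<eta> \<Delta> \<epsilon> \<aa> \<longleftrightarrow>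
    bisemialgebra S A \<mu> \<eta> \<Delta> \<epsilon> \<and>
    \<aa> \<in> linear_maps S A A \<and>
    (\<forall>a\<in>carrier A.
      \<mu> (tensor_map S A A \<aa> id (\<Delta> a)) = \<eta> (\<epsilon> a) \<and>
      \<mu> (tensor_map S A A id \<aa> (\<Delta> a)) = \<eta> (\<epsilon> a))"


section \<open>Duals\<close>

text \<open>
  Elements of \<open>M\<^sup>*\<close> are extensional functions, so that equal functionals are equal as HOL functions.
\<close>

definition dual ::
  "('s, 'r) ring_scheme \<Rightarrow> ('s, 'a, 'm) module_scheme \<Rightarrow> ('s, 'a \<Rightarrow> 's) module"
  where "dual S M =
    \<lparr>carrier = linear_maps S M (regular S) \<inter> extensional (carrier M),
     mult = undefined, one = undefined,
     zero = (\<lambda>x\<in>carrier M. \<zero>\<^bsub>S\<^esub>),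
     add = (\<lambda>f g. \<lambda>x\<in>carrier M. f x \<oplus>\<^bsub>S\<^esub> g x),
     smult = (\<lambda>s f. \<lambda>x\<in>carrier M. s \<otimes>\<^bsub>S\<^esub> f x)\<rparr>"

text \<open>\<open>f\<^sup>* : N\<^sup>* \<rightarrow> M\<^sup>*\<close> for \<open>f : M \<rightarrow> N\<close>.\<close>

definition dual_map :: "('a, 'm) ring_scheme \<Rightarrow> ('a \<Rightarrow> 'b) \<Rightarrow> ('b \<Rightarrow> 's) \<Rightarrow> 'a \<Rightarrow> 's"
  where "dual_map M f \<phi> = (\<lambda>x\<in>carrier M. \<phi> (f x))"

text \<open>\<open>h : S\<^sup>* \<rightarrow> S\<close> and its inverse.\<close>

definition eval_one :: "('s, 'r) ring_scheme \<Rightarrow> ('s \<Rightarrow> 's) \<Rightarrow> 's"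
  where "eval_one S f = f \<one>\<^bsub>S\<^esub>"

definition eval_one_inv :: "('s, 'r) ring_scheme \<Rightarrow> 's \<Rightarrow> ('s \<Rightarrow> 's)"
  where "eval_one_inv S = inv_into (carrier (dual S (regular S))) (eval_one S)"

text \<open>
  The canonical map \<open>X\<^sup>* \<otimes> Y\<^sup>* \<rightarrow> (X \<otimes> Y)\<^sup>*\<close>, and its inverse, which is meaningful whenever the
  canonical map is bijective; this holds for \<open>X = Y\<close> finitely generated and projective.
\<close>

definition canonical_map ::
  "('s, 'r) ring_scheme \<Rightarrow> ('s, 'a, 'm) module_scheme \<Rightarrow> ('s, 'b, 'n) module_scheme \<Rightarrow>
    ('a \<Rightarrow> 's, 'b \<Rightarrow> 's) tensor \<Rightarrow> ('a, 'b) tensor \<Rightarrow> 's"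
  where "canonical_map S X Y =
    tensor_lift (dual S (tensor S X Y))
      (\<lambda>f g. \<lambda>t\<in>carrier (tensor S X Y). tensor_lift S (\<lambda>x y. f x \<otimes>\<^bsub>S\<^esub> g y) t)"

definition canonical_map_inv ::
  "('s, 'r) ring_scheme \<Rightarrow> ('s, 'a, 'm) module_scheme \<Rightarrow> ('s, 'b, 'n) module_scheme \<Rightarrow>
    (('a, 'b) tensor \<Rightarrow> 's) \<Rightarrow> ('a \<Rightarrow> 's, 'b \<Rightarrow> 's) tensor"
  where "canonical_map_inv S X Y =
    inv_into (carrier (tensor S (dual S X) (dual S Y))) (canonical_map S X Y)"

end

theory Submission
  imports Defs
begin

text \<open>
  Restricting a splitting of a free semimodule over \<open>A\<close> to the finitely many coordinates met by
  generators of \<open>A\<close> gives a finite dual basis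
  \<open>x = \<Sum>\<^sub>j \<xi>\<^sub>j(x) e\<^sub>j\<close>. Its dual form \<open>X = \<Sum>\<^sub>j \<xi>\<^sub>j \<otimes> (ev(e\<^sub>j) \<otimes> id) X\<close> for \<open>X \<in> A\<^sup>* \<otimes> N\<close> shows that
  the contractions \<open>ev(a) \<otimes> id\<close> separate the elements of \<open>A\<^sup>* \<otimes> N\<close>, so that an identity in
  \<open>A\<^sup>* \<otimes> A\<^sup>*\<close> or \<open>A\<^sup>* \<otimes> (A\<^sup>* \<otimes> A\<^sup>*)\<close> may be checked by evaluating at elements of \<open>A\<close>, and that the
  canonical map is bijective. The axioms on \<open>A\<^sup>*\<close> then reduce to those on \<open>A\<close> by naturality of the
  pairing \<open>(f \<otimes> g)(X)\<close>.
\<close>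

section \<open>Linear and bilinear maps\<close>

text \<open>Without subtraction two tensors cannot be compared through their difference, and a
  linear map with zero kernel need not be injective. Equality in a tensor product with
  \<open>D = dual S A\<close> therefore rests on a formula that rebuilds each element from its
  contractions. Two kinds of identity occur: linear maps out of a tensor product are compared on
  pure tensors (\<open>tensor_ext\<close>), whereas values in \<open>D \<otimes> D\<close>, such as
  coproducts, which are rarely pure, are compared by contraction (\<open>DD_eqI\<close>). The
  inverse of the canonical map is given by choice, so the dual coproduct has no formula of its own.
  It is accessible only through \<open>contract D a (dual_comult \<mu> \<phi>) b = \<phi> (\<mu> (a
  \<otimes> b))\<close>, which rests on surjectivity of the canonical map. A contraction consumes
  the left factor and returns an element of the right one, so it can be iterated on threefold
  products. Functionals in \<open>dual\<close> are cut off outside the carrier while composites such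
  as \<open>\<lambda>x. f (p x)\<close> are not; \<open>pairing_cong\<close> bridges this
  gap.\<close>

lemma semimodule_abelian_monoid: "semimodule S M \<Longrightarrow> abelian_monoid M"
  by (simp add: semimodule_def)

lemma semimodule_scalars: "semimodule S M \<Longrightarrow> commutative_semiring S"
  by (simp add: semimodule_def)

lemma linear_mapsI:
  assumes "\<And>x. x \<in> carrier M \<Longrightarrow> f x \<in> carrier N"
    and "\<And>x y. x \<in> carrier M \<Longrightarrow> y \<in> carrier M \<Longrightarrow> f (x \<oplus>\<^bsub>M\<^esub> y) = f x \<oplus>\<^bsub>N\<^esub> f y"
    and "\<And>s x. s \<in> carrier S \<Longrightarrow> x \<in> carrier M \<Longrightarrow> f (s \<odot>\<^bsub>M\<^esub> x) = s \<odot>\<^bsub>N\<^esub> f x"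
  shows "f \<in> linear_maps S M N"
  using assms by (auto simp: linear_maps_def)

lemma linear_closed: "f \<in> linear_maps S M N \<Longrightarrow> x \<in> carrier M \<Longrightarrow> f x \<in> carrier N"
  by (auto simp: linear_maps_def)

lemma linear_add:
  "f \<in> linear_maps S M N \<Longrightarrow> x \<in> carrier M \<Longrightarrow> y \<in> carrier M \<Longrightarrow> f (x \<oplus>\<^bsub>M\<^esub> y) = f x \<oplus>\<^bsub>N\<^esub> f y"
  by (auto simp: linear_maps_def)

lemma linear_smult:
  "f \<in> linear_maps S M N \<Longrightarrow> s \<in> carrier S \<Longrightarrow> x \<in> carrier M \<Longrightarrow> f (s \<odot>\<^bsub>M\<^esub> x) = s \<odot>\<^bsub>N\<^esub> f x"
  by (auto simp: linear_maps_def)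

lemma linear_zero:
  assumes M: "semimodule S M" and N: "semimodule S N" and f: "f \<in> linear_maps S M N"
  shows "f \<zero>\<^bsub>M\<^esub> = \<zero>\<^bsub>N\<^esub>"
proof -
  interpret M: semimodule S M by fact
  interpret N: semimodule S N by fact
  have "f \<zero>\<^bsub>M\<^esub> = f (\<zero>\<^bsub>S\<^esub> \<odot>\<^bsub>M\<^esub> \<zero>\<^bsub>M\<^esub>)"
    by (simp add: M.smult_l_null)
  also have "\<dots> = \<zero>\<^bsub>N\<^esub>"
    by (simp add: linear_smult[OF f] N.smult_l_null linear_closed[OF f])
  finally show ?thesis .
qed

lemma linear_compose:
  "f \<in> linear_maps S M N \<Longrightarrow> g \<in> linear_maps S N P \<Longrightarrow> (\<lambda>x. g (f x)) \<in> linear_maps S M P"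
  by (rule linear_mapsI) (simp_all add: linear_closed linear_add linear_smult)

lemma linear_ident: "(\<lambda>x. x) \<in> linear_maps S M M"
  by (auto simp: linear_maps_def)

text \<open>Membership in \<open>linear_maps\<close> sees only values on the carrier of
  \<open>M\<close>; closure of that carrier under sums and scalars is what transfers the laws from
  \<open>f\<close> to \<open>g\<close>.\<close>

lemma linear_cong:
  assumes "f \<in> linear_maps S M N" "semimodule S M" "\<And>x. x \<in> carrier M \<Longrightarrow> g x = f x"
  shows "g \<in> linear_maps S M N"
proof -
  interpret M: semimodule S M by fact
  show ?thesis
    using assms(1,3) by (auto simp: linear_maps_def M.smult_closed)
qed

lemma linear_finsum:
  assumes M: "semimodule S M" and N: "semimodule S N" and f: "f \<in> linear_maps S M N"
    and "g \<in> J \<rightarrow> carrier M"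
  shows "f (\<Oplus>\<^bsub>M\<^esub>j\<in>J. g j) = (\<Oplus>\<^bsub>N\<^esub>j\<in>J. f (g j))"
proof -
  interpret M: semimodule S M by fact
  interpret N: semimodule S N by fact
  show ?thesis
    using \<open>g \<in> J \<rightarrow> carrier M\<close>
  \<comment> \<open>A sum over an infinite set is zero by convention, so that case is
    \<open>linear_zero\<close>, like the empty one.\<close>
  proof (induction J rule: infinite_finite_induct)
    case (insert j J)
    then have "g \<in> J \<rightarrow> carrier M" "g j \<in> carrier M" by auto
    then show ?case
      using insert by (simp add: linear_add[OF f] linear_closed[OF f] Pi_iff)
  qed (simp_all add: linear_zero[OF M N f])
qed

lemma linear_finsum_pointwise:
  assumes M: "semimodule S M" and N: "semimodule S N"
    and "\<And>j. j \<in> J \<Longrightarrow> g j \<in> linear_maps S M N"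
  shows "(\<lambda>x. \<Oplus>\<^bsub>N\<^esub>j\<in>J. g j x) \<in> linear_maps S M N"
proof -
  interpret M: semimodule S M by fact
  interpret N: semimodule S N by fact
  show ?thesis
  proof (rule linear_mapsI)
    fix x y assume "x \<in> carrier M" "y \<in> carrier M"
    then have "(\<lambda>j. g j x) \<in> J \<rightarrow> carrier N" "(\<lambda>j. g j y) \<in> J \<rightarrow> carrier N"
      using assms(3) by (auto intro: linear_closed)
    moreover from this have "(\<Oplus>\<^bsub>N\<^esub>j\<in>J. g j (x \<oplus>\<^bsub>M\<^esub> y)) = (\<Oplus>\<^bsub>N\<^esub>j\<in>J. g j x \<oplus>\<^bsub>N\<^esub> g j y)"
      using \<open>x \<in> carrier M\<close> \<open>y \<in> carrier M\<close>
      by (intro N.M.finsum_cong') (auto simp: linear_add[OF assms(3)])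
    ultimately show "(\<Oplus>\<^bsub>N\<^esub>j\<in>J. g j (x \<oplus>\<^bsub>M\<^esub> y)) = (\<Oplus>\<^bsub>N\<^esub>j\<in>J. g j x) \<oplus>\<^bsub>N\<^esub> (\<Oplus>\<^bsub>N\<^esub>j\<in>J. g j y)"
      by (simp add: N.M.finsum_addf)
  next
    fix s x assume s: "s \<in> carrier S" and x: "x \<in> carrier M"
    then have "(\<lambda>j. g j x) \<in> J \<rightarrow> carrier N"
      using assms(3) by (auto intro: linear_closed)
    \<comment> \<open>Scaling by \<open>s\<close> is itself linear because \<open>S\<close> is
      commutative, so \<open>linear_finsum\<close> pulls it out of the sum.\<close>
    moreover have "(\<lambda>y. s \<odot>\<^bsub>N\<^esub> y) \<in> linear_maps S N N"
      using s by (auto intro!: linear_mapsI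
          simp: N.smult_closed N.smult_r_distr M.S.m_comm N.smult_assoc1[symmetric])
    ultimately show "(\<Oplus>\<^bsub>N\<^esub>j\<in>J. g j (s \<odot>\<^bsub>M\<^esub> x)) = s \<odot>\<^bsub>N\<^esub> (\<Oplus>\<^bsub>N\<^esub>j\<in>J. g j x)"
      using s x by (subst linear_finsum[OF N N])
        (auto intro!: N.M.finsum_cong' N.smult_closed simp: linear_smult[OF assms(3)])
  qed (auto intro!: N.M.finsum_closed linear_closed[OF assms(3)])
qed

definition bilinear_maps ::
  "('s, 'r) ring_scheme \<Rightarrow> ('s, 'a, 'm) module_scheme \<Rightarrow> ('s, 'b, 'n) module_scheme \<Rightarrow>
    ('s, 'c, 'p) module_scheme \<Rightarrow> ('a \<Rightarrow> 'b \<Rightarrow> 'c) set"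
  where "bilinear_maps S M N P =
    {\<beta>. (\<forall>x\<in>carrier M. \<beta> x \<in> linear_maps S N P) \<and>
        (\<forall>y\<in>carrier N. (\<lambda>x. \<beta> x y) \<in> linear_maps S M P)}"

lemma bilinear_mapsI:
  assumes "\<And>x. x \<in> carrier M \<Longrightarrow> (\<lambda>y. \<beta> x y) \<in> linear_maps S N P"
    and "\<And>y. y \<in> carrier N \<Longrightarrow> (\<lambda>x. \<beta> x y) \<in> linear_maps S M P"
  shows "\<beta> \<in> bilinear_maps S M N P"
  using assms by (simp add: bilinear_maps_def)

lemma bilinear_left: "\<beta> \<in> bilinear_maps S M N P \<Longrightarrow> y \<in> carrier N \<Longrightarrow> (\<lambda>x. \<beta> x y) \<in> linear_maps S M P"
  by (simp add: bilinear_maps_def)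

lemma bilinear_right: "\<beta> \<in> bilinear_maps S M N P \<Longrightarrow> x \<in> carrier M \<Longrightarrow> \<beta> x \<in> linear_maps S N P"
  by (simp add: bilinear_maps_def)

lemma bilinear_closed:
  "\<beta> \<in> bilinear_maps S M N P \<Longrightarrow> x \<in> carrier M \<Longrightarrow> y \<in> carrier N \<Longrightarrow> \<beta> x y \<in> carrier P"
  by (metis bilinear_right linear_closed)

lemma regular_simps [simp]:
  "carrier (regular S) = carrier S" "zero (regular S) = zero S" "add (regular S) = add S"
  "smult (regular S) = mult S"
  by (simp_all add: regular_def)

lemma semimodule_regular:
  assumes "commutative_semiring S"
  shows "semimodule S (regular S)"
proof -
  interpret commutative_semiring S by fact
  have "abelian_monoid (regular S)"
    by (rule abelian_monoidI) (auto simp: a_ac)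
  then show ?thesis
    by (auto simp: semimodule_def semimodule_axioms_def assms l_distr r_distr m_assoc)
qed

section \<open>Tensor products of semimodules\<close>

lemma formal_sums_empty [simp]: "{#} \<in> formal_sums M N"
  by (simp add: formal_sums_def)

lemma formal_sums_single [simp]:
  "{#(x, y)#} \<in> formal_sums M N \<longleftrightarrow> x \<in> carrier M \<and> y \<in> carrier N"
  by (simp add: formal_sums_def)

lemma formal_sums_plus [simp]:
  "m + n \<in> formal_sums M N \<longleftrightarrow> m \<in> formal_sums M N \<and> n \<in> formal_sums M N"
  by (auto simp: formal_sums_def)

lemma formal_sums_add_mset [simp]:
  "add_mset q m \<in> formal_sums M N \<longleftrightarrow> q \<in> carrier M \<times> carrier N \<and> m \<in> formal_sums M N"
  by (auto simp: formal_sums_def)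

text \<open>The scalar action of \<open>tensor\<close> on representatives. Scaling the left entries
  or the right ones gives the same class, by the relation \<open>balanced\<close>.\<close>

definition formal_smult :: "('s, 'a, 'm) module_scheme \<Rightarrow> 's \<Rightarrow> ('a \<times> 'b) multiset \<Rightarrow> ('a \<times> 'b) multiset"
  where "formal_smult M s = image_mset (\<lambda>(x, y). (s \<odot>\<^bsub>M\<^esub> x, y))"

lemma formal_smult_simps [simp]:
  "formal_smult M s {#} = {#}"
  "formal_smult M s (add_mset (x, y) m) = add_mset (s \<odot>\<^bsub>M\<^esub> x, y) (formal_smult M s m)"
  "formal_smult M s (m + n) = formal_smult M s m + formal_smult M s n"
  by (simp_all add: formal_smult_def)

context
  fixes S :: "('s, 'r) ring_scheme" and M :: "('s, 'a, 'm) module_scheme"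
    and N :: "('s, 'b, 'n) module_scheme"
  assumes M: "semimodule S M" and N: "semimodule S N"
begin

interpretation M: semimodule S M by (fact M)
interpretation N: semimodule S N by (fact N)

lemma tensor_cong_formal_sums:
  "(m, m') \<in> tensor_cong S M N \<Longrightarrow> m \<in> formal_sums M N \<and> m' \<in> formal_sums M N"
  by (induction rule: tensor_cong.induct) (auto simp: M.smult_closed N.smult_closed)

lemma equiv_tensor_cong: "equiv (formal_sums M N) (tensor_cong S M N)"
proof (rule equivI)
  show "tensor_cong S M N \<subseteq> formal_sums M N \<times> formal_sums M N"
    by (rule subrelI) (blast dest: tensor_cong_formal_sums)
  show "refl_on (formal_sums M N) (tensor_cong S M N)"
    by (simp add: refl_on_def tensor_cong.refl)
  show "sym (tensor_cong S M N)"
    by (rule symI) (rule tensor_cong.sym)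
  show "trans (tensor_cong S M N)"
    by (rule transI) (rule tensor_cong.trans)
qed

abbreviation tensor_class :: "('a \<times> 'b) multiset \<Rightarrow> ('a, 'b) tensor"
  where "tensor_class m \<equiv> tensor_cong S M N `` {m}"

lemma tensor_class_eq: "(m, m') \<in> tensor_cong S M N \<Longrightarrow> tensor_class m = tensor_class m'"
  using equiv_class_eq[OF equiv_tensor_cong] .

lemma tensor_class_carrier [simp]: "m \<in> formal_sums M N \<Longrightarrow> tensor_class m \<in> carrier (tensor S M N)"
  by (simp add: tensor_def quotientI)

lemma tensor_class_cases:
  assumes "X \<in> carrier (tensor S M N)"
  obtains m where "m \<in> formal_sums M N" "X = tensor_class m"
  using assms by (auto simp: tensor_def elim: quotientE)

lemma formal_smult_closed:
  "s \<in> carrier S \<Longrightarrow> m \<in> formal_sums M N \<Longrightarrow> formal_smult M s m \<in> formal_sums M N"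
  by (auto simp: formal_sums_def formal_smult_def intro!: M.smult_closed)

text \<open>Makes the scalar action on classes well defined: each generating relation stays a
  relation of the same kind after its left entries are scaled.\<close>

lemma formal_smult_cong:
  assumes s: "s \<in> carrier S"
  shows "(m, m') \<in> tensor_cong S M N \<Longrightarrow> (formal_smult M s m, formal_smult M s m') \<in> tensor_cong S M N"
proof (induction rule: tensor_cong.induct)
  case (balanced t x y)
  \<comment> \<open>Scaling touches the left entries only, so \<open>s\<close> has to move past the
    \<open>t\<close> of the balanced relation; this is commutativity of \<open>S\<close>.\<close>
  have "s \<odot>\<^bsub>M\<^esub> (t \<odot>\<^bsub>M\<^esub> x) = t \<odot>\<^bsub>M\<^esub> (s \<odot>\<^bsub>M\<^esub> x)"
    using balanced s by (simp add: M.smult_assoc1[symmetric] M.S.m_comm)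
  then show ?case
    using balanced s by (simp add: tensor_cong.balanced M.smult_closed)
next
  case (trans m m' m'')
  then show ?case by (blast intro: tensor_cong.trans)
next
  case (sym m m')
  then show ?case by (blast intro: tensor_cong.sym)
qed (use s in \<open>simp_all add: tensor_cong.refl tensor_cong.plus tensor_cong.add_left tensor_cong.add_right
      tensor_cong.zero_left tensor_cong.zero_right formal_smult_closed M.smult_closed M.smult_r_distr
      M.smult_r_null\<close>)

lemma tensor_zero: "\<zero>\<^bsub>tensor S M N\<^esub> = tensor_class {#}"
  by (simp add: tensor_def)

lemma tensor_class_add:
  assumes m: "m \<in> formal_sums M N" and n: "n \<in> formal_sums M N"
  shows "tensor_class m \<oplus>\<^bsub>tensor S M N\<^esub> tensor_class n = tensor_class (m + n)"
proof -
  have *: "tensor_class (m' + n') = tensor_class (m + n)"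
    if "m' \<in> tensor_class m" "n' \<in> tensor_class n" for m' n'
    using that by (intro tensor_class_eq[symmetric] tensor_cong.plus) simp_all
  have "m \<in> tensor_class m" "n \<in> tensor_class n"
    using m n by (simp_all add: tensor_cong.refl)
  \<comment> \<open>The union in the definition of the sum runs over all representatives. They all
    yield the same class, and there is at least one, so the union collapses.\<close>
  then have "(\<Union>m'\<in>tensor_class m. \<Union>n'\<in>tensor_class n. tensor_class (m' + n')) = tensor_class (m + n)"
    by (intro UN_constant_eq[of m] UN_constant_eq[of n] ballI *)
  then show ?thesis
    by (simp add: tensor_def)
qed

lemma tensor_class_smult:
  assumes s: "s \<in> carrier S" and m: "m \<in> formal_sums M N"
  shows "s \<odot>\<^bsub>tensor S M N\<^esub> tensor_class m = tensor_class (formal_smult M s m)"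
proof -
  have *: "tensor_class (formal_smult M s m') = tensor_class (formal_smult M s m)"
    if "m' \<in> tensor_class m" for m'
    using that s by (intro tensor_class_eq[symmetric] formal_smult_cong) simp_all
  have "m \<in> tensor_class m"
    using m by (simp add: tensor_cong.refl)
  then have "(\<Union>m'\<in>tensor_class m. tensor_class (formal_smult M s m')) = tensor_class (formal_smult M s m)"
    by (intro UN_constant_eq[of m] ballI *)
  then show ?thesis
    by (simp add: tensor_def formal_smult_def)
qed

lemma pure_tensor_carrier [simp]:
  "x \<in> carrier M \<Longrightarrow> y \<in> carrier N \<Longrightarrow> pure_tensor S M N x y \<in> carrier (tensor S M N)"
  by (simp add: pure_tensor_def)

lemma tensor_induct [consumes 1, case_names zero pure add]:
  assumes "X \<in> carrier (tensor S M N)"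
    and "P \<zero>\<^bsub>tensor S M N\<^esub>"
    and pure: "\<And>x y. x \<in> carrier M \<Longrightarrow> y \<in> carrier N \<Longrightarrow> P (pure_tensor S M N x y)"
    and add: "\<And>X Y. X \<in> carrier (tensor S M N) \<Longrightarrow> Y \<in> carrier (tensor S M N) \<Longrightarrow> P X \<Longrightarrow> P Y \<Longrightarrow>
      P (X \<oplus>\<^bsub>tensor S M N\<^esub> Y)"
  shows "P X"
proof -
  obtain m where "m \<in> formal_sums M N" "X = tensor_class m"
    using assms(1) by (rule tensor_class_cases)
  moreover have "m \<in> formal_sums M N \<Longrightarrow> P (tensor_class m)"
  proof (induction m)
    case empty
    then show ?case using assms(2) by (simp add: tensor_zero)
  next
    case (add q m)
    obtain x y where q: "q = (x, y)" by (cases q)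
    have "P (tensor_class {#q#} \<oplus>\<^bsub>tensor S M N\<^esub> tensor_class m)"
      using add pure by (intro assms(4)) (auto simp: q pure_tensor_def)
    then show ?case
      using add by (simp add: q tensor_class_add)
  qed
  ultimately show ?thesis by simp
qed

lemma semimodule_tensor: "semimodule S (tensor S M N)"
proof -
  let ?T = "tensor S M N"
  have am: "abelian_monoid ?T"
  proof (rule abelian_monoidI)
    show "\<zero>\<^bsub>?T\<^esub> \<in> carrier ?T"
      by (simp add: tensor_zero)
  qed (auto elim!: tensor_class_cases simp: tensor_zero tensor_class_add add_ac)
  interpret T: abelian_monoid ?T by fact
  have closed: "s \<odot>\<^bsub>?T\<^esub> X \<in> carrier ?T" if "s \<in> carrier S" "X \<in> carrier ?T" for s X
    using that by (auto elim!: tensor_class_cases simp: tensor_class_smult formal_smult_closed)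
  have r_distr: "s \<odot>\<^bsub>?T\<^esub> (X \<oplus>\<^bsub>?T\<^esub> Y) = s \<odot>\<^bsub>?T\<^esub> X \<oplus>\<^bsub>?T\<^esub> s \<odot>\<^bsub>?T\<^esub> Y"
    if "s \<in> carrier S" "X \<in> carrier ?T" "Y \<in> carrier ?T" for s X Y
    using that
    by (auto elim!: tensor_class_cases simp: tensor_class_smult formal_smult_closed tensor_class_add)
  have r_null: "s \<odot>\<^bsub>?T\<^esub> \<zero>\<^bsub>?T\<^esub> = \<zero>\<^bsub>?T\<^esub>" if "s \<in> carrier S" for s
    using that by (simp add: tensor_class_smult tensor_zero)
  have smult_pure: "s \<odot>\<^bsub>?T\<^esub> pure_tensor S M N x y = pure_tensor S M N (s \<odot>\<^bsub>M\<^esub> x) y"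
    if "s \<in> carrier S" "x \<in> carrier M" "y \<in> carrier N" for s x y
    using that by (simp add: pure_tensor_def tensor_class_smult)
  have l_distr: "(s \<oplus>\<^bsub>S\<^esub> t) \<odot>\<^bsub>?T\<^esub> X = s \<odot>\<^bsub>?T\<^esub> X \<oplus>\<^bsub>?T\<^esub> t \<odot>\<^bsub>?T\<^esub> X"
    if "s \<in> carrier S" "t \<in> carrier S" "X \<in> carrier ?T" for s t X
    using that(3)
  proof (induction rule: tensor_induct)
    case (pure x y)
    then have "tensor_class {#(s \<odot>\<^bsub>M\<^esub> x \<oplus>\<^bsub>M\<^esub> t \<odot>\<^bsub>M\<^esub> x, y)#} =
        tensor_class {#(s \<odot>\<^bsub>M\<^esub> x, y), (t \<odot>\<^bsub>M\<^esub> x, y)#}"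
      using that by (intro tensor_class_eq tensor_cong.add_left) (auto simp: M.smult_closed)
    then show ?case
      using pure that
      by (simp add: smult_pure M.smult_l_distr) (simp add: pure_tensor_def tensor_class_add M.smult_closed add_mset_commute)
  qed (use that in \<open>simp_all add: r_null r_distr closed T.a_ac\<close>)
  have assoc: "(s \<otimes>\<^bsub>S\<^esub> t) \<odot>\<^bsub>?T\<^esub> X = s \<odot>\<^bsub>?T\<^esub> (t \<odot>\<^bsub>?T\<^esub> X)"
    if "s \<in> carrier S" "t \<in> carrier S" "X \<in> carrier ?T" for s t X
    using that(3)
    by (induction rule: tensor_induct)
      (use that in \<open>simp_all add: r_null r_distr closed smult_pure M.smult_assoc1 M.smult_closed\<close>)
  have one: "\<one>\<^bsub>S\<^esub> \<odot>\<^bsub>?T\<^esub> X = X" if "X \<in> carrier ?T" for X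
    using that
    by (induction rule: tensor_induct) (simp_all add: r_null r_distr closed smult_pure M.smult_one)
  \<comment> \<open>In the absence of cancellation this does not follow from distributivity; on pure
    tensors it comes from the generator \<open>zero_left\<close>.\<close>
  have l_null: "\<zero>\<^bsub>S\<^esub> \<odot>\<^bsub>?T\<^esub> X = \<zero>\<^bsub>?T\<^esub>" if "X \<in> carrier ?T" for X
    using that
  proof (induction rule: tensor_induct)
    case (pure x y)
    then show ?case
      by (simp add: smult_pure M.smult_l_null)
        (simp add: pure_tensor_def tensor_zero tensor_class_eq tensor_cong.zero_left)
  qed (simp_all add: r_null r_distr closed)
  show ?thesis
    by (intro semimodule.intro semimodule_axioms.intro am M.commutative_semiring_axioms
        closed r_distr r_null l_distr assoc one l_null)
qed

section \<open>The universal property of the tensor product\<close>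

interpretation T: semimodule S "tensor S M N" by (rule semimodule_tensor)

lemma pure_tensor_bilinear: "pure_tensor S M N \<in> bilinear_maps S M N (tensor S M N)"
proof (intro bilinear_mapsI linear_mapsI)
  fix s x y assume s: "s \<in> carrier S" and x: "x \<in> carrier M" and y: "y \<in> carrier N"
  have "tensor_class {#(s \<odot>\<^bsub>M\<^esub> x, y)#} = tensor_class {#(x, s \<odot>\<^bsub>N\<^esub> y)#}"
    using s x y by (intro tensor_class_eq tensor_cong.balanced)
  then show "pure_tensor S M N (s \<odot>\<^bsub>M\<^esub> x) y = s \<odot>\<^bsub>tensor S M N\<^esub> pure_tensor S M N x y"
    "pure_tensor S M N x (s \<odot>\<^bsub>N\<^esub> y) = s \<odot>\<^bsub>tensor S M N\<^esub> pure_tensor S M N x y"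
    using s x y by (simp_all add: pure_tensor_def tensor_class_smult)
next
  fix x y y' assume "x \<in> carrier M" "y \<in> carrier N" "y' \<in> carrier N"
  moreover from this have "tensor_class {#(x, y \<oplus>\<^bsub>N\<^esub> y')#} = tensor_class {#(x, y), (x, y')#}"
    by (intro tensor_class_eq tensor_cong.add_right)
  ultimately show "pure_tensor S M N x (y \<oplus>\<^bsub>N\<^esub> y') =
      pure_tensor S M N x y \<oplus>\<^bsub>tensor S M N\<^esub> pure_tensor S M N x y'"
    by (simp add: pure_tensor_def tensor_class_add add_mset_commute)
next
  fix x x' y assume "x \<in> carrier M" "x' \<in> carrier M" "y \<in> carrier N"
  moreover from this have "tensor_class {#(x \<oplus>\<^bsub>M\<^esub> x', y)#} = tensor_class {#(x, y), (x', y)#}"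
    by (intro tensor_class_eq tensor_cong.add_left)
  ultimately show "pure_tensor S M N (x \<oplus>\<^bsub>M\<^esub> x') y =
      pure_tensor S M N x y \<oplus>\<^bsub>tensor S M N\<^esub> pure_tensor S M N x' y"
    by (simp add: pure_tensor_def tensor_class_add add_mset_commute)
qed auto

text \<open>The uniqueness half of the universal property, valid because pure tensors generate
  additively. Most identities below are reduced to pure tensors by it, one tensor argument at a
  time.\<close>

lemma tensor_ext:
  assumes P: "semimodule S P"
    and f: "f \<in> linear_maps S (tensor S M N) P" and g: "g \<in> linear_maps S (tensor S M N) P"
    and "\<And>x y. x \<in> carrier M \<Longrightarrow> y \<in> carrier N \<Longrightarrow> f (pure_tensor S M N x y) = g (pure_tensor S M N x y)"
    and "X \<in> carrier (tensor S M N)"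
  shows "f X = g X"
  using assms(5)
  by (induction rule: tensor_induct)
    (simp_all add: linear_zero[OF semimodule_tensor P f] linear_zero[OF semimodule_tensor P g]
      linear_add[OF f] linear_add[OF g] assms(4))

text \<open>The defining sum runs over the support of \<open>m\<close>, which varies with
  \<open>m\<close>. Padding with terms of multiplicity zero gives several formal sums a common index
  set, so that their values can be added termwise.\<close>

lemma formal_sum_value_superset:
  assumes P: "semimodule S P" and \<beta>: "\<beta> \<in> bilinear_maps S M N P"
    and "finite B" "set_mset m \<subseteq> B" "B \<subseteq> carrier M \<times> carrier N"
  shows "formal_sum_value P \<beta> m = (\<Oplus>\<^bsub>P\<^esub>q\<in>B. [count m q] \<cdot>\<^bsub>P\<^esub> \<beta> (fst q) (snd q))"
proof -
  interpret P: semimodule S P by fact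
  show ?thesis
    unfolding formal_sum_value_def
    using assms(3-5)
    by (intro P.M.add.finprod_mono_neutral_cong)
      (auto simp: not_in_iff intro!: P.M.add.nat_pow_closed bilinear_closed[OF \<beta>])
qed

lemma formal_sum_value_plus:
  assumes P: "semimodule S P" and \<beta>: "\<beta> \<in> bilinear_maps S M N P"
    and m: "m \<in> formal_sums M N" and n: "n \<in> formal_sums M N"
  shows "formal_sum_value P \<beta> (m + n) = formal_sum_value P \<beta> m \<oplus>\<^bsub>P\<^esub> formal_sum_value P \<beta> n"
proof -
  interpret P: semimodule S P by fact
  define B where "B = set_mset (m + n)"
  have B: "B \<subseteq> carrier M \<times> carrier N"
    using m n by (auto simp: B_def formal_sums_def)
  then have cl: "\<beta> (fst q) (snd q) \<in> carrier P" if "q \<in> B" for q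
    using that by (auto intro!: bilinear_closed[OF \<beta>])
  have *: "formal_sum_value P \<beta> k = (\<Oplus>\<^bsub>P\<^esub>q\<in>B. [count k q] \<cdot>\<^bsub>P\<^esub> \<beta> (fst q) (snd q))" if "set_mset k \<subseteq> B" for k
    using that B by (intro formal_sum_value_superset P \<beta>) (auto simp: B_def)
  have "formal_sum_value P \<beta> (m + n) = (\<Oplus>\<^bsub>P\<^esub>q\<in>B. [count m q] \<cdot>\<^bsub>P\<^esub> \<beta> (fst q) (snd q) \<oplus>\<^bsub>P\<^esub>
      [count n q] \<cdot>\<^bsub>P\<^esub> \<beta> (fst q) (snd q))"
    unfolding *[of "m + n", unfolded B_def[symmetric], OF order.refl]
    by (intro P.M.finsum_cong') (auto simp: P.M.add.nat_pow_mult cl)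
  also have "\<dots> = formal_sum_value P \<beta> m \<oplus>\<^bsub>P\<^esub> formal_sum_value P \<beta> n"
  proof -
    have "set_mset m \<subseteq> B" "set_mset n \<subseteq> B"
      by (auto simp: B_def)
    then show ?thesis
      unfolding *[OF \<open>set_mset m \<subseteq> B\<close>] *[OF \<open>set_mset n \<subseteq> B\<close>]
      by (intro P.M.finsum_addf) (auto simp: cl)
  qed
  finally show ?thesis .
qed

lemma formal_sum_value_empty:
  assumes P: "semimodule S P"
  shows "formal_sum_value P \<beta> {#} = \<zero>\<^bsub>P\<^esub>"
proof -
  interpret P: semimodule S P by fact
  show ?thesis by (simp add: formal_sum_value_def)
qed

lemma formal_sum_value_single:
  assumes P: "semimodule S P" and "\<beta> x y \<in> carrier P"
  shows "formal_sum_value P \<beta> {#(x, y)#} = \<beta> x y"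
proof -
  interpret P: semimodule S P by fact
  show ?thesis using assms(2) by (simp add: formal_sum_value_def P.M.add.nat_pow_closed)
qed

lemma formal_sum_value_closed:
  assumes P: "semimodule S P" and \<beta>: "\<beta> \<in> bilinear_maps S M N P"
    and m: "m \<in> formal_sums M N"
  shows "formal_sum_value P \<beta> m \<in> carrier P"
proof -
  interpret P: semimodule S P by fact
  show ?thesis
    unfolding formal_sum_value_def using m
    by (auto intro!: P.M.finsum_closed P.M.add.nat_pow_closed bilinear_closed[OF \<beta>]
        simp: formal_sums_def)
qed

text \<open>The existence half of the universal property: bilinearity of \<open>\<beta>\<close> is
  exactly compatibility with the generating relations, the two zero relations being covered by
  \<open>linear_zero\<close> in each argument.\<close>

lemma formal_sum_value_cong:
  assumes P: "semimodule S P" and \<beta>: "\<beta> \<in> bilinear_maps S M N P"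
  shows "(m, m') \<in> tensor_cong S M N \<Longrightarrow> formal_sum_value P \<beta> m = formal_sum_value P \<beta> m'"
proof -
  interpret P: semimodule S P by fact
  show "(m, m') \<in> tensor_cong S M N \<Longrightarrow> formal_sum_value P \<beta> m = formal_sum_value P \<beta> m'"
  proof (induction rule: tensor_cong.induct)
    case (plus m m' n n')
    then show ?case
      by (metis formal_sum_value_plus[OF P \<beta>] tensor_cong_formal_sums)
  next
    case (add_left x x' y)
    have "formal_sum_value P \<beta> ({#(x, y)#} + {#(x', y)#}) = \<beta> x y \<oplus>\<^bsub>P\<^esub> \<beta> x' y"
      using add_left by (subst formal_sum_value_plus[OF P \<beta>])
        (simp_all add: formal_sum_value_single[OF P] bilinear_closed[OF \<beta>])
    then show ?case
      using add_left linear_add[OF bilinear_left[OF \<beta>]]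
      by (simp add: formal_sum_value_single[OF P] bilinear_closed[OF \<beta>] add_mset_commute)
  next
    case (add_right x y y')
    have "formal_sum_value P \<beta> ({#(x, y)#} + {#(x, y')#}) = \<beta> x y \<oplus>\<^bsub>P\<^esub> \<beta> x y'"
      using add_right by (subst formal_sum_value_plus[OF P \<beta>])
        (simp_all add: formal_sum_value_single[OF P] bilinear_closed[OF \<beta>])
    then show ?case
      using add_right linear_add[OF bilinear_right[OF \<beta>]]
      by (simp add: formal_sum_value_single[OF P] bilinear_closed[OF \<beta>] add_mset_commute)
  next
    case (zero_left y)
    then show ?case
      using linear_zero[OF M P bilinear_left[OF \<beta>]]
      by (simp add: formal_sum_value_single[OF P] formal_sum_value_empty[OF P] bilinear_closed[OF \<beta>])
  next
    case (zero_right x)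
    then show ?case
      using linear_zero[OF N P bilinear_right[OF \<beta>]]
      by (simp add: formal_sum_value_single[OF P] formal_sum_value_empty[OF P] bilinear_closed[OF \<beta>])
  next
    case (balanced s x y)
    then have "\<beta> (s \<odot>\<^bsub>M\<^esub> x) y = \<beta> x (s \<odot>\<^bsub>N\<^esub> y)"
      using linear_smult[OF bilinear_right[OF \<beta>]] linear_smult[OF bilinear_left[OF \<beta>]] by simp
    then show ?case
      using balanced
      by (simp add: formal_sum_value_single[OF P] bilinear_closed[OF \<beta>] M.smult_closed N.smult_closed)
  qed auto
qed

context
  fixes P :: "('s, 'c, 'p) module_scheme" and \<beta> :: "'a \<Rightarrow> 'b \<Rightarrow> 'c"
  assumes P: "semimodule S P" and \<beta>: "\<beta> \<in> bilinear_maps S M N P"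
begin

interpretation P: semimodule S P by (fact P)

lemma tensor_lift_class:
  assumes "m \<in> formal_sums M N"
  shows "tensor_lift P \<beta> (tensor_class m) = formal_sum_value P \<beta> m"
proof -
  \<comment> \<open>\<open>the_elem\<close> is meaningful since all representatives have the same
    value and \<open>m\<close> is one of them by reflexivity.\<close>
  have "formal_sum_value P \<beta> ` tensor_class m = {formal_sum_value P \<beta> m}"
    using formal_sum_value_cong[OF P \<beta>] assms by (force intro: tensor_cong.refl)
  then show ?thesis
    by (simp add: tensor_lift_def)
qed

lemma tensor_lift_pure:
  "x \<in> carrier M \<Longrightarrow> y \<in> carrier N \<Longrightarrow> tensor_lift P \<beta> (pure_tensor S M N x y) = \<beta> x y"
  by (simp add: pure_tensor_def tensor_lift_class formal_sum_value_single[OF P] bilinear_closed[OF \<beta>])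

lemma tensor_lift_add:
  assumes "X \<in> carrier (tensor S M N)" "Y \<in> carrier (tensor S M N)"
  shows "tensor_lift P \<beta> (X \<oplus>\<^bsub>tensor S M N\<^esub> Y) = tensor_lift P \<beta> X \<oplus>\<^bsub>P\<^esub> tensor_lift P \<beta> Y"
  using assms by (auto elim!: tensor_class_cases
      simp: tensor_class_add tensor_lift_class formal_sum_value_plus[OF P \<beta>])

lemma tensor_lift_zero: "tensor_lift P \<beta> \<zero>\<^bsub>tensor S M N\<^esub> = \<zero>\<^bsub>P\<^esub>"
  by (simp add: tensor_zero tensor_lift_class formal_sum_value_empty[OF P])

lemma tensor_lift_closed: "X \<in> carrier (tensor S M N) \<Longrightarrow> tensor_lift P \<beta> X \<in> carrier P"
  by (auto elim!: tensor_class_cases simp: tensor_lift_class formal_sum_value_closed[OF P \<beta>])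

lemma tensor_lift_linear: "tensor_lift P \<beta> \<in> linear_maps S (tensor S M N) P"
proof (intro linear_mapsI tensor_lift_add tensor_lift_closed)
  fix s X assume s: "s \<in> carrier S" and "X \<in> carrier (tensor S M N)"
  from this(2) show "tensor_lift P \<beta> (s \<odot>\<^bsub>tensor S M N\<^esub> X) = s \<odot>\<^bsub>P\<^esub> tensor_lift P \<beta> X"
  proof (induction rule: tensor_induct)
    case (pure x y)
    have "s \<odot>\<^bsub>tensor S M N\<^esub> pure_tensor S M N x y = pure_tensor S M N (s \<odot>\<^bsub>M\<^esub> x) y"
      using linear_smult[OF bilinear_left[OF pure_tensor_bilinear]] pure s by simp
    then show ?case
      using linear_smult[OF bilinear_left[OF \<beta>]] pure s
      by (simp add: tensor_lift_pure M.smult_closed)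
  qed (use s in \<open>simp_all add: T.smult_r_null P.smult_r_null tensor_lift_zero T.smult_r_distr
        tensor_lift_add T.smult_closed P.smult_r_distr tensor_lift_closed\<close>)
qed

end

text \<open>Allows \<open>\<beta>\<close> and \<open>\<gamma>\<close> to differ off the carriers, as
  a functional and its restriction do. Bilinearity of \<open>\<beta>\<close> is inherited from
  \<open>\<gamma>\<close>.\<close>

lemma tensor_lift_cong:
  assumes "\<And>x y. x \<in> carrier M \<Longrightarrow> y \<in> carrier N \<Longrightarrow> \<beta> x y = \<gamma> x y"
    and P: "semimodule S P" and \<gamma>: "\<gamma> \<in> bilinear_maps S M N P"
    and "X \<in> carrier (tensor S M N)"
  shows "tensor_lift P \<beta> X = tensor_lift P \<gamma> X"
proof -
  have \<beta>: "\<beta> \<in> bilinear_maps S M N P"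
  proof (rule bilinear_mapsI)
    show "(\<lambda>y. \<beta> x y) \<in> linear_maps S N P" if "x \<in> carrier M" for x
      by (rule linear_cong[OF bilinear_right[OF \<gamma> that] N]) (simp add: assms(1) that)
    show "(\<lambda>x. \<beta> x y) \<in> linear_maps S M P" if "y \<in> carrier N" for y
      by (rule linear_cong[OF bilinear_left[OF \<gamma> that] M]) (simp add: assms(1) that)
  qed
  show ?thesis
    by (rule tensor_ext[OF P tensor_lift_linear[OF P \<beta>] tensor_lift_linear[OF P \<gamma>] _ assms(4)])
      (simp add: tensor_lift_pure[OF P \<beta>] tensor_lift_pure[OF P \<gamma>] assms(1))
qed

text \<open>Fixes the tensor and varies the bilinear map. This is what makes nested lifts, such as
  those in \<open>associator\<close> and \<open>interchange\<close>, linear in their outer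
  variables; it holds by additivity in \<open>X\<close> from the case of pure tensors.\<close>

lemma tensor_lift_linear_param:
  assumes Z: "semimodule S Z" and P: "semimodule S P"
    and \<beta>: "\<And>z. z \<in> carrier Z \<Longrightarrow> \<beta> z \<in> bilinear_maps S M N P"
    and lin: "\<And>x y. x \<in> carrier M \<Longrightarrow> y \<in> carrier N \<Longrightarrow> (\<lambda>z. \<beta> z x y) \<in> linear_maps S Z P"
    and X: "X \<in> carrier (tensor S M N)"
  shows "(\<lambda>z. tensor_lift P (\<beta> z) X) \<in> linear_maps S Z P"
proof -
  interpret Z: semimodule S Z by fact
  interpret P: semimodule S P by fact
  show ?thesis
  proof (rule linear_mapsI)
    fix z z' assume z: "z \<in> carrier Z" "z' \<in> carrier Z"
    note z' = z Z.M.a_closed[OF z]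
    show "tensor_lift P (\<beta> (z \<oplus>\<^bsub>Z\<^esub> z')) X = tensor_lift P (\<beta> z) X \<oplus>\<^bsub>P\<^esub> tensor_lift P (\<beta> z') X"
      using X
      by (induction rule: tensor_induct)
        (use z' in \<open>simp_all add: tensor_lift_zero[OF P \<beta>] tensor_lift_pure[OF P \<beta>] tensor_lift_add[OF P \<beta>]
            linear_add[OF lin] tensor_lift_closed[OF P \<beta>] P.M.a_ac\<close>)
  next
    fix s z assume z: "s \<in> carrier S" "z \<in> carrier Z"
    note z' = z Z.smult_closed[OF z]
    show "tensor_lift P (\<beta> (s \<odot>\<^bsub>Z\<^esub> z)) X = s \<odot>\<^bsub>P\<^esub> tensor_lift P (\<beta> z) X"
      using X
      by (induction rule: tensor_induct)
        (use z' in \<open>simp_all add: tensor_lift_zero[OF P \<beta>] tensor_lift_pure[OF P \<beta>] tensor_lift_add[OF P \<beta>]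
            linear_smult[OF lin] tensor_lift_closed[OF P \<beta>] P.smult_r_distr P.smult_r_null\<close>)
  qed (use X tensor_lift_closed[OF P \<beta>] in simp)
qed

end

text \<open>\<open>canonical_map\<close> lifts into \<open>S\<close> as a ring, while the universal
  property speaks of the semimodule \<open>regular S\<close>. Lifting uses only the additive
  structure of the target, where the two agree.\<close>

lemma tensor_lift_regular: "tensor_lift (regular S) \<beta> = tensor_lift S \<beta>"
proof -
  have "finsum (regular S) h B = finsum S h B" for h :: "'x \<Rightarrow> _" and B
    by (simp add: finsum_def finprod_def)
  moreover have "[k] \<cdot>\<^bsub>regular S\<^esub> x = [k] \<cdot>\<^bsub>S\<^esub> x" for k :: nat and x
    by (simp add: add_pow_def nat_pow_def)
  ultimately have "formal_sum_value (regular S) \<beta> m = formal_sum_value S \<beta> m" for m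
    by (simp add: formal_sum_value_def)
  then show ?thesis
    by (simp add: tensor_lift_def fun_eq_iff)
qed

text \<open>
  Goals \<open>f \<in> linear_maps S M N\<close> are solved by resolution with these rules from left to right. Hence a
  premise fixing semimodules that the conclusion leaves open must precede their side conditions
  \<open>semimodule S M\<close>, on which resolution would otherwise diverge.
\<close>

named_theorems linear_intros

declare linear_ident [linear_intros] semimodule_tensor [linear_intros]
  semimodule_regular [linear_intros] pure_tensor_carrier [linear_intros]

lemma linear_smult_right [linear_intros]:
  assumes N: "semimodule S N" and f: "f \<in> linear_maps S Z (regular S)" and y: "y \<in> carrier N"
  shows "(\<lambda>z. f z \<odot>\<^bsub>N\<^esub> y) \<in> linear_maps S Z N"
proof -
  interpret N: semimodule S N by fact
  show ?thesis
    using y linear_closed[OF f] linear_add[OF f] linear_smult[OF f]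
    by (intro linear_mapsI) (simp_all add: N.smult_closed N.smult_l_distr N.smult_assoc1)
qed

lemma linear_smult_left [linear_intros]:
  assumes N: "semimodule S N" and f: "f \<in> linear_maps S Z N" and s: "s \<in> carrier S"
  shows "(\<lambda>z. s \<odot>\<^bsub>N\<^esub> f z) \<in> linear_maps S Z N"
proof -
  interpret N: semimodule S N by fact
  show ?thesis
    using s linear_closed[OF f] linear_add[OF f] linear_smult[OF f]
    by (intro linear_mapsI)
      (simp_all add: N.smult_closed N.smult_r_distr N.smult_assoc1[symmetric] N.S.m_comm)
qed

lemma linear_mult_right [linear_intros]:
  assumes "commutative_semiring S" and "f \<in> linear_maps S Z (regular S)" and "s \<in> carrier S"
  shows "(\<lambda>z. f z \<otimes>\<^bsub>S\<^esub> s) \<in> linear_maps S Z (regular S)"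
  using linear_smult_right[OF semimodule_regular[OF assms(1)] assms(2)] assms(3) by simp

lemma linear_mult_left [linear_intros]:
  assumes "commutative_semiring S" and "f \<in> linear_maps S Z (regular S)" and "s \<in> carrier S"
  shows "(\<lambda>z. s \<otimes>\<^bsub>S\<^esub> f z) \<in> linear_maps S Z (regular S)"
  using linear_smult_left[OF semimodule_regular[OF assms(1)] assms(2)] assms(3) by simp

lemma linear_pure_left [linear_intros]:
  assumes "semimodule S M" "semimodule S N" "f \<in> linear_maps S Z M" "y \<in> carrier N"
  shows "(\<lambda>z. pure_tensor S M N (f z) y) \<in> linear_maps S Z (tensor S M N)"
  using assms by (intro linear_compose[OF _ bilinear_left[OF pure_tensor_bilinear]])

lemma linear_pure_right [linear_intros]:
  assumes "semimodule S M" "semimodule S N" "f \<in> linear_maps S Z N" "x \<in> carrier M"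
  shows "(\<lambda>z. pure_tensor S M N x (f z)) \<in> linear_maps S Z (tensor S M N)"
  using assms by (intro linear_compose[OF _ bilinear_right[OF pure_tensor_bilinear]])

lemma tensor_map_bilinear:
  assumes "semimodule S P" "semimodule S Q" "f \<in> linear_maps S M P" "g \<in> linear_maps S N Q"
  shows "(\<lambda>x y. pure_tensor S P Q (f x) (g y)) \<in> bilinear_maps S M N (tensor S P Q)"
  using assms by (auto intro!: bilinear_mapsI linear_intros intro: linear_closed)

lemma tensor_map_pure:
  assumes "semimodule S M" "semimodule S N" "semimodule S P" "semimodule S Q"
    and "f \<in> linear_maps S M P" "g \<in> linear_maps S N Q"
    and "x \<in> carrier M" "y \<in> carrier N"
  shows "tensor_map S P Q f g (pure_tensor S M N x y) = pure_tensor S P Q (f x) (g y)"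
  unfolding tensor_map_def using assms
  by (intro tensor_lift_pure[OF _ _ _ tensor_map_bilinear] semimodule_tensor)

lemma linear_tensor_map [linear_intros]:
  assumes "h \<in> linear_maps S Z (tensor S M N)"
    and "semimodule S M" "semimodule S N" "semimodule S P" "semimodule S Q"
    and "f \<in> linear_maps S M P" "g \<in> linear_maps S N Q"
  shows "(\<lambda>z. tensor_map S P Q f g (h z)) \<in> linear_maps S Z (tensor S P Q)"
  unfolding tensor_map_def using assms
  by (intro linear_compose[OF assms(1) tensor_lift_linear[OF _ _ _ tensor_map_bilinear]] semimodule_tensor)

text \<open>The pattern behind nested lifts: linearity in \<open>X\<close> is that of a lift,
  linearity in \<open>z\<close> is that of a lift depending on a parameter.\<close>

lemma tensor_lift_bilinear_left:
  assumes "semimodule S M" "semimodule S N" "semimodule S Z" "semimodule S P"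
    and "\<And>z. z \<in> carrier Z \<Longrightarrow> (\<lambda>x y. \<beta> x y z) \<in> bilinear_maps S M N P"
    and "\<And>x y. x \<in> carrier M \<Longrightarrow> y \<in> carrier N \<Longrightarrow> (\<lambda>z. \<beta> x y z) \<in> linear_maps S Z P"
  shows "(\<lambda>X z. tensor_lift P (\<lambda>x y. \<beta> x y z) X) \<in> bilinear_maps S (tensor S M N) Z P"
  by (rule bilinear_mapsI; rule tensor_lift_linear[OF assms(1,2)] tensor_lift_linear_param[OF assms(1,2)])
    (simp_all add: assms)

section \<open>The associator\<close>

context
  fixes S :: "('s, 'r) ring_scheme" and M :: "('s, 'a, 'm) module_scheme"
    and N :: "('s, 'b, 'n) module_scheme" and P :: "('s, 'c, 'p) module_scheme"
  assumes M: "semimodule S M" and N: "semimodule S N" and P: "semimodule S P"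
begin

lemma associator_inner_bilinear:
  "z \<in> carrier P \<Longrightarrow> (\<lambda>x y. pure_tensor S M (tensor S N P) x (pure_tensor S N P y z))
    \<in> bilinear_maps S M N (tensor S M (tensor S N P))"
  using M N P by (intro bilinear_mapsI linear_intros)

lemma associator_bilinear:
  "(\<lambda>X z. tensor_lift (tensor S M (tensor S N P))
      (\<lambda>x y. pure_tensor S M (tensor S N P) x (pure_tensor S N P y z)) X)
    \<in> bilinear_maps S (tensor S M N) P (tensor S M (tensor S N P))"
  using M N P by (intro tensor_lift_bilinear_left[OF M N] associator_inner_bilinear linear_intros)

lemma associator_pure:
  assumes "x \<in> carrier M" "y \<in> carrier N" "z \<in> carrier P"
  shows "associator S M N P (pure_tensor S (tensor S M N) P (pure_tensor S M N x y) z) =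
    pure_tensor S M (tensor S N P) x (pure_tensor S N P y z)"
  unfolding associator_def using M N P assms
  by (simp add: tensor_lift_pure[OF _ _ _ associator_bilinear] tensor_lift_pure[OF _ _ _ associator_inner_bilinear]
      semimodule_tensor pure_tensor_carrier)

lemma linear_associator [linear_intros]:
  "f \<in> linear_maps S Z (tensor S (tensor S M N) P) \<Longrightarrow>
    (\<lambda>z. associator S M N P (f z)) \<in> linear_maps S Z (tensor S M (tensor S N P))"
  unfolding associator_def using M N P
  by (intro linear_compose[OF _ tensor_lift_linear[OF _ _ _ associator_bilinear]] semimodule_tensor)

end

section \<open>The unitors\<close>

context
  fixes S :: "('s, 'r) ring_scheme" and M :: "('s, 'a, 'm) module_scheme"
  assumes M: "semimodule S M"
begin

interpretation M: semimodule S M by (fact M)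

lemma left_unitor_bilinear: "(\<lambda>s x. s \<odot>\<^bsub>M\<^esub> x) \<in> bilinear_maps S (regular S) M M"
  using M by (intro bilinear_mapsI linear_intros) simp_all

lemma right_unitor_bilinear: "(\<lambda>x s. s \<odot>\<^bsub>M\<^esub> x) \<in> bilinear_maps S M (regular S) M"
  using M by (intro bilinear_mapsI linear_intros) simp_all

lemma left_unitor_pure:
  "s \<in> carrier S \<Longrightarrow> x \<in> carrier M \<Longrightarrow> left_unitor M (pure_tensor S (regular S) M s x) = s \<odot>\<^bsub>M\<^esub> x"
  unfolding left_unitor_def using M semimodule_regular[OF M.commutative_semiring_axioms]
  by (simp add: tensor_lift_pure[OF _ _ _ left_unitor_bilinear])

lemma right_unitor_pure:
  "s \<in> carrier S \<Longrightarrow> x \<in> carrier M \<Longrightarrow> right_unitor M (pure_tensor S M (regular S) x s) = s \<odot>\<^bsub>M\<^esub> x"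
  unfolding right_unitor_def using M semimodule_regular[OF M.commutative_semiring_axioms]
  by (simp add: tensor_lift_pure[OF _ _ _ right_unitor_bilinear])

lemma linear_left_unitor [linear_intros]:
  "f \<in> linear_maps S Z (tensor S (regular S) M) \<Longrightarrow> (\<lambda>z. left_unitor M (f z)) \<in> linear_maps S Z M"
  unfolding left_unitor_def using M semimodule_regular[OF M.commutative_semiring_axioms]
  by (intro linear_compose[OF _ tensor_lift_linear[OF _ _ _ left_unitor_bilinear]])

lemma linear_right_unitor [linear_intros]:
  "f \<in> linear_maps S Z (tensor S M (regular S)) \<Longrightarrow> (\<lambda>z. right_unitor M (f z)) \<in> linear_maps S Z M"
  unfolding right_unitor_def using M semimodule_regular[OF M.commutative_semiring_axioms]
  by (intro linear_compose[OF _ tensor_lift_linear[OF _ _ _ right_unitor_bilinear]])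

end

section \<open>The interchange of the middle factors\<close>

context
  fixes S :: "('s, 'r) ring_scheme" and M :: "('s, 'a, 'm) module_scheme"
    and N :: "('s, 'b, 'n) module_scheme"
  assumes M: "semimodule S M" and N: "semimodule S N"
begin

abbreviation "interchange_target \<equiv> tensor S (tensor S M M) (tensor S N N)"

abbreviation "interchange_pure x y x' y' \<equiv>
  pure_tensor S (tensor S M M) (tensor S N N) (pure_tensor S M M x x') (pure_tensor S N N y y')"

text \<open>This lemma and the next two treat the three nested lifts in \<open>interchange\<close>
  from the inside out: in \<open>(x', y')\<close>, then in \<open>(x, y)\<close>, then in the two
  tensors.\<close>

lemma interchange_bilinear1:
  "x \<in> carrier M \<Longrightarrow> y \<in> carrier N \<Longrightarrow> interchange_pure x y \<in> bilinear_maps S M N interchange_target"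
  using M N by (intro bilinear_mapsI linear_intros)

lemma interchange_bilinear2:
  "Y \<in> carrier (tensor S M N) \<Longrightarrow> (\<lambda>x y. tensor_lift interchange_target (interchange_pure x y) Y)
    \<in> bilinear_maps S M N interchange_target"
  using M N
  by (intro bilinear_mapsI tensor_lift_linear_param[OF M N] interchange_bilinear1 linear_intros)

lemma interchange_bilinear3:
  "(\<lambda>X Y. tensor_lift interchange_target
      (\<lambda>x y. tensor_lift interchange_target (interchange_pure x y) Y) X)
    \<in> bilinear_maps S (tensor S M N) (tensor S M N) interchange_target"
  using M N
  by (intro tensor_lift_bilinear_left[OF M N] interchange_bilinear2 tensor_lift_linear[OF M N]
      interchange_bilinear1 semimodule_tensor)

lemma interchange_pure:
  assumes "x \<in> carrier M" "y \<in> carrier N" "x' \<in> carrier M" "y' \<in> carrier N"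
  shows "interchange S M N (pure_tensor S (tensor S M N) (tensor S M N)
    (pure_tensor S M N x y) (pure_tensor S M N x' y')) = interchange_pure x y x' y'"
  unfolding interchange_def Let_def using M N assms
  by (simp add: tensor_lift_pure[OF _ _ _ interchange_bilinear3]
      tensor_lift_pure[OF _ _ _ interchange_bilinear2] tensor_lift_pure[OF _ _ _ interchange_bilinear1]
      semimodule_tensor pure_tensor_carrier)

lemma linear_interchange [linear_intros]:
  "f \<in> linear_maps S Z (tensor S (tensor S M N) (tensor S M N)) \<Longrightarrow>
    (\<lambda>z. interchange S M N (f z)) \<in> linear_maps S Z interchange_target"
  unfolding interchange_def Let_def using M N
  by (intro linear_compose[OF _ tensor_lift_linear[OF _ _ _ interchange_bilinear3]] semimodule_tensor)

end

section \<open>The pairing of functionals with tensors\<close>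

text \<open>The functional that the canonical map assigns to \<open>f \<otimes> g\<close>, but
  without the restriction to the carrier, so that it composes freely with other maps.\<close>

definition pairing ::
  "('s, 'r) ring_scheme \<Rightarrow> ('a \<Rightarrow> 's) \<Rightarrow> ('b \<Rightarrow> 's) \<Rightarrow> ('a, 'b) tensor \<Rightarrow> 's"
  where "pairing S f g = tensor_lift S (\<lambda>x y. f x \<otimes>\<^bsub>S\<^esub> g y)"

lemma pairing_conv_regular: "pairing S f g = tensor_lift (regular S) (\<lambda>x y. f x \<otimes>\<^bsub>S\<^esub> g y)"
  by (simp add: pairing_def tensor_lift_regular)

context
  fixes S :: "('s, 'r) ring_scheme" and M :: "('s, 'a, 'm) module_scheme"
    and N :: "('s, 'b, 'n) module_scheme"
  assumes M: "semimodule S M" and N: "semimodule S N"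
begin

lemma pairing_bilinear:
  assumes "f \<in> linear_maps S M (regular S)" "g \<in> linear_maps S N (regular S)"
  shows "(\<lambda>x y. f x \<otimes>\<^bsub>S\<^esub> g y) \<in> bilinear_maps S M N (regular S)"
  using assms linear_closed[OF assms(1)] linear_closed[OF assms(2)] semimodule_scalars[OF M]
  by (intro bilinear_mapsI linear_intros) simp_all

lemma pairing_pure:
  assumes "f \<in> linear_maps S M (regular S)" "g \<in> linear_maps S N (regular S)"
    and "x \<in> carrier M" "y \<in> carrier N"
  shows "pairing S f g (pure_tensor S M N x y) = f x \<otimes>\<^bsub>S\<^esub> g y"
  unfolding pairing_conv_regular using M N assms semimodule_scalars[OF M]
  by (intro tensor_lift_pure[OF _ _ _ pairing_bilinear] semimodule_regular)

lemma linear_pairing: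
  assumes "f \<in> linear_maps S M (regular S)" "g \<in> linear_maps S N (regular S)"
    and "h \<in> linear_maps S Z (tensor S M N)"
  shows "(\<lambda>z. pairing S f g (h z)) \<in> linear_maps S Z (regular S)"
  unfolding pairing_conv_regular using M N assms semimodule_scalars[OF M]
  by (intro linear_compose[OF _ tensor_lift_linear[OF _ _ _ pairing_bilinear]] semimodule_regular)

text \<open>Used to exchange a restricted functional, such as a product in the dual, for the
  unrestricted expression that it equals on the carrier.\<close>

lemma pairing_cong:
  assumes "\<And>x. x \<in> carrier M \<Longrightarrow> f x = f' x" "\<And>y. y \<in> carrier N \<Longrightarrow> g y = g' y"
    and "f' \<in> linear_maps S M (regular S)" "g' \<in> linear_maps S N (regular S)"
    and "X \<in> carrier (tensor S M N)"
  shows "pairing S f g X = pairing S f' g' X"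
  unfolding pairing_conv_regular using M N assms semimodule_scalars[OF M]
  by (intro tensor_lift_cong[OF M N _ _ pairing_bilinear] semimodule_regular) simp_all

text \<open>Here the tensor is fixed and the functional varies. Linearity of \<open>F\<close> is
  required only pointwise, which is how evaluation at elements of a dual supplies it.\<close>

lemma linear_pairing_left:
  assumes Z: "semimodule S Z" and F: "\<And>z. z \<in> carrier Z \<Longrightarrow> F z \<in> linear_maps S M (regular S)"
    and lin: "\<And>x. x \<in> carrier M \<Longrightarrow> (\<lambda>z. F z x) \<in> linear_maps S Z (regular S)"
    and g: "g \<in> linear_maps S N (regular S)" and X: "X \<in> carrier (tensor S M N)"
  shows "(\<lambda>z. pairing S (F z) g X) \<in> linear_maps S Z (regular S)"
  unfolding pairing_conv_regular
  using linear_closed[OF g] semimodule_scalars[OF M] X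
  by (intro tensor_lift_linear_param[OF M N Z] semimodule_regular pairing_bilinear F g linear_mult_right lin)
    simp_all

lemma linear_pairing_right:
  assumes Z: "semimodule S Z" and G: "\<And>z. z \<in> carrier Z \<Longrightarrow> G z \<in> linear_maps S N (regular S)"
    and lin: "\<And>y. y \<in> carrier N \<Longrightarrow> (\<lambda>z. G z y) \<in> linear_maps S Z (regular S)"
    and f: "f \<in> linear_maps S M (regular S)" and X: "X \<in> carrier (tensor S M N)"
  shows "(\<lambda>z. pairing S f (G z) X) \<in> linear_maps S Z (regular S)"
  unfolding pairing_conv_regular
  using linear_closed[OF f] semimodule_scalars[OF M] X
  by (intro tensor_lift_linear_param[OF M N Z] semimodule_regular pairing_bilinear G f linear_mult_left lin)
    simp_all

end

text \<open>The conclusion does not determine \<open>M\<close> and \<open>N\<close>; linearity of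
  \<open>h\<close> does, and is therefore moved to the front.\<close>

lemmas [linear_intros] = linear_pairing[rotated 4]

lemmas [linear_intros] =
  linear_tensor_map[OF linear_ident] linear_associator[OF _ _ _ linear_ident]
  linear_left_unitor[OF _ linear_ident] linear_right_unitor[OF _ linear_ident]
  linear_interchange[OF _ _ linear_ident] linear_pairing[OF _ _ _ _ linear_ident]

text \<open>Naturality of the pairing: on a pure tensor both sides are the product of
  \<open>f (p x)\<close> and \<open>g (q y)\<close>.\<close>

lemma pairing_tensor_map:
  assumes M: "semimodule S M" and N: "semimodule S N" and P: "semimodule S P" and Q: "semimodule S Q"
    and f: "f \<in> linear_maps S P (regular S)" and g: "g \<in> linear_maps S Q (regular S)"
    and p: "p \<in> linear_maps S M P" and q: "q \<in> linear_maps S N Q"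
    and X: "X \<in> carrier (tensor S M N)"
  shows "pairing S f g (tensor_map S P Q p q X) = pairing S (\<lambda>x. f (p x)) (\<lambda>y. g (q y)) X"
proof (rule tensor_ext[OF M N semimodule_regular[OF semimodule_scalars[OF M]] _ _ _ X])
  show "(\<lambda>X. pairing S f g (tensor_map S P Q p q X)) \<in> linear_maps S (tensor S M N) (regular S)"
    by (rule assms linear_intros)+
  have fp: "(\<lambda>x. f (p x)) \<in> linear_maps S M (regular S)" and gq: "(\<lambda>y. g (q y)) \<in> linear_maps S N (regular S)"
    using linear_compose[OF p f] linear_compose[OF q g] .
  show "pairing S (\<lambda>x. f (p x)) (\<lambda>y. g (q y)) \<in> linear_maps S (tensor S M N) (regular S)"
    using linear_pairing[OF M N fp gq linear_ident] .
  fix x y assume "x \<in> carrier M" "y \<in> carrier N"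
  then show "pairing S f g (tensor_map S P Q p q (pure_tensor S M N x y)) =
      pairing S (\<lambda>x. f (p x)) (\<lambda>y. g (q y)) (pure_tensor S M N x y)"
    by (simp add: tensor_map_pure[OF M N P Q p q] pairing_pure[OF M N fp gq] pairing_pure[OF P Q f g]
        linear_closed[OF p] linear_closed[OF q])
qed

text \<open>On pure tensors this is associativity of multiplication in \<open>S\<close>. It later
  turns coassociativity in \<open>A\<close> into associativity in the dual.\<close>

lemma pairing_associator:
  assumes M: "semimodule S M" and N: "semimodule S N" and P: "semimodule S P"
    and f: "f \<in> linear_maps S M (regular S)" and g: "g \<in> linear_maps S N (regular S)"
    and h: "h \<in> linear_maps S P (regular S)"
    and X: "X \<in> carrier (tensor S (tensor S M N) P)"
  shows "pairing S f (pairing S g h) (associator S M N P X) = pairing S (pairing S f g) h X"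
proof -
  have S: "commutative_semiring S"
    by (rule semimodule_scalars[OF M])
  interpret commutative_semiring S by fact
  note rules = M N P S f g h semimodule_tensor semimodule_regular
  note lin = rules linear_intros
  show ?thesis
  proof (rule tensor_ext[OF semimodule_tensor[OF M N] P semimodule_regular[OF S] _ _ _ X])
    show "(\<lambda>X. pairing S f (pairing S g h) (associator S M N P X))
        \<in> linear_maps S (tensor S (tensor S M N) P) (regular S)"
      by (rule lin)+
    show "pairing S (pairing S f g) h \<in> linear_maps S (tensor S (tensor S M N) P) (regular S)"
      by (rule lin)+
    fix Y z assume Y: "Y \<in> carrier (tensor S M N)" and z: "z \<in> carrier P"
    show "pairing S f (pairing S g h) (associator S M N P (pure_tensor S (tensor S M N) P Y z)) =
        pairing S (pairing S f g) h (pure_tensor S (tensor S M N) P Y z)"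
    \<comment> \<open>A pure tensor of the outer product still has an arbitrary tensor
      \<open>Y\<close> as its left entry, so extensionality is applied a second time.\<close>
    proof (rule tensor_ext[OF M N semimodule_regular[OF S] _ _ _ Y])
      show "(\<lambda>Y. pairing S f (pairing S g h) (associator S M N P (pure_tensor S (tensor S M N) P Y z)))
          \<in> linear_maps S (tensor S M N) (regular S)"
        by (rule z lin)+
      show "(\<lambda>Y. pairing S (pairing S f g) h (pure_tensor S (tensor S M N) P Y z))
          \<in> linear_maps S (tensor S M N) (regular S)"
        by (rule z lin)+
      fix x y assume x: "x \<in> carrier M" and y: "y \<in> carrier N"
      have fg: "pairing S f g \<in> linear_maps S (tensor S M N) (regular S)"
        and gh: "pairing S g h \<in> linear_maps S (tensor S N P) (regular S)"
        by (rule lin)+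
      show "pairing S f (pairing S g h) (associator S M N P
            (pure_tensor S (tensor S M N) P (pure_tensor S M N x y) z)) =
          pairing S (pairing S f g) h (pure_tensor S (tensor S M N) P (pure_tensor S M N x y) z)"
        using x y z linear_closed[OF f x] linear_closed[OF g y] linear_closed[OF h z]
        by (simp add: associator_pure[OF M N P] pairing_pure[OF M semimodule_tensor[OF N P] f gh]
            pairing_pure[OF N P g h] pairing_pure[OF semimodule_tensor[OF M N] P fg h]
            pairing_pure[OF M N f g] pure_tensor_carrier[OF M N] pure_tensor_carrier[OF N P] m_assoc)
    qed
  qed
qed

section \<open>Duals\<close>

lemma dual_apply [simp]:
  "x \<in> carrier M \<Longrightarrow> (f \<oplus>\<^bsub>dual S M\<^esub> g) x = f x \<oplus>\<^bsub>S\<^esub> g x"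
  "x \<in> carrier M \<Longrightarrow> (s \<odot>\<^bsub>dual S M\<^esub> f) x = s \<otimes>\<^bsub>S\<^esub> f x"
  "x \<in> carrier M \<Longrightarrow> \<zero>\<^bsub>dual S M\<^esub> x = \<zero>\<^bsub>S\<^esub>"
  by (simp_all add: dual_def)

lemma dual_linear: "f \<in> carrier (dual S M) \<Longrightarrow> f \<in> linear_maps S M (regular S)"
  by (simp add: dual_def)

lemma dual_closed: "f \<in> carrier (dual S M) \<Longrightarrow> x \<in> carrier M \<Longrightarrow> f x \<in> carrier S"
  using linear_closed[OF dual_linear] by fastforce

lemma dual_eqI:
  assumes "f \<in> carrier (dual S M)" "g \<in> carrier (dual S M)"
    and "\<And>x. x \<in> carrier M \<Longrightarrow> f x = g x"
  shows "f = g"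
  using assms by (auto simp: dual_def intro: extensionalityI)

lemma restrict_in_dual:
  assumes "semimodule S M" "f \<in> linear_maps S M (regular S)"
  shows "restrict f (carrier M) \<in> carrier (dual S M)"
  using assms by (auto simp: dual_def intro: linear_cong)

lemma semimodule_dual:
  assumes M: "semimodule S M"
  shows "semimodule S (dual S M)"
proof -
  interpret M: semimodule S M by fact
  have S: "commutative_semiring S" by (rule M.commutative_semiring_axioms)
  interpret R: semimodule S "regular S" by (rule semimodule_regular[OF S])
  let ?D = "dual S M"
  have ext: "f \<oplus>\<^bsub>?D\<^esub> g \<in> extensional (carrier M)" "s \<odot>\<^bsub>?D\<^esub> f \<in> extensional (carrier M)"
    "\<zero>\<^bsub>?D\<^esub> \<in> extensional (carrier M)" for f g s
    by (simp_all add: dual_def)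
  have add: "f \<oplus>\<^bsub>?D\<^esub> g \<in> carrier ?D" if "f \<in> carrier ?D" "g \<in> carrier ?D" for f g
  proof -
    note l = dual_linear[OF that(1)] dual_linear[OF that(2)]
    have "(\<lambda>x\<in>carrier M. f x \<oplus>\<^bsub>S\<^esub> g x) \<in> carrier ?D"
      using l[THEN linear_closed] l[THEN linear_add] l[THEN linear_smult]
      by (intro restrict_in_dual M linear_mapsI) (simp_all add: M.S.a_ac M.S.r_distr)
    then show ?thesis by (simp add: dual_def)
  qed
  \<comment> \<open>A scalar multiple of a functional is again linear because \<open>S\<close> is
    commutative.\<close>
  have smult: "s \<odot>\<^bsub>?D\<^esub> f \<in> carrier ?D" if "s \<in> carrier S" "f \<in> carrier ?D" for s f
    using restrict_in_dual[OF M linear_mult_left[OF S dual_linear[OF that(2)] that(1)]]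
    by (simp add: dual_def)
  have zero: "\<zero>\<^bsub>?D\<^esub> \<in> carrier ?D"
  proof -
    have "(\<lambda>x\<in>carrier M. \<zero>\<^bsub>S\<^esub>) \<in> carrier ?D"
      by (intro restrict_in_dual M linear_mapsI) simp_all
    then show ?thesis by (simp add: dual_def)
  qed
  have am: "abelian_monoid ?D"
    by (rule abelian_monoidI; (rule dual_eqI[of _ S M])?)
      (simp_all add: add zero dual_closed[of _ S M] M.S.a_ac)
  show ?thesis
    by (intro semimodule.intro semimodule_axioms.intro am S smult; (rule dual_eqI[of _ S M])?)
      (simp_all add: add smult zero dual_closed[of _ S M] M.S.l_distr M.S.r_distr M.S.m_assoc)
qed

declare semimodule_dual [linear_intros] dual_linear [linear_intros]

lemma linear_eval_dual:
  assumes "x \<in> carrier M" "F \<in> linear_maps S Z (dual S M)"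
  shows "(\<lambda>z. F z x) \<in> linear_maps S Z (regular S)"
  using assms(1) linear_closed[OF assms(2)] linear_add[OF assms(2)] linear_smult[OF assms(2)]
  by (intro linear_mapsI) (simp_all add: dual_closed[of _ S M])

text \<open>Equality in the dual is tested at points, so linearity of every evaluation suffices.
  That the values lie in the dual is a separate premise: linearity in \<open>z\<close> says nothing
  about \<open>F z\<close> as a function of \<open>x\<close>.\<close>

lemma linear_into_dual:
  assumes Z: "semimodule S Z" and M: "semimodule S M"
    and F: "\<And>z. z \<in> carrier Z \<Longrightarrow> F z \<in> carrier (dual S M)"
    and lin: "\<And>x. x \<in> carrier M \<Longrightarrow> (\<lambda>z. F z x) \<in> linear_maps S Z (regular S)"
  shows "F \<in> linear_maps S Z (dual S M)"
proof -
  interpret Z: semimodule S Z by fact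
  interpret D: semimodule S "dual S M" by (rule semimodule_dual[OF M])
  show ?thesis
    by (rule linear_mapsI F; (rule dual_eqI[of _ S M])?)
      (simp_all add: F Z.smult_closed D.smult_closed linear_add[OF lin] linear_smult[OF lin])
qed

lemma dual_map_closed:
  assumes "semimodule S M" "f \<in> linear_maps S M N" "\<phi> \<in> carrier (dual S N)"
  shows "dual_map M f \<phi> \<in> carrier (dual S M)"
  unfolding dual_map_def
  using restrict_in_dual[OF assms(1) linear_compose[OF assms(2) dual_linear[OF assms(3)]]] .

lemma linear_dual_map:
  assumes M: "semimodule S M" and N: "semimodule S N" and f: "f \<in> linear_maps S M N"
    and G: "G \<in> linear_maps S Z (dual S N)" and Z: "semimodule S Z"
  shows "(\<lambda>z. dual_map M f (G z)) \<in> linear_maps S Z (dual S M)"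
proof (rule linear_into_dual[OF Z M])
  show "dual_map M f (G z) \<in> carrier (dual S M)" if "z \<in> carrier Z" for z
    by (rule dual_map_closed[OF M f linear_closed[OF G that]])
  show "(\<lambda>z. dual_map M f (G z) x) \<in> linear_maps S Z (regular S)" if "x \<in> carrier M" for x
    using linear_eval_dual[OF linear_closed[OF f that] G] that by (simp add: dual_map_def)
qed

lemma dual_map_apply: "x \<in> carrier M \<Longrightarrow> dual_map M f \<phi> x = \<phi> (f x)"
  by (simp add: dual_map_def)

text \<open>A functional on \<open>S\<close> is multiplication by its value at one. Evaluation at
  one is thus injective, and the preimage picked by \<open>inv_into\<close> is the one exhibited
  here.\<close>

lemma eval_one_inv_eq:
  assumes S: "commutative_semiring S" and s: "s \<in> carrier S"
  shows "eval_one_inv S s = (\<lambda>x\<in>carrier S. s \<otimes>\<^bsub>S\<^esub> x)"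
proof -
  interpret commutative_semiring S by fact
  have inj: "inj_on (eval_one S) (carrier (dual S (regular S)))"
  proof (rule inj_onI, rule dual_eqI)
    fix f g x
    assume fg: "f \<in> carrier (dual S (regular S))" "g \<in> carrier (dual S (regular S))"
      and eq: "eval_one S f = eval_one S g" and "x \<in> carrier (regular S)"
    then have x: "x \<in> carrier S" by simp
    then show "f x = g x"
      using linear_smult[OF dual_linear[OF fg(1)] x, of "\<one>\<^bsub>S\<^esub>"]
        linear_smult[OF dual_linear[OF fg(2)] x, of "\<one>\<^bsub>S\<^esub>"] eq
      by (simp add: eval_one_def)
  qed
  have "(\<lambda>x\<in>carrier S. s \<otimes>\<^bsub>S\<^esub> x) \<in> carrier (dual S (regular S))"
    using restrict_in_dual[OF semimodule_regular[OF S] linear_mult_left[OF S linear_ident s]] by simp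
  from inv_into_f_f[OF inj this] show ?thesis
    using s by (simp add: eval_one_inv_def eval_one_def)
qed

text \<open>The contraction \<open>ev(a) \<otimes> id : A\<^sup>* \<otimes> N \<rightarrow> S \<otimes> N \<cong> N\<close>.\<close>

definition contract ::
  "('s, 'b, 'n) module_scheme \<Rightarrow> 'a \<Rightarrow> ('a \<Rightarrow> 's, 'b) tensor \<Rightarrow> 'b"
  where "contract N a = tensor_lift N (\<lambda>f y. f a \<odot>\<^bsub>N\<^esub> y)"

context
  fixes S :: "('s, 'r) ring_scheme" and A :: "('s, 'a, 'm) module_scheme"
    and N :: "('s, 'b, 'n) module_scheme"
  assumes A: "semimodule S A" and N: "semimodule S N"
begin

lemma contract_bilinear:
  assumes a: "a \<in> carrier A"
  shows "(\<lambda>f y. f a \<odot>\<^bsub>N\<^esub> y) \<in> bilinear_maps S (dual S A) N N"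
proof (rule bilinear_mapsI)
  show "(\<lambda>y. f a \<odot>\<^bsub>N\<^esub> y) \<in> linear_maps S N N" if "f \<in> carrier (dual S A)" for f
    using dual_closed[OF that a] by (intro linear_smult_left[OF N linear_ident])
  show "(\<lambda>f. f a \<odot>\<^bsub>N\<^esub> y) \<in> linear_maps S (dual S A) N" if "y \<in> carrier N" for y
    using that by (intro linear_smult_right[OF N] linear_eval_dual[OF a linear_ident])
qed

lemma contract_pure:
  "a \<in> carrier A \<Longrightarrow> f \<in> carrier (dual S A) \<Longrightarrow> y \<in> carrier N \<Longrightarrow>
    contract N a (pure_tensor S (dual S A) N f y) = f a \<odot>\<^bsub>N\<^esub> y"
  unfolding contract_def
  by (rule tensor_lift_pure[OF semimodule_dual[OF A] N N contract_bilinear])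

lemma linear_contract:
  "h \<in> linear_maps S Z (tensor S (dual S A) N) \<Longrightarrow> a \<in> carrier A \<Longrightarrow>
    (\<lambda>z. contract N a (h z)) \<in> linear_maps S Z N"
  unfolding contract_def
  by (rule linear_compose[OF _ tensor_lift_linear[OF semimodule_dual[OF A] N N contract_bilinear]])

end

lemmas [linear_intros] = linear_contract[rotated 2]

section \<open>Finite dual bases\<close>

text \<open>The \<open>e j\<close> may be linearly dependent, as images of a basis under a
  projection are; \<open>\<xi>\<close> is one linear choice of coefficients.\<close>

definition dual_basis ::
  "('s, 'r) ring_scheme \<Rightarrow> ('s, 'a, 'm) module_scheme \<Rightarrow> 'i set \<Rightarrow> ('i \<Rightarrow> 'a) \<Rightarrow> ('i \<Rightarrow> 'a \<Rightarrow> 's) \<Rightarrow> bool"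
  where "dual_basis S A J e \<xi> \<longleftrightarrow>
    finite J \<and> e \<in> J \<rightarrow> carrier A \<and> \<xi> \<in> J \<rightarrow> carrier (dual S A) \<and>
    (\<forall>x\<in>carrier A. x = (\<Oplus>\<^bsub>A\<^esub>j\<in>J. \<xi> j x \<odot>\<^bsub>A\<^esub> e j))"

locale dual_basis_semimodule =
  fixes S :: "('s, 'r) ring_scheme" and A :: "('s, 'a, 'm) module_scheme" and J :: "'i set" and e \<xi>
  assumes A: "semimodule S A" and dual_basis: "dual_basis S A J e \<xi>"
begin

abbreviation "D \<equiv> dual S A"
abbreviation "AA \<equiv> tensor S A A"
abbreviation "DD \<equiv> tensor S D D"

lemma S: "commutative_semiring S"
  by (rule semimodule_scalars[OF A])

lemma R: "semimodule S (regular S)"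
  by (rule semimodule_regular[OF S])

lemma D: "semimodule S D"
  by (rule semimodule_dual[OF A])

lemma AA: "semimodule S AA"
  by (rule semimodule_tensor[OF A A])

lemma DD: "semimodule S DD"
  by (rule semimodule_tensor[OF D D])

sublocale S: commutative_semiring S by (rule S)
sublocale D: semimodule S D by (rule D)

lemma basis_closed: "j \<in> J \<Longrightarrow> e j \<in> carrier A"
  and cobasis_closed: "j \<in> J \<Longrightarrow> \<xi> j \<in> carrier D"
  using dual_basis by (auto simp: dual_basis_def)

lemma basis_expansion: "x \<in> carrier A \<Longrightarrow> (\<Oplus>\<^bsub>A\<^esub>j\<in>J. \<xi> j x \<odot>\<^bsub>A\<^esub> e j) = x"
  using dual_basis by (simp add: dual_basis_def)

lemma basis_scaled_closed: "x \<in> carrier A \<Longrightarrow> (\<lambda>j. \<xi> j x \<odot>\<^bsub>A\<^esub> e j) \<in> J \<rightarrow> carrier A"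
  using semimodule.smult_closed[OF A dual_closed[OF cobasis_closed] basis_closed] by auto

text \<open>Applying \<open>\<phi>\<close> to the expansion of \<open>x\<close> gives
  \<open>\<phi> x\<close> as the sum of the \<open>\<xi> j x\<close> with coefficients
  \<open>\<phi> (e j)\<close>. Hence the \<open>\<xi> j\<close> generate the dual, with coefficients
  again obtained by evaluation.\<close>

lemma cobasis_expansion:
  assumes \<phi>: "\<phi> \<in> carrier D"
  shows "(\<Oplus>\<^bsub>D\<^esub>j\<in>J. \<phi> (e j) \<odot>\<^bsub>D\<^esub> \<xi> j) = \<phi>"
proof (rule dual_eqI)
  have cl: "(\<lambda>j. \<phi> (e j) \<odot>\<^bsub>D\<^esub> \<xi> j) \<in> J \<rightarrow> carrier D"
    using D.smult_closed[OF dual_closed[OF \<phi> basis_closed] cobasis_closed] by auto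
  then show "(\<Oplus>\<^bsub>D\<^esub>j\<in>J. \<phi> (e j) \<odot>\<^bsub>D\<^esub> \<xi> j) \<in> carrier D"
    by (rule D.M.finsum_closed)
  fix x assume x: "x \<in> carrier A"
  have "(\<Oplus>\<^bsub>D\<^esub>j\<in>J. \<phi> (e j) \<odot>\<^bsub>D\<^esub> \<xi> j) x = (\<Oplus>\<^bsub>regular S\<^esub>j\<in>J. (\<phi> (e j) \<odot>\<^bsub>D\<^esub> \<xi> j) x)"
    by (rule linear_finsum[OF D R linear_eval_dual[OF x linear_ident] cl])
  also have "\<dots> = (\<Oplus>\<^bsub>regular S\<^esub>j\<in>J. \<phi> (\<xi> j x \<odot>\<^bsub>A\<^esub> e j))"
    using x basis_closed cobasis_closed dual_closed[OF \<phi>] dual_closed[of _ S A x]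
    by (intro abelian_monoid.finsum_cong'[OF semimodule_abelian_monoid[OF R]])
      (auto simp: linear_smult[OF dual_linear[OF \<phi>]] S.m_comm)
  also have "\<dots> = \<phi> (\<Oplus>\<^bsub>A\<^esub>j\<in>J. \<xi> j x \<odot>\<^bsub>A\<^esub> e j)"
    by (rule linear_finsum[OF A R dual_linear[OF \<phi>] basis_scaled_closed[OF x], symmetric])
  finally show "(\<Oplus>\<^bsub>D\<^esub>j\<in>J. \<phi> (e j) \<odot>\<^bsub>D\<^esub> \<xi> j) x = \<phi> x"
    by (simp add: basis_expansion x)
qed (rule \<phi>)

text \<open>For \<open>X = \<phi> \<otimes> y\<close> the \<open>j\<close>-th term is
  \<open>\<xi> j \<otimes> \<phi> (e j) y\<close>. Moving the scalar across the tensor sign and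
  summing in the left entry gives \<open>\<phi> \<otimes> y\<close> by
  \<open>cobasis_expansion\<close>; both sides are linear in \<open>X\<close>.\<close>

lemma tensor_expansion:
  assumes N: "semimodule S N" and X: "X \<in> carrier (tensor S D N)"
  shows "(\<Oplus>\<^bsub>tensor S D N\<^esub>j\<in>J. pure_tensor S D N (\<xi> j) (contract N (e j) X)) = X"
proof (rule tensor_ext[OF D N semimodule_tensor[OF D N] _ linear_ident _ X])
  have T: "semimodule S (tensor S D N)"
    by (rule semimodule_tensor[OF D N])
  show "(\<lambda>X. \<Oplus>\<^bsub>tensor S D N\<^esub>j\<in>J. pure_tensor S D N (\<xi> j) (contract N (e j) X))
      \<in> linear_maps S (tensor S D N) (tensor S D N)"
    by (rule linear_finsum_pointwise[OF T T])
      (rule linear_pure_right[OF D N linear_contract[OF A N linear_ident basis_closed] cobasis_closed])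
  fix \<phi> y assume \<phi>: "\<phi> \<in> carrier D" and y: "y \<in> carrier N"
  have cl: "\<phi> (e j) \<odot>\<^bsub>D\<^esub> \<xi> j \<in> carrier D" if "j \<in> J" for j
    using D.smult_closed[OF dual_closed[OF \<phi> basis_closed] cobasis_closed] that by auto
  have "(\<Oplus>\<^bsub>tensor S D N\<^esub>j\<in>J. pure_tensor S D N (\<xi> j) (contract N (e j) (pure_tensor S D N \<phi> y))) =
      (\<Oplus>\<^bsub>tensor S D N\<^esub>j\<in>J. pure_tensor S D N (\<phi> (e j) \<odot>\<^bsub>D\<^esub> \<xi> j) y)"
    using \<phi> y cl basis_closed cobasis_closed
    by (intro abelian_monoid.finsum_cong'[OF semimodule_abelian_monoid[OF T]])
      (auto simp: contract_pure[OF A N] semimodule.smult_closed[OF T] pure_tensor_carrier[OF D N] dual_closed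
        linear_smult[OF bilinear_left[OF pure_tensor_bilinear[OF D N]]]
        linear_smult[OF bilinear_right[OF pure_tensor_bilinear[OF D N]]])
  also have "\<dots> = pure_tensor S D N (\<Oplus>\<^bsub>D\<^esub>j\<in>J. \<phi> (e j) \<odot>\<^bsub>D\<^esub> \<xi> j) y"
    using cl by (intro linear_finsum[OF D T linear_pure_left[OF D N linear_ident y], symmetric]) auto
  finally show "(\<Oplus>\<^bsub>tensor S D N\<^esub>j\<in>J. pure_tensor S D N (\<xi> j) (contract N (e j) (pure_tensor S D N \<phi> y))) =
      pure_tensor S D N \<phi> y"
    by (simp add: cobasis_expansion \<phi>)
qed

text \<open>The expansion recovers a tensor from its contractions, so it compares two elements
  directly, where a triviality of kernels would not be enough.\<close>

lemma tensor_eqI: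
  assumes N: "semimodule S N" and X: "X \<in> carrier (tensor S D N)" and Y: "Y \<in> carrier (tensor S D N)"
    and eq: "\<And>a. a \<in> carrier A \<Longrightarrow> contract N a X = contract N a Y"
  shows "X = Y"
proof -
  have "(\<Oplus>\<^bsub>tensor S D N\<^esub>j\<in>J. pure_tensor S D N (\<xi> j) (contract N (e j) X)) =
      (\<Oplus>\<^bsub>tensor S D N\<^esub>j\<in>J. pure_tensor S D N (\<xi> j) (contract N (e j) Y))"
    using Y by (intro abelian_monoid.finsum_cong'[OF semimodule_abelian_monoid[OF semimodule_tensor[OF D N]]])
      (auto simp: eq basis_closed intro!: pure_tensor_carrier[OF D N] cobasis_closed
        linear_closed[OF linear_contract[OF A N linear_ident]])
  then show ?thesis
    by (simp add: tensor_expansion[OF N X] tensor_expansion[OF N Y])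
qed

lemma DD_eqI:
  assumes X: "X \<in> carrier DD" and Y: "Y \<in> carrier DD"
    and eq: "\<And>a b. a \<in> carrier A \<Longrightarrow> b \<in> carrier A \<Longrightarrow> contract D a X b = contract D a Y b"
  shows "X = Y"
proof (rule tensor_eqI[OF D X Y])
  fix a assume a: "a \<in> carrier A"
  note cl = linear_closed[OF linear_contract[OF A D linear_ident a]]
  show "contract D a X = contract D a Y"
    by (rule dual_eqI[OF cl[OF X] cl[OF Y] eq[OF a]])
qed

end

section \<open>The canonical map\<close>

context
  fixes S :: "('s, 'r) ring_scheme" and M :: "('s, 'a, 'm) module_scheme"
    and N :: "('s, 'b, 'n) module_scheme"
  assumes M: "semimodule S M" and N: "semimodule S N"
begin

lemma canonical_map_bilinear:
  "(\<lambda>f g. \<lambda>t\<in>carrier (tensor S M N). pairing S f g t)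
    \<in> bilinear_maps S (dual S M) (dual S N) (dual S (tensor S M N))"
proof (rule bilinear_mapsI)
  note T = semimodule_tensor[OF M N]
  have cl: "(\<lambda>t\<in>carrier (tensor S M N). pairing S f g t) \<in> carrier (dual S (tensor S M N))"
    if "f \<in> carrier (dual S M)" "g \<in> carrier (dual S N)" for f g
    by (rule restrict_in_dual T that M N linear_intros)+
  show "(\<lambda>g. \<lambda>t\<in>carrier (tensor S M N). pairing S f g t)
      \<in> linear_maps S (dual S N) (dual S (tensor S M N))" if f: "f \<in> carrier (dual S M)" for f
  proof (rule linear_into_dual[OF semimodule_dual[OF N] T cl[OF f]])
    show "(\<lambda>g. (\<lambda>t\<in>carrier (tensor S M N). pairing S f g t) t) \<in> linear_maps S (dual S N) (regular S)"
      if t: "t \<in> carrier (tensor S M N)" for t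
      using linear_pairing_right[OF M N semimodule_dual[OF N] dual_linear
          linear_eval_dual[OF _ linear_ident] dual_linear[OF f] t] t by simp
  qed
  show "(\<lambda>f. \<lambda>t\<in>carrier (tensor S M N). pairing S f g t)
      \<in> linear_maps S (dual S M) (dual S (tensor S M N))" if g: "g \<in> carrier (dual S N)" for g
  proof (rule linear_into_dual[OF semimodule_dual[OF M] T cl[OF _ g]])
    show "(\<lambda>f. (\<lambda>t\<in>carrier (tensor S M N). pairing S f g t) t) \<in> linear_maps S (dual S M) (regular S)"
      if t: "t \<in> carrier (tensor S M N)" for t
      using linear_pairing_left[OF M N semimodule_dual[OF M] dual_linear
          linear_eval_dual[OF _ linear_ident] dual_linear[OF g] t] t by simp
  qed
qed

lemma linear_canonical_map:
  assumes "h \<in> linear_maps S Z (tensor S (dual S M) (dual S N))"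
  shows "(\<lambda>z. canonical_map S M N (h z)) \<in> linear_maps S Z (dual S (tensor S M N))"
  unfolding canonical_map_def pairing_def[symmetric]
  by (rule linear_compose[OF assms tensor_lift_linear[OF _ _ _ canonical_map_bilinear]])
    (rule M N linear_intros)+

lemma canonical_map_pure:
  assumes f: "f \<in> carrier (dual S M)" and g: "g \<in> carrier (dual S N)" and t: "t \<in> carrier (tensor S M N)"
  shows "canonical_map S M N (pure_tensor S (dual S M) (dual S N) f g) t = pairing S f g t"
proof -
  have "canonical_map S M N (pure_tensor S (dual S M) (dual S N) f g) =
      (\<lambda>t\<in>carrier (tensor S M N). pairing S f g t)"
    unfolding canonical_map_def pairing_def[symmetric]
    by (rule tensor_lift_pure[OF _ _ _ canonical_map_bilinear]) (rule M N f g linear_intros)+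
  then show ?thesis
    using t by simp
qed

lemma linear_canonical_map_apply:
  assumes "h \<in> linear_maps S Z (tensor S (dual S M) (dual S N))" and "t \<in> carrier (tensor S M N)"
  shows "(\<lambda>z. canonical_map S M N (h z) t) \<in> linear_maps S Z (regular S)"
  by (rule linear_eval_dual[OF assms(2) linear_canonical_map[OF assms(1)]])

lemma canonical_map_closed:
  "X \<in> carrier (tensor S (dual S M) (dual S N)) \<Longrightarrow> canonical_map S M N X \<in> carrier (dual S (tensor S M N))"
  by (rule linear_closed[OF linear_canonical_map[OF linear_ident]])

text \<open>Both sides are \<open>f a\<close> times \<open>g b\<close> on
  \<open>f \<otimes> g\<close>. This identifies the image under the canonical map with the data that
  determine an element of the source.\<close>

lemma canonical_map_contract:
  assumes X: "X \<in> carrier (tensor S (dual S M) (dual S N))"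
    and a: "a \<in> carrier M" and b: "b \<in> carrier N"
  shows "canonical_map S M N X (pure_tensor S M N a b) = contract (dual S N) a X b"
proof (rule tensor_ext[OF _ _ _ _ _ _ X])
  have ab: "pure_tensor S M N a b \<in> carrier (tensor S M N)"
    using a b by (rule pure_tensor_carrier[OF M N])
  show "(\<lambda>X. canonical_map S M N X (pure_tensor S M N a b))
      \<in> linear_maps S (tensor S (dual S M) (dual S N)) (regular S)"
    by (rule linear_canonical_map_apply[OF linear_ident ab])
  show "(\<lambda>X. contract (dual S N) a X b) \<in> linear_maps S (tensor S (dual S M) (dual S N)) (regular S)"
    by (rule linear_eval_dual[OF b linear_contract[OF M semimodule_dual[OF N] linear_ident a]])
  show "canonical_map S M N (pure_tensor S (dual S M) (dual S N) f g) (pure_tensor S M N a b) =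
      contract (dual S N) a (pure_tensor S (dual S M) (dual S N) f g) b"
    if "f \<in> carrier (dual S M)" "g \<in> carrier (dual S N)" for f g
    using that a b
    by (simp add: canonical_map_pure ab pairing_pure[OF M N] dual_linear
        contract_pure[OF M semimodule_dual[OF N]])
qed (rule M N linear_intros semimodule_scalars[OF M])+

end

text \<open>
  Exchanging \<open>A\<close> and \<open>A\<^sup>*\<close> swaps the two sides, which is why compatibility of product and coproduct
  passes from \<open>A\<close> to \<open>A\<^sup>*\<close>.
\<close>

lemma interchange_canonical_map:
  assumes A: "semimodule S A"
    and F: "F \<in> carrier (tensor S (dual S A) (dual S A))" and G: "G \<in> carrier (tensor S (dual S A) (dual S A))"
    and X: "X \<in> carrier (tensor S A A)" and Y: "Y \<in> carrier (tensor S A A)"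
  shows "pairing S (\<lambda>V. canonical_map S A A V X) (\<lambda>W. canonical_map S A A W Y)
      (interchange S (dual S A) (dual S A)
        (pure_tensor S (tensor S (dual S A) (dual S A)) (tensor S (dual S A) (dual S A)) F G)) =
    pairing S (canonical_map S A A F) (canonical_map S A A G)
      (interchange S A A (pure_tensor S (tensor S A A) (tensor S A A) X Y))"
  (is "?L F G X Y = ?R F G X Y")
proof -
  let ?D = "dual S A"
  let ?T = "tensor S A A"
  let ?DD = "tensor S ?D ?D"
  have S: "commutative_semiring S" by (rule semimodule_scalars[OF A])
  interpret commutative_semiring S by fact
  note D = semimodule_dual[OF A]
  note T = semimodule_tensor[OF A A]
  note DD = semimodule_tensor[OF D D]
  note R = semimodule_regular[OF S]
  note can1 = linear_canonical_map_apply[OF A A linear_ident]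
  note can2 = dual_linear[OF canonical_map_closed[OF A A]]
  \<comment> \<open>Both sides are linear in each of the four tensors separately; the next eight
    facts record this, so that extensionality can replace the tensors by pure ones in turn.\<close>
  have L_F: "(\<lambda>F. ?L F G X Y) \<in> linear_maps S ?DD (regular S)"
    if "G \<in> carrier ?DD" "X \<in> carrier ?T" "Y \<in> carrier ?T" for G X Y
    by (rule that A D S T DD R can1 linear_intros)+
  have L_G: "(\<lambda>G. ?L F G X Y) \<in> linear_maps S ?DD (regular S)"
    if "F \<in> carrier ?DD" "X \<in> carrier ?T" "Y \<in> carrier ?T" for F X Y
    by (rule that A D S T DD R can1 linear_intros)+
  have int: "interchange S ?D ?D (pure_tensor S ?DD ?DD F G) \<in> carrier (tensor S ?DD ?DD)"
    if "F \<in> carrier ?DD" "G \<in> carrier ?DD" for F G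
    by (rule linear_closed[OF linear_interchange[OF D D linear_ident]]) (rule that pure_tensor_carrier[OF DD DD])+
  have int': "interchange S A A (pure_tensor S ?T ?T X Y) \<in> carrier (tensor S ?T ?T)"
    if "X \<in> carrier ?T" "Y \<in> carrier ?T" for X Y
    by (rule linear_closed[OF linear_interchange[OF A A linear_ident]]) (rule that pure_tensor_carrier[OF T T])+
  \<comment> \<open>On this side \<open>X\<close> and \<open>Y\<close> sit in the functionals and
    not in the paired tensor, hence linearity of the pairing in a functional. On the other side
    \<open>F\<close> and \<open>G\<close> play that part.\<close>
  have L_X: "(\<lambda>X. ?L F G X Y) \<in> linear_maps S ?T (regular S)"
    if "F \<in> carrier ?DD" "G \<in> carrier ?DD" "Y \<in> carrier ?T" for F G Y
    by (rule linear_pairing_left[OF DD DD T]) (rule that int can1 can2 | assumption)+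
  have L_Y: "(\<lambda>Y. ?L F G X Y) \<in> linear_maps S ?T (regular S)"
    if "F \<in> carrier ?DD" "G \<in> carrier ?DD" "X \<in> carrier ?T" for F G X
    by (rule linear_pairing_right[OF DD DD T]) (rule that int can1 can2 | assumption)+
  have R_X: "(\<lambda>X. ?R F G X Y) \<in> linear_maps S ?T (regular S)"
    if "F \<in> carrier ?DD" "G \<in> carrier ?DD" "Y \<in> carrier ?T" for F G Y
    by (rule that A D S T DD R can2 linear_intros)+
  have R_Y: "(\<lambda>Y. ?R F G X Y) \<in> linear_maps S ?T (regular S)"
    if "F \<in> carrier ?DD" "G \<in> carrier ?DD" "X \<in> carrier ?T" for F G X
    by (rule that A D S T DD R can2 linear_intros)+
  have R_F: "(\<lambda>F. ?R F G X Y) \<in> linear_maps S ?DD (regular S)"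
    if "G \<in> carrier ?DD" "X \<in> carrier ?T" "Y \<in> carrier ?T" for G X Y
    by (rule linear_pairing_left[OF T T DD]) (rule that int' can1 can2 | assumption)+
  have R_G: "(\<lambda>G. ?R F G X Y) \<in> linear_maps S ?DD (regular S)"
    if "F \<in> carrier ?DD" "X \<in> carrier ?T" "Y \<in> carrier ?T" for F X Y
    by (rule linear_pairing_right[OF T T DD]) (rule that int' can1 can2 | assumption)+
  note pD = pure_tensor_carrier[OF D D]
  note pA = pure_tensor_carrier[OF A A]
  \<comment> \<open>Both sides multiply the scalars \<open>f x\<close>, \<open>g y\<close>,
    \<open>f' x'\<close> and \<open>g' y'\<close>; interchanging functionals or elements only
    permutes the two middle ones.\<close>
  have pure: "?L (pure_tensor S ?D ?D f g) (pure_tensor S ?D ?D f' g') (pure_tensor S A A x x') (pure_tensor S A A y y') =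
      ?R (pure_tensor S ?D ?D f g) (pure_tensor S ?D ?D f' g') (pure_tensor S A A x x') (pure_tensor S A A y y')"
    if f: "f \<in> carrier ?D" "f' \<in> carrier ?D" and g: "g \<in> carrier ?D" "g' \<in> carrier ?D"
      and x: "x \<in> carrier A" "x' \<in> carrier A" and y: "y \<in> carrier A" "y' \<in> carrier A" for f f' g g' x x' y y'
  proof -
    have "f x \<in> carrier S" "f' x' \<in> carrier S" "g y \<in> carrier S" "g' y' \<in> carrier S"
      using f g x y by (auto intro: dual_closed)
    then show ?thesis
      using f g x y
      by (simp add: interchange_pure[OF D D] interchange_pure[OF A A] pD pA
          pairing_pure[OF DD DD can1 can1] pairing_pure[OF T T can2 can2]
          canonical_map_pure[OF A A] pairing_pure[OF A A dual_linear dual_linear] m_ac)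
  qed
  show ?thesis
    by (rule tensor_ext[OF D D R L_F R_F _ F], (rule G X Y)+,
        rule tensor_ext[OF D D R L_G R_G _ G], (rule pD X Y | assumption)+,
        rule tensor_ext[OF A A R L_X R_X _ X], (rule pD Y | assumption)+,
        rule tensor_ext[OF A A R L_Y R_Y _ Y], (rule pD pA | assumption)+,
        rule pure, assumption+)
qed

context dual_basis_semimodule begin

text \<open>The image determines all double contractions by \<open>canonical_map_contract\<close>,
  and these separate elements of \<open>DD\<close>.\<close>

lemma canonical_map_inj: "inj_on (canonical_map S A A) (carrier DD)"
proof (rule inj_onI, rule DD_eqI)
  fix X Y a b
  assume "X \<in> carrier DD" "Y \<in> carrier DD" "canonical_map S A A X = canonical_map S A A Y"
    and "a \<in> carrier A" "b \<in> carrier A"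
  then show "contract D a X b = contract D a Y b"
    by (simp flip: canonical_map_contract[OF A A])
qed

lemma canonical_map_surj:
  assumes \<phi>: "\<phi> \<in> carrier (dual S AA)"
  shows "\<exists>X\<in>carrier DD. canonical_map S A A X = \<phi>"
proof
  \<comment> \<open>A preimage is rebuilt from its contractions at the \<open>e j\<close>, and these
    have to be the functionals \<open>b \<mapsto> \<phi> (e j \<otimes> b)\<close>; this dictates
    \<open>X\<close>.\<close>
  define \<psi> where "\<psi> j = (\<lambda>b\<in>carrier A. \<phi> (pure_tensor S A A (e j) b))" for j
  define X where "X = (\<Oplus>\<^bsub>DD\<^esub>j\<in>J. pure_tensor S D D (\<xi> j) (\<psi> j))"
  have \<psi>: "\<psi> j \<in> carrier D" if "j \<in> J" for j
    unfolding \<psi>_def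
    by (rule restrict_in_dual[OF A linear_compose[OF linear_pure_right[OF A A linear_ident] dual_linear[OF \<phi>]]])
      (rule basis_closed[OF that])
  have cl: "(\<lambda>j. pure_tensor S D D (\<xi> j) (\<psi> j)) \<in> J \<rightarrow> carrier DD"
    using \<psi> cobasis_closed by (auto intro: pure_tensor_carrier[OF D D])
  then show X: "X \<in> carrier DD"
    unfolding X_def by (rule abelian_monoid.finsum_closed[OF semimodule_abelian_monoid[OF DD]])
  show "canonical_map S A A X = \<phi>"
  proof (rule dual_eqI[OF canonical_map_closed[OF A A X] \<phi>])
    fix t assume t: "t \<in> carrier AA"
    show "canonical_map S A A X t = \<phi> t"
    proof (rule tensor_ext[OF A A R dual_linear[OF canonical_map_closed[OF A A X]] dual_linear[OF \<phi>] _ t])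
      fix a b assume a: "a \<in> carrier A" and b: "b \<in> carrier A"
      have ab: "pure_tensor S A A a b \<in> carrier AA"
        using a b by (rule pure_tensor_carrier[OF A A])
      have "canonical_map S A A X (pure_tensor S A A a b) =
          (\<Oplus>\<^bsub>regular S\<^esub>j\<in>J. canonical_map S A A (pure_tensor S D D (\<xi> j) (\<psi> j)) (pure_tensor S A A a b))"
        unfolding X_def
        by (rule linear_finsum[OF DD R linear_canonical_map_apply[OF A A linear_ident ab] cl])
      \<comment> \<open>The scalar \<open>\<xi> j a\<close> is absorbed into the left entry, so that
        the expansion of \<open>a\<close> can be reassembled inside \<open>\<phi>\<close>.\<close>
      also have "\<dots> = (\<Oplus>\<^bsub>regular S\<^esub>j\<in>J. \<phi> (pure_tensor S A A (\<xi> j a \<odot>\<^bsub>A\<^esub> e j) b))"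
      proof (intro abelian_monoid.finsum_cong'[OF semimodule_abelian_monoid[OF R]])
        have L: "(\<lambda>x. \<phi> (pure_tensor S A A x b)) \<in> linear_maps S A (regular S)"
          by (rule linear_compose[OF linear_pure_left[OF A A linear_ident b] dual_linear[OF \<phi>]])
        show "(\<lambda>j. \<phi> (pure_tensor S A A (\<xi> j a \<odot>\<^bsub>A\<^esub> e j) b)) \<in> J \<rightarrow> carrier (regular S)"
          using basis_scaled_closed[OF a] linear_closed[OF L] by auto
        fix j assume j: "j \<in> J"
        show "canonical_map S A A (pure_tensor S D D (\<xi> j) (\<psi> j)) (pure_tensor S A A a b) =
            \<phi> (pure_tensor S A A (\<xi> j a \<odot>\<^bsub>A\<^esub> e j) b)"
          using linear_smult[OF L dual_closed[OF cobasis_closed[OF j] a] basis_closed[OF j]]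
            cobasis_closed[OF j] \<psi>[OF j] a b
          by (simp add: canonical_map_pure[OF A A _ _ ab] pairing_pure[OF A A dual_linear dual_linear])
            (simp add: \<psi>_def)
      qed simp
      also have "\<dots> = \<phi> (pure_tensor S A A (\<Oplus>\<^bsub>A\<^esub>j\<in>J. \<xi> j a \<odot>\<^bsub>A\<^esub> e j) b)"
        by (rule linear_finsum[OF A R linear_compose[OF linear_pure_left[OF A A linear_ident b]
                dual_linear[OF \<phi>]] basis_scaled_closed[OF a], symmetric])
      finally show "canonical_map S A A X (pure_tensor S A A a b) = \<phi> (pure_tensor S A A a b)"
        by (simp add: basis_expansion a)
    qed
  qed
qed

lemma canonical_map_inv:
  assumes "\<phi> \<in> carrier (dual S AA)"
  shows "canonical_map_inv S A A \<phi> \<in> carrier DD"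
    and "canonical_map S A A (canonical_map_inv S A A \<phi>) = \<phi>"
proof -
  have "\<phi> \<in> canonical_map S A A ` carrier DD"
    using canonical_map_surj[OF assms] by auto
  then show "canonical_map_inv S A A \<phi> \<in> carrier DD"
    "canonical_map S A A (canonical_map_inv S A A \<phi>) = \<phi>"
    unfolding canonical_map_inv_def by (rule inv_into_into, rule f_inv_into_f)
qed

text \<open>The inverse is a choice function, so its linearity is detected after applying the
  canonical map, which is linear and injective.\<close>

lemma linear_canonical_map_inv: "canonical_map_inv S A A \<in> linear_maps S (dual S AA) DD"
proof -
  interpret DD: semimodule S DD by (rule DD)
  interpret DA: semimodule S "dual S AA" by (rule semimodule_dual[OF AA])
  have C: "canonical_map S A A \<in> linear_maps S DD (dual S AA)"
    by (rule linear_canonical_map[OF A A linear_ident])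
  show ?thesis
  proof (rule linear_mapsI)
    fix \<phi> \<psi> assume *: "\<phi> \<in> carrier (dual S AA)" "\<psi> \<in> carrier (dual S AA)"
    then show "canonical_map_inv S A A (\<phi> \<oplus>\<^bsub>dual S AA\<^esub> \<psi>) =
        canonical_map_inv S A A \<phi> \<oplus>\<^bsub>DD\<^esub> canonical_map_inv S A A \<psi>"
      by (intro inj_onD[OF canonical_map_inj])
        (simp_all add: linear_add[OF C] canonical_map_inv DA.M.a_closed DD.M.a_closed)
  next
    fix s \<phi> assume *: "s \<in> carrier S" "\<phi> \<in> carrier (dual S AA)"
    then show "canonical_map_inv S A A (s \<odot>\<^bsub>dual S AA\<^esub> \<phi>) = s \<odot>\<^bsub>DD\<^esub> canonical_map_inv S A A \<phi>"
      by (intro inj_onD[OF canonical_map_inj])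
        (simp_all add: linear_smult[OF C] canonical_map_inv DA.smult_closed DD.smult_closed)
  qed (rule canonical_map_inv)
qed

end

section \<open>Dual bases of finitely generated projective semimodules\<close>

lemma free_semimodule_simps:
  "carrier (free_semimodule S I) = {v \<in> I \<rightarrow>\<^sub>E carrier S. finite {i \<in> I. v i \<noteq> \<zero>\<^bsub>S\<^esub>}}"
  "\<zero>\<^bsub>free_semimodule S I\<^esub> = (\<lambda>i\<in>I. \<zero>\<^bsub>S\<^esub>)"
  "v \<oplus>\<^bsub>free_semimodule S I\<^esub> w = (\<lambda>i\<in>I. v i \<oplus>\<^bsub>S\<^esub> w i)"
  "s \<odot>\<^bsub>free_semimodule S I\<^esub> v = (\<lambda>i\<in>I. s \<otimes>\<^bsub>S\<^esub> v i)"
  by (simp_all add: free_semimodule_def)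

lemma semimodule_free:
  assumes S: "commutative_semiring S"
  shows "semimodule S (free_semimodule S I)"
proof -
  interpret commutative_semiring S by fact
  let ?F = "free_semimodule S I"
  note [simp] = free_semimodule_simps
  have add: "v \<oplus>\<^bsub>?F\<^esub> w \<in> carrier ?F" if "v \<in> carrier ?F" "w \<in> carrier ?F" for v w
  proof -
    have "{i \<in> I. v i \<oplus>\<^bsub>S\<^esub> w i \<noteq> \<zero>\<^bsub>S\<^esub>} \<subseteq> {i \<in> I. v i \<noteq> \<zero>\<^bsub>S\<^esub>} \<union> {i \<in> I. w i \<noteq> \<zero>\<^bsub>S\<^esub>}"
      by auto
    then show ?thesis
      using that by (auto intro!: finite_subset[of _ "{i \<in> I. v i \<noteq> \<zero>\<^bsub>S\<^esub>} \<union> {i \<in> I. w i \<noteq> \<zero>\<^bsub>S\<^esub>}"]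
          intro: a_closed cong: conj_cong)
  qed
  have smult: "s \<odot>\<^bsub>?F\<^esub> v \<in> carrier ?F" if "s \<in> carrier S" "v \<in> carrier ?F" for s v
  proof -
    have "{i \<in> I. s \<otimes>\<^bsub>S\<^esub> v i \<noteq> \<zero>\<^bsub>S\<^esub>} \<subseteq> {i \<in> I. v i \<noteq> \<zero>\<^bsub>S\<^esub>}"
      using that by auto
    then show ?thesis
      using that by (auto intro!: finite_subset[of _ "{i \<in> I. v i \<noteq> \<zero>\<^bsub>S\<^esub>}"] cong: conj_cong)
  qed
  have zero: "\<zero>\<^bsub>?F\<^esub> \<in> carrier ?F"
    by (simp cong: conj_cong)
  have val: "v i \<in> carrier S" if "v \<in> carrier ?F" "i \<in> I" for v i
    using that by auto
  have eqI: "v = w" if "v \<in> carrier ?F" "w \<in> carrier ?F" "\<And>i. i \<in> I \<Longrightarrow> v i = w i" for v w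
    using that by (auto intro: PiE_ext)
  have am: "abelian_monoid ?F"
    by (rule abelian_monoidI; (rule eqI)?; (intro add zero)?; assumption?)
      (simp_all del: free_semimodule_simps(1) add: val a_ac)
  show ?thesis
    by (intro semimodule.intro semimodule_axioms.intro am S smult; (rule eqI)?; (intro add smult zero a_closed m_closed)?; assumption?)
      (simp_all del: free_semimodule_simps(1) add: val l_distr r_distr m_assoc)
qed

lemma linear_coordinate:
  assumes "i \<in> I"
  shows "(\<lambda>v. v i) \<in> linear_maps S (free_semimodule S I) (regular S)"
  using assms by (intro linear_mapsI) (auto simp: free_semimodule_simps)

text \<open>Total in \<open>j\<close>: for \<open>j\<close> outside \<open>I\<close> it is the zero
  vector, which still lies in the carrier.\<close>

definition unit_vector :: "('s, 'r) ring_scheme \<Rightarrow> 'i set \<Rightarrow> 'i \<Rightarrow> 'i \<Rightarrow> 's"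
  where "unit_vector S I j = (\<lambda>i\<in>I. if i = j then \<one>\<^bsub>S\<^esub> else \<zero>\<^bsub>S\<^esub>)"

lemma unit_vector_closed:
  assumes S: "commutative_semiring S"
  shows "unit_vector S I j \<in> carrier (free_semimodule S I)"
proof -
  interpret commutative_semiring S by fact
  have "{i \<in> I. unit_vector S I j i \<noteq> \<zero>\<^bsub>S\<^esub>} \<subseteq> {j}"
    by (auto simp: unit_vector_def)
  then have "finite {i \<in> I. unit_vector S I j i \<noteq> \<zero>\<^bsub>S\<^esub>}"
    by (rule finite_subset) simp
  then show ?thesis
    by (simp add: free_semimodule_simps) (auto simp: unit_vector_def)
qed

text \<open>\<open>J\<close> may exceed the support of \<open>v\<close>, since one finite
  \<open>J\<close> will have to serve the images of all elements of \<open>A\<close> at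
  once.\<close>

lemma free_semimodule_expansion:
  assumes S: "commutative_semiring S" and v: "v \<in> carrier (free_semimodule S I)"
    and J: "finite J" "J \<subseteq> I" and supp: "\<And>i. i \<in> I \<Longrightarrow> i \<notin> J \<Longrightarrow> v i = \<zero>\<^bsub>S\<^esub>"
  shows "(\<Oplus>\<^bsub>free_semimodule S I\<^esub>j\<in>J. v j \<odot>\<^bsub>free_semimodule S I\<^esub> unit_vector S I j) = v"
proof -
  interpret commutative_semiring S by fact
  interpret F: semimodule S "free_semimodule S I" by (rule semimodule_free[OF S])
  interpret R: semimodule S "regular S" by (rule semimodule_regular[OF S])
  let ?F = "free_semimodule S I"
  let ?g = "\<lambda>j. v j \<odot>\<^bsub>?F\<^esub> unit_vector S I j"
  have val: "v i \<in> carrier S" if "i \<in> I" for i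
    using v that by (auto simp: free_semimodule_simps)
  have g: "?g \<in> J \<rightarrow> carrier ?F"
    using val J by (auto intro!: F.smult_closed unit_vector_closed[OF S])
  have sum: "(\<Oplus>\<^bsub>?F\<^esub>j\<in>J. ?g j) \<in> carrier ?F"
    using g by (rule F.M.finsum_closed)
  have "(\<Oplus>\<^bsub>?F\<^esub>j\<in>J. ?g j) i = v i" if i: "i \<in> I" for i
  proof -
    have "(\<Oplus>\<^bsub>?F\<^esub>j\<in>J. ?g j) i = (\<Oplus>\<^bsub>regular S\<^esub>j\<in>J. ?g j i)"
      by (rule linear_finsum[OF semimodule_free[OF S] semimodule_regular[OF S] linear_coordinate[OF i] g])
    also have "\<dots> = (\<Oplus>\<^bsub>regular S\<^esub>j\<in>J. if i = j then v j else \<zero>\<^bsub>regular S\<^esub>)"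
      using i J val by (intro R.M.finsum_cong') (auto simp: free_semimodule_simps unit_vector_def)
    also have "\<dots> = v i"
    proof (cases "i \<in> J")
      case True
      then show ?thesis
        using J val by (intro R.M.finsum_singleton) auto
    next
      case False
      then have "(\<Oplus>\<^bsub>regular S\<^esub>j\<in>J. if i = j then v j else \<zero>\<^bsub>regular S\<^esub>) = (\<Oplus>\<^bsub>regular S\<^esub>j\<in>J. \<zero>\<^bsub>regular S\<^esub>)"
        by (intro R.M.finsum_cong') auto
      then show ?thesis
        using supp[OF i False] R.M.finsum_zero[of J] by simp
    qed
    finally show ?thesis .
  qed
  then show ?thesis
    using sum v by (auto simp: free_semimodule_simps intro: PiE_ext)
qed

lemma exists_dual_basis:
  assumes A: "semimodule S A" and fg: "finitely_generated S A" and proj: "projective TYPE('i) S A"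
  shows "\<exists>(J :: 'i set) e \<xi>. dual_basis S A J e \<xi>"
proof -
  have S: "commutative_semiring S" by (rule semimodule_scalars[OF A])
  interpret A: semimodule S A by (rule A)
  interpret R: semimodule S "regular S" by (rule semimodule_regular[OF S])
  obtain I :: "'i set" and i p where i: "i \<in> linear_maps S A (free_semimodule S I)"
    and p: "p \<in> linear_maps S (free_semimodule S I) A" and pi: "\<And>x. x \<in> carrier A \<Longrightarrow> p (i x) = x"
    using proj by (auto simp: projective_def retract_of_def)
  obtain n g where g: "g \<in> linear_maps S (free_rank S n) A"
    and surj: "g ` carrier (free_rank S n) = carrier A"
    using fg by (auto simp: finitely_generated_def)
  define b where "b k = g (unit_vector S {..<n} k)" for k
  have b: "b k \<in> carrier A" for k
    unfolding b_def by (rule linear_closed[OF g unit_vector_closed[OF S]])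
  \<comment> \<open>The coordinates met by the \<open>n\<close> generators \<open>b k\<close>:
    finitely many, because each \<open>i (b k)\<close> has finite support.\<close>
  define J where "J = (\<Union>k<n. {c \<in> I. i (b k) c \<noteq> \<zero>\<^bsub>S\<^esub>})"
  have J: "finite J" "J \<subseteq> I"
    using linear_closed[OF i b] by (auto simp: J_def free_semimodule_simps)
  have coord: "(\<lambda>x. i x c) \<in> linear_maps S A (regular S)" if "c \<in> I" for c
    by (rule linear_compose[OF i linear_coordinate[OF that]])
  \<comment> \<open>A coordinate outside \<open>J\<close> is a linear functional that kills every
    \<open>b k\<close>, and each \<open>x\<close> is a combination of these.\<close>
  have supp: "i x c = \<zero>\<^bsub>S\<^esub>" if x: "x \<in> carrier A" and c: "c \<in> I" "c \<notin> J" for x c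
  proof -
    let ?F = "free_rank S n"
    interpret F: semimodule S ?F by (rule semimodule_free[OF S])
    obtain v where v: "v \<in> carrier ?F" and x_eq: "x = g v"
      using x surj by auto
    have L: "(\<lambda>v. i (g v) c) \<in> linear_maps S ?F (regular S)"
      by (rule linear_compose[OF g coord[OF c(1)]])
    have val: "v k \<in> carrier S" if "k < n" for k
      using v that by (auto simp: free_semimodule_simps)
    have "i x c = i (g (\<Oplus>\<^bsub>?F\<^esub>k\<in>{..<n}. v k \<odot>\<^bsub>?F\<^esub> unit_vector S {..<n} k)) c"
      unfolding x_eq by (subst free_semimodule_expansion[OF S v]) auto
    also have "\<dots> = (\<Oplus>\<^bsub>regular S\<^esub>k\<in>{..<n}. i (g (v k \<odot>\<^bsub>?F\<^esub> unit_vector S {..<n} k)) c)"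
      using val by (intro linear_finsum[OF semimodule_free[OF S] semimodule_regular[OF S] L])
        (auto intro!: F.smult_closed unit_vector_closed[OF S])
    also have "\<dots> = (\<Oplus>\<^bsub>regular S\<^esub>k\<in>{..<n}. \<zero>\<^bsub>regular S\<^esub>)"
    proof (intro R.M.finsum_cong')
      fix k assume "k \<in> {..<n}"
      then show "i (g (v k \<odot>\<^bsub>?F\<^esub> unit_vector S {..<n} k)) c = \<zero>\<^bsub>regular S\<^esub>"
        using c val[of k] linear_smult[OF L val[of k] unit_vector_closed[OF S]]
        by (auto simp: b_def[symmetric] J_def)
    qed simp_all
    finally show ?thesis
      using R.M.finsum_zero[of "{..<n}"] by simp
  qed
  let ?F = "free_semimodule S I"
  interpret F: semimodule S ?F by (rule semimodule_free[OF S])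
  \<comment> \<open>The elements are the images of the standard basis under the projection
    \<open>p\<close>, the functionals are the coordinates of the section \<open>i\<close>. Expanding
    \<open>i x\<close> and applying \<open>p\<close> returns \<open>x\<close>.\<close>
  have "dual_basis S A J (\<lambda>j. p (unit_vector S I j)) (\<lambda>j. \<lambda>x\<in>carrier A. i x j)"
    unfolding dual_basis_def
  proof (intro conjI ballI J(1))
    show "(\<lambda>j. p (unit_vector S I j)) \<in> J \<rightarrow> carrier A"
      by (auto intro!: linear_closed[OF p] unit_vector_closed[OF S])
    show "(\<lambda>j. \<lambda>x\<in>carrier A. i x j) \<in> J \<rightarrow> carrier (dual S A)"
      using J by (auto intro!: restrict_in_dual[OF A] coord)
    fix x assume x: "x \<in> carrier A"
    have val: "i x j \<in> carrier S" if "j \<in> J" for j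
      using linear_closed[OF coord x, of j] that J by auto
    have "x = p (\<Oplus>\<^bsub>?F\<^esub>j\<in>J. i x j \<odot>\<^bsub>?F\<^esub> unit_vector S I j)"
      by (simp add: free_semimodule_expansion[OF S linear_closed[OF i x] J supp[OF x]] pi x)
    also have "\<dots> = (\<Oplus>\<^bsub>A\<^esub>j\<in>J. p (i x j \<odot>\<^bsub>?F\<^esub> unit_vector S I j))"
      using val by (intro linear_finsum[OF semimodule_free[OF S] A p])
        (auto intro!: F.smult_closed unit_vector_closed[OF S])
    also have "\<dots> = (\<Oplus>\<^bsub>A\<^esub>j\<in>J. (\<lambda>x\<in>carrier A. i x j) x \<odot>\<^bsub>A\<^esub> p (unit_vector S I j))"
      using val x by (intro A.M.finsum_cong')
        (auto simp: linear_smult[OF p _ unit_vector_closed[OF S]]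
          intro!: A.smult_closed linear_closed[OF p] unit_vector_closed[OF S])
    finally show "x = (\<Oplus>\<^bsub>A\<^esub>j\<in>J. (\<lambda>x\<in>carrier A. i x j) x \<odot>\<^bsub>A\<^esub> p (unit_vector S I j))" .
  qed
  then show ?thesis by blast
qed

section \<open>Structures on the dual\<close>

lemma linear_id [linear_intros]: "id \<in> linear_maps S M M"
  by (simp add: linear_maps_def)

context
  fixes S :: "('s, 'r) ring_scheme" and A :: "('s, 'a, 'm) module_scheme" and \<mu> \<eta>
  assumes alg: "semialgebra S A \<mu> \<eta>"
begin

lemma semialgebra_semimodule: "semimodule S A"
  and linear_semialgebra_mult: "\<mu> \<in> linear_maps S (tensor S A A) A"
  and linear_semialgebra_unit: "\<eta> \<in> linear_maps S (regular S) A"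
  using alg by (simp_all add: semialgebra_def)

text \<open>The elementwise form to which coassociativity of the dual reduces once it is evaluated
  at three elements.\<close>

lemma semialgebra_assoc:
  assumes abc: "a \<in> carrier A" "b \<in> carrier A" "c \<in> carrier A"
  shows "\<mu> (pure_tensor S A A (\<mu> (pure_tensor S A A a b)) c) =
    \<mu> (pure_tensor S A A a (\<mu> (pure_tensor S A A b c)))"
proof -
  note A = semialgebra_semimodule and \<mu> = linear_semialgebra_mult
  note T = semimodule_tensor[OF A A]
  have "pure_tensor S (tensor S A A) A (pure_tensor S A A a b) c \<in> carrier (tensor S (tensor S A A) A)"
    by (rule abc A T pure_tensor_carrier)+
  with alg have "\<mu> (tensor_map S A A \<mu> id (pure_tensor S (tensor S A A) A (pure_tensor S A A a b) c)) =
      \<mu> (tensor_map S A A id \<mu> (associator S A A A (pure_tensor S (tensor S A A) A (pure_tensor S A A a b) c)))"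
    unfolding semialgebra_def by blast
  then show ?thesis
    using abc by (simp add: associator_pure[OF A A A] pure_tensor_carrier[OF A A]
        tensor_map_pure[OF T A A A \<mu> linear_id] tensor_map_pure[OF A T A A linear_id \<mu>])
qed

lemma semialgebra_unit:
  assumes s: "s \<in> carrier S" and a: "a \<in> carrier A"
  shows "\<mu> (pure_tensor S A A (\<eta> s) a) = s \<odot>\<^bsub>A\<^esub> a" "\<mu> (pure_tensor S A A a (\<eta> s)) = s \<odot>\<^bsub>A\<^esub> a"
proof -
  note A = semialgebra_semimodule and \<eta> = linear_semialgebra_unit
  note R = semimodule_regular[OF semimodule_scalars[OF A]]
  have "pure_tensor S (regular S) A s a \<in> carrier (tensor S (regular S) A)"
    "pure_tensor S A (regular S) a s \<in> carrier (tensor S A (regular S))"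
    using s a by (simp_all add: pure_tensor_carrier[OF R A] pure_tensor_carrier[OF A R])
  with alg have "\<mu> (tensor_map S A A \<eta> id (pure_tensor S (regular S) A s a)) =
      left_unitor A (pure_tensor S (regular S) A s a)"
    and "\<mu> (tensor_map S A A id \<eta> (pure_tensor S A (regular S) a s)) =
      right_unitor A (pure_tensor S A (regular S) a s)"
    unfolding semialgebra_def by blast+
  then show "\<mu> (pure_tensor S A A (\<eta> s) a) = s \<odot>\<^bsub>A\<^esub> a" "\<mu> (pure_tensor S A A a (\<eta> s)) = s \<odot>\<^bsub>A\<^esub> a"
    using s a by (simp_all add: left_unitor_pure[OF A] right_unitor_pure[OF A]
        tensor_map_pure[OF R A A A \<eta> linear_id] tensor_map_pure[OF A R A A linear_id \<eta>])
qed

end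

section \<open>The dual structure maps and the dual semicoalgebra\<close>

context dual_basis_semimodule begin

abbreviation dual_mult where "dual_mult \<Delta> \<equiv> dual_map A \<Delta> \<circ> canonical_map S A A"
abbreviation dual_unit where "dual_unit \<epsilon> \<equiv> dual_map A \<epsilon> \<circ> eval_one_inv S"
abbreviation dual_comult where "dual_comult \<mu> \<equiv> canonical_map_inv S A A \<circ> dual_map AA \<mu>"
abbreviation dual_counit where "dual_counit \<eta> \<equiv> eval_one S \<circ> dual_map (regular S) \<eta>"

lemma linear_dual_mult:
  assumes "\<Delta> \<in> linear_maps S A AA"
  shows "dual_mult \<Delta> \<in> linear_maps S DD D"
  unfolding comp_def
  by (rule linear_dual_map[OF A AA assms linear_canonical_map[OF A A linear_ident] DD])

lemma dual_mult_apply: "a \<in> carrier A \<Longrightarrow> dual_mult \<Delta> X a = canonical_map S A A X (\<Delta> a)"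
  by (simp add: dual_map_apply)

lemma dual_mult_pure:
  assumes "\<Delta> \<in> linear_maps S A AA" "f \<in> carrier D" "g \<in> carrier D" "a \<in> carrier A"
  shows "dual_mult \<Delta> (pure_tensor S D D f g) a = pairing S f g (\<Delta> a)"
  using assms by (simp add: dual_map_apply canonical_map_pure[OF A A] linear_closed[OF assms(1)])

lemma dual_unit_apply:
  assumes "\<epsilon> \<in> linear_maps S A (regular S)" "s \<in> carrier S" "a \<in> carrier A"
  shows "dual_unit \<epsilon> s a = s \<otimes>\<^bsub>S\<^esub> \<epsilon> a"
  using assms linear_closed[OF assms(1,3)] by (simp add: dual_map_apply eval_one_inv_eq[OF S])

lemma linear_dual_unit:
  assumes \<epsilon>: "\<epsilon> \<in> linear_maps S A (regular S)"
  shows "dual_unit \<epsilon> \<in> linear_maps S (regular S) D"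
proof (rule linear_into_dual[OF R A])
  fix s assume "s \<in> carrier (regular S)"
  then have s: "s \<in> carrier S" by simp
  have "eval_one_inv S s \<in> carrier (dual S (regular S))"
    using restrict_in_dual[OF R linear_mult_left[OF S linear_ident s]] s
    by (simp add: eval_one_inv_eq[OF S])
  then show "dual_unit \<epsilon> s \<in> carrier D"
    by (simp add: dual_map_closed[OF A \<epsilon>])
next
  fix a assume a: "a \<in> carrier A"
  have \<epsilon>a: "\<epsilon> a \<in> carrier S"
    using linear_closed[OF \<epsilon> a] by simp
  show "(\<lambda>s. dual_unit \<epsilon> s a) \<in> linear_maps S (regular S) (regular S)"
    by (rule linear_cong[OF linear_mult_right[OF S linear_ident \<epsilon>a] R])
      (simp only: dual_unit_apply[OF \<epsilon> _ a] regular_simps)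
qed

context
  fixes \<mu> assumes \<mu>: "\<mu> \<in> linear_maps S AA A"
begin

lemma linear_dual_comult: "dual_comult \<mu> \<in> linear_maps S D DD"
  unfolding comp_def
  by (rule linear_compose[OF linear_dual_map[OF AA A \<mu> linear_ident D] linear_canonical_map_inv])

lemma dual_comult_closed: "\<phi> \<in> carrier D \<Longrightarrow> dual_comult \<mu> \<phi> \<in> carrier DD"
  by (rule linear_closed[OF linear_dual_comult])

lemma canonical_map_dual_comult:
  "\<phi> \<in> carrier D \<Longrightarrow> X \<in> carrier AA \<Longrightarrow> canonical_map S A A (dual_comult \<mu> \<phi>) X = \<phi> (\<mu> X)"
  by (simp add: canonical_map_inv dual_map_closed[OF AA \<mu>] dual_map_apply)

text \<open>The working description of the coproduct: it fixes all double contractions, hence the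
  coproduct itself, without a formula for the inverse of the canonical map.\<close>

lemma contract_dual_comult:
  "\<phi> \<in> carrier D \<Longrightarrow> a \<in> carrier A \<Longrightarrow> b \<in> carrier A \<Longrightarrow>
    contract D a (dual_comult \<mu> \<phi>) b = \<phi> (\<mu> (pure_tensor S A A a b))"
  by (simp only: canonical_map_contract[OF A A dual_comult_closed, symmetric]
      canonical_map_dual_comult pure_tensor_carrier[OF A A])

end

lemma linear_dual_counit:
  assumes "\<eta> \<in> linear_maps S (regular S) A"
  shows "dual_counit \<eta> \<in> linear_maps S D (regular S)"
proof -
  have "(\<lambda>\<phi>. \<phi> (\<eta> \<one>\<^bsub>S\<^esub>)) \<in> linear_maps S D (regular S)"
    by (rule linear_eval_dual[OF linear_closed[OF assms] linear_ident]) simp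
  then show ?thesis
    by (rule linear_cong[OF _ D]) (simp add: eval_one_def dual_map_def)
qed

lemma dual_counit_apply: "dual_counit \<eta> \<phi> = \<phi> (\<eta> \<one>\<^bsub>S\<^esub>)"
  by (simp add: eval_one_def dual_map_def)

text \<open>Evaluated at three elements, the two iterated coproducts of \<open>\<phi>\<close> are
  \<open>\<phi> ((a b) c)\<close> and \<open>\<phi> (a (b c))\<close>. The counit is evaluation at
  the unit of \<open>A\<close>, so the counit laws reduce to \<open>\<phi> (1 a) = \<phi> a\<close>
  and \<open>\<phi> (a 1) = \<phi> a\<close>.\<close>

lemma dual_semicoalgebra:
  assumes alg: "semialgebra S A \<mu> \<eta>"
  shows "semicoalgebra S D (dual_comult \<mu>) (dual_counit \<eta>)"
proof -
  note \<mu> = linear_semialgebra_mult[OF alg] and \<eta> = linear_semialgebra_unit[OF alg]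
  note \<Delta>' = linear_dual_comult[OF \<mu>] and \<epsilon>' = linear_dual_counit[OF \<eta>]
  note cl = dual_comult_closed[OF \<mu>]
  note lin = S D DD R \<Delta>' \<epsilon>' linear_intros
  have D_DD: "semimodule S (tensor S D DD)" by (rule semimodule_tensor[OF D DD])
  let ?\<Delta> = "dual_comult \<mu>" and ?\<epsilon> = "dual_counit \<eta>"
  let ?l = "\<lambda>X. associator S D D D (tensor_map S DD D ?\<Delta> id X)"
  let ?r = "tensor_map S D DD id ?\<Delta>"
  \<comment> \<open>\<open>T\<close> is kept arbitrary because it will be the coproduct of a
    functional, which need not be pure.\<close>
  have pure: "contract D b (contract DD a (associator S D D D (pure_tensor S DD D T \<psi>))) c =
      contract D a T b \<otimes>\<^bsub>S\<^esub> \<psi> c"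
    if a: "a \<in> carrier A" and b: "b \<in> carrier A" and c: "c \<in> carrier A"
      and T: "T \<in> carrier DD" and \<psi>: "\<psi> \<in> carrier D" for a b c T \<psi>
  proof (rule tensor_ext[OF D D R _ _ _ T])
    show "(\<lambda>T. contract D b (contract DD a (associator S D D D (pure_tensor S DD D T \<psi>))) c)
        \<in> linear_maps S DD (regular S)"
      by (rule linear_eval_dual[OF c]) (rule a b \<psi> A lin)+
    show "(\<lambda>T. contract D a T b \<otimes>\<^bsub>S\<^esub> \<psi> c) \<in> linear_maps S DD (regular S)"
      by (rule linear_mult_right[OF S linear_eval_dual[OF b] dual_closed[OF \<psi> c]]) (rule a A lin)+
    fix f g assume f: "f \<in> carrier D" and g: "g \<in> carrier D"
    have "f a \<in> carrier S" "g b \<in> carrier S" "\<psi> c \<in> carrier S"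
      using f g \<psi> a b c by (auto intro: dual_closed)
    then show "contract D b (contract DD a (associator S D D D (pure_tensor S DD D (pure_tensor S D D f g) \<psi>))) c =
        contract D a (pure_tensor S D D f g) b \<otimes>\<^bsub>S\<^esub> \<psi> c"
      using a b c f g \<psi>
      by (simp add: associator_pure[OF D D D] contract_pure[OF A DD] contract_pure[OF A D]
          pure_tensor_carrier[OF D D] linear_smult[OF linear_contract[OF A D linear_ident]] S.m_assoc)
  qed
  \<comment> \<open>Comultiplying the left factor means multiplying the first two arguments; dually,
    \<open>right\<close> below multiplies the last two. Both are stated for arbitrary
    \<open>X\<close>, to be applied to a coproduct.\<close>
  have left: "contract D b (contract DD a (?l X)) c = contract D (\<mu> (pure_tensor S A A a b)) X c"
    if a: "a \<in> carrier A" and b: "b \<in> carrier A" and c: "c \<in> carrier A" and X: "X \<in> carrier DD" for a b c X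
  proof (rule tensor_ext[OF D D R _ _ _ X])
    have ab: "\<mu> (pure_tensor S A A a b) \<in> carrier A"
      using a b by (intro linear_closed[OF \<mu>] pure_tensor_carrier[OF A A])
    show "(\<lambda>X. contract D b (contract DD a (?l X)) c) \<in> linear_maps S DD (regular S)"
      by (rule linear_eval_dual[OF c]) (rule a b A lin)+
    show "(\<lambda>X. contract D (\<mu> (pure_tensor S A A a b)) X c) \<in> linear_maps S DD (regular S)"
      by (rule linear_eval_dual[OF c]) (rule ab A lin)+
    fix f g assume f: "f \<in> carrier D" and g: "g \<in> carrier D"
    then show "contract D b (contract DD a (?l (pure_tensor S D D f g))) c =
        contract D (\<mu> (pure_tensor S A A a b)) (pure_tensor S D D f g) c"
      using a b c ab
      by (simp only: tensor_map_pure[OF D D DD D \<Delta>' linear_id] id_apply pure cl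
          contract_dual_comult[OF \<mu>] contract_pure[OF A D] dual_apply)
  qed
  have right: "contract D b (contract DD a (?r X)) c = contract D a X (\<mu> (pure_tensor S A A b c))"
    if a: "a \<in> carrier A" and b: "b \<in> carrier A" and c: "c \<in> carrier A" and X: "X \<in> carrier DD" for a b c X
  proof (rule tensor_ext[OF D D R _ _ _ X])
    have bc: "\<mu> (pure_tensor S A A b c) \<in> carrier A"
      using b c by (intro linear_closed[OF \<mu>] pure_tensor_carrier[OF A A])
    show "(\<lambda>X. contract D b (contract DD a (?r X)) c) \<in> linear_maps S DD (regular S)"
      by (rule linear_eval_dual[OF c]) (rule a b A lin)+
    show "(\<lambda>X. contract D a X (\<mu> (pure_tensor S A A b c))) \<in> linear_maps S DD (regular S)"
      by (rule linear_eval_dual[OF bc]) (rule a A lin)+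
    fix f g assume f: "f \<in> carrier D" and g: "g \<in> carrier D"
    then show "contract D b (contract DD a (?r (pure_tensor S D D f g))) c =
        contract D a (pure_tensor S D D f g) (\<mu> (pure_tensor S A A b c))"
      using a b c bc
      by (simp only: tensor_map_pure[OF D D D DD linear_id \<Delta>'] id_apply cl contract_pure[OF A DD]
          linear_smult[OF linear_contract[OF A D linear_ident]] dual_closed
          contract_dual_comult[OF \<mu>] contract_pure[OF A D] dual_apply)
  qed
  have lin_l: "?l \<in> linear_maps S DD (tensor S D DD)"
    by (rule lin)+
  have lin_r: "?r \<in> linear_maps S DD (tensor S D DD)"
    by (rule lin)+
  have coassoc: "?l (?\<Delta> \<phi>) = ?r (?\<Delta> \<phi>)" if \<phi>: "\<phi> \<in> carrier D" for \<phi>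
  proof (rule tensor_eqI[OF DD linear_closed[OF lin_l cl[OF \<phi>]] linear_closed[OF lin_r cl[OF \<phi>]]])
    fix a assume a: "a \<in> carrier A"
    note con = linear_closed[OF linear_contract[OF A DD linear_ident a]]
    show "contract DD a (?l (?\<Delta> \<phi>)) = contract DD a (?r (?\<Delta> \<phi>))"
    proof (rule DD_eqI)
      show "contract DD a (?l (?\<Delta> \<phi>)) \<in> carrier DD" "contract DD a (?r (?\<Delta> \<phi>)) \<in> carrier DD"
        by (rule con linear_closed[OF lin_l cl[OF \<phi>]] linear_closed[OF lin_r cl[OF \<phi>]])+
      fix b c assume b: "b \<in> carrier A" and c: "c \<in> carrier A"
      have "\<mu> (pure_tensor S A A a b) \<in> carrier A" "\<mu> (pure_tensor S A A b c) \<in> carrier A"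
        using a b c by (auto intro!: linear_closed[OF \<mu>] pure_tensor_carrier[OF A A])
      then show "contract D b (contract DD a (?l (?\<Delta> \<phi>))) c = contract D b (contract DD a (?r (?\<Delta> \<phi>))) c"
        using a b c \<phi>
        by (simp only: left right cl contract_dual_comult[OF \<mu>] semialgebra_assoc[OF alg])
    qed
  qed
  have \<eta>1: "\<eta> \<one>\<^bsub>S\<^esub> \<in> carrier A"
    by (rule linear_closed[OF \<eta>]) simp
  have left_counit: "left_unitor D (tensor_map S (regular S) D ?\<epsilon> id (?\<Delta> \<phi>)) = \<phi>" if \<phi>: "\<phi> \<in> carrier D" for \<phi>
  proof (rule dual_eqI[OF _ \<phi>])
    have l: "(\<lambda>X. left_unitor D (tensor_map S (regular S) D ?\<epsilon> id X)) \<in> linear_maps S DD D"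
      by (rule lin)+
    show "left_unitor D (tensor_map S (regular S) D ?\<epsilon> id (?\<Delta> \<phi>)) \<in> carrier D"
      by (rule linear_closed[OF l cl[OF \<phi>]])
    fix a assume a: "a \<in> carrier A"
    \<comment> \<open>Evaluating the left factor at the unit of \<open>A\<close> and then scaling
      the right one is precisely a contraction.\<close>
    have "left_unitor D (tensor_map S (regular S) D ?\<epsilon> id (?\<Delta> \<phi>)) = contract D (\<eta> \<one>\<^bsub>S\<^esub>) (?\<Delta> \<phi>)"
    proof (rule tensor_ext[OF D D D l _ _ cl[OF \<phi>]])
      show "contract D (\<eta> \<one>\<^bsub>S\<^esub>) \<in> linear_maps S DD D"
        by (rule linear_contract[OF A D linear_ident \<eta>1])
      show "left_unitor D (tensor_map S (regular S) D ?\<epsilon> id (pure_tensor S D D f g)) =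
          contract D (\<eta> \<one>\<^bsub>S\<^esub>) (pure_tensor S D D f g)" if "f \<in> carrier D" "g \<in> carrier D" for f g
        using that \<eta>1
        by (simp only: tensor_map_pure[OF D D R D \<epsilon>' linear_id] id_apply dual_counit_apply
            left_unitor_pure[OF D] dual_closed contract_pure[OF A D])
    qed
    then show "left_unitor D (tensor_map S (regular S) D ?\<epsilon> id (?\<Delta> \<phi>)) a = \<phi> a"
      using semialgebra_unit(1)[OF alg S.one_closed a] a \<eta>1 \<phi>
      by (simp only: contract_dual_comult[OF \<mu>] semimodule.smult_one[OF A])
  qed
  have right_counit: "right_unitor D (tensor_map S D (regular S) id ?\<epsilon> (?\<Delta> \<phi>)) = \<phi>" if \<phi>: "\<phi> \<in> carrier D" for \<phi>
  proof (rule dual_eqI[OF _ \<phi>])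
    have l: "(\<lambda>X. right_unitor D (tensor_map S D (regular S) id ?\<epsilon> X)) \<in> linear_maps S DD D"
      by (rule lin)+
    show "right_unitor D (tensor_map S D (regular S) id ?\<epsilon> (?\<Delta> \<phi>)) \<in> carrier D"
      by (rule linear_closed[OF l cl[OF \<phi>]])
    fix a assume a: "a \<in> carrier A"
    \<comment> \<open>Evaluation at the unit falls on the right factor here. Contractions act on the
      left one, so the left factor is evaluated at \<open>a\<close> as well and the comparison is
      made in \<open>S\<close>.\<close>
    have "right_unitor D (tensor_map S D (regular S) id ?\<epsilon> (?\<Delta> \<phi>)) a = contract D a (?\<Delta> \<phi>) (\<eta> \<one>\<^bsub>S\<^esub>)"
    proof (rule tensor_ext[OF D D R linear_eval_dual[OF a l] _ _ cl[OF \<phi>]])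
      show "(\<lambda>X. contract D a X (\<eta> \<one>\<^bsub>S\<^esub>)) \<in> linear_maps S DD (regular S)"
        by (rule linear_eval_dual[OF \<eta>1 linear_contract[OF A D linear_ident a]])
      show "right_unitor D (tensor_map S D (regular S) id ?\<epsilon> (pure_tensor S D D f g)) a =
          contract D a (pure_tensor S D D f g) (\<eta> \<one>\<^bsub>S\<^esub>)" if "f \<in> carrier D" "g \<in> carrier D" for f g
      proof -
        have "f a \<in> carrier S" "g (\<eta> \<one>\<^bsub>S\<^esub>) \<in> carrier S"
          using that a \<eta>1 by (auto intro: dual_closed)
        then show ?thesis
          using that \<eta>1 a
          by (simp only: tensor_map_pure[OF D D D R linear_id \<epsilon>'] id_apply dual_counit_apply
              right_unitor_pure[OF D] contract_pure[OF A D] dual_apply S.m_comm)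
      qed
    qed
    then show "right_unitor D (tensor_map S D (regular S) id ?\<epsilon> (?\<Delta> \<phi>)) a = \<phi> a"
      using semialgebra_unit(2)[OF alg S.one_closed a] a \<eta>1 \<phi>
      by (simp only: contract_dual_comult[OF \<mu>] semimodule.smult_one[OF A])
  qed
  show ?thesis
    unfolding semicoalgebra_def
    using D \<Delta>' \<epsilon>' coassoc left_counit right_counit by blast
qed

end

text \<open>On \<open>r \<otimes> x\<close> both sides are the product of \<open>s\<close>,
  \<open>r\<close> and \<open>f x\<close>. Multiplication by \<open>s\<close> is what remains of the
  dual unit at \<open>s\<close> once the counit of \<open>A\<close> has been split off.\<close>

lemma pairing_left_unitor:
  assumes M: "semimodule S M" and f: "f \<in> linear_maps S M (regular S)" and s: "s \<in> carrier S"
    and X: "X \<in> carrier (tensor S (regular S) M)"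
  shows "pairing S (\<lambda>r. s \<otimes>\<^bsub>S\<^esub> r) f X = s \<otimes>\<^bsub>S\<^esub> f (left_unitor M X)"
proof -
  have S: "commutative_semiring S" by (rule semimodule_scalars[OF M])
  interpret commutative_semiring S by fact
  note R = semimodule_regular[OF S]
  have ms: "(\<lambda>r. s \<otimes>\<^bsub>S\<^esub> r) \<in> linear_maps S (regular S) (regular S)"
    by (rule S s linear_intros)+
  show ?thesis
  proof (rule tensor_ext[OF R M R _ _ _ X])
    show "pairing S (\<lambda>r. s \<otimes>\<^bsub>S\<^esub> r) f \<in> linear_maps S (tensor S (regular S) M) (regular S)"
      by (rule R M f ms linear_intros)+
    show "(\<lambda>X. s \<otimes>\<^bsub>S\<^esub> f (left_unitor M X)) \<in> linear_maps S (tensor S (regular S) M) (regular S)"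
      by (rule linear_mult_left[OF S linear_compose[OF linear_left_unitor[OF M linear_ident] f] s])
    show "pairing S (\<lambda>r. s \<otimes>\<^bsub>S\<^esub> r) f (pure_tensor S (regular S) M r x) =
        s \<otimes>\<^bsub>S\<^esub> f (left_unitor M (pure_tensor S (regular S) M r x))"
      if "r \<in> carrier (regular S)" "x \<in> carrier M" for r x
      using that s linear_closed[OF f]
      by (simp add: pairing_pure[OF R M ms f] left_unitor_pure[OF M] linear_smult[OF f] m_assoc)
  qed
qed

lemma pairing_right_unitor:
  assumes M: "semimodule S M" and f: "f \<in> linear_maps S M (regular S)" and s: "s \<in> carrier S"
    and X: "X \<in> carrier (tensor S M (regular S))"
  shows "pairing S f (\<lambda>r. s \<otimes>\<^bsub>S\<^esub> r) X = s \<otimes>\<^bsub>S\<^esub> f (right_unitor M X)"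
proof -
  have S: "commutative_semiring S" by (rule semimodule_scalars[OF M])
  interpret commutative_semiring S by fact
  note R = semimodule_regular[OF S]
  have ms: "(\<lambda>r. s \<otimes>\<^bsub>S\<^esub> r) \<in> linear_maps S (regular S) (regular S)"
    by (rule S s linear_intros)+
  show ?thesis
  proof (rule tensor_ext[OF M R R _ _ _ X])
    show "pairing S f (\<lambda>r. s \<otimes>\<^bsub>S\<^esub> r) \<in> linear_maps S (tensor S M (regular S)) (regular S)"
      by (rule R M f ms linear_intros)+
    show "(\<lambda>X. s \<otimes>\<^bsub>S\<^esub> f (right_unitor M X)) \<in> linear_maps S (tensor S M (regular S)) (regular S)"
      by (rule linear_mult_left[OF S linear_compose[OF linear_right_unitor[OF M linear_ident] f] s])
    show "pairing S f (\<lambda>r. s \<otimes>\<^bsub>S\<^esub> r) (pure_tensor S M (regular S) x r) =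
        s \<otimes>\<^bsub>S\<^esub> f (right_unitor M (pure_tensor S M (regular S) x r))"
      if "x \<in> carrier M" "r \<in> carrier (regular S)" for r x
      using that s linear_closed[OF f]
      by (simp add: pairing_pure[OF M R f ms] right_unitor_pure[OF M] linear_smult[OF f] m_ac)
  qed
qed

text \<open>Turns a double contraction of \<open>(p \<otimes> q) X\<close> into a pairing with the
  tensor \<open>X\<close> itself, the form in which products of coproducts are compared.\<close>

lemma contract_tensor_map:
  assumes A: "semimodule S A" and B: "semimodule S B" and P: "semimodule S P" and Q: "semimodule S Q"
    and p: "p \<in> linear_maps S P (dual S A)" and q: "q \<in> linear_maps S Q (dual S B)"
    and a: "a \<in> carrier A" and b: "b \<in> carrier B" and X: "X \<in> carrier (tensor S P Q)"
  shows "contract (dual S B) a (tensor_map S (dual S A) (dual S B) p q X) b =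
    pairing S (\<lambda>v. p v a) (\<lambda>w. q w b) X"
proof -
  note R = semimodule_regular[OF semimodule_scalars[OF A]]
  note DA = semimodule_dual[OF A] and DB = semimodule_dual[OF B]
  note pa = linear_eval_dual[OF a p] and qb = linear_eval_dual[OF b q]
  show ?thesis
  proof (rule tensor_ext[OF P Q R _ _ _ X])
    show "(\<lambda>X. contract (dual S B) a (tensor_map S (dual S A) (dual S B) p q X) b)
        \<in> linear_maps S (tensor S P Q) (regular S)"
      by (rule linear_eval_dual[OF b]) (rule a A B P Q p q linear_intros)+
    show "pairing S (\<lambda>v. p v a) (\<lambda>w. q w b) \<in> linear_maps S (tensor S P Q) (regular S)"
      by (rule linear_pairing[OF P Q pa qb linear_ident])
    show "contract (dual S B) a (tensor_map S (dual S A) (dual S B) p q (pure_tensor S P Q v w)) b =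
        pairing S (\<lambda>v. p v a) (\<lambda>w. q w b) (pure_tensor S P Q v w)"
      if "v \<in> carrier P" "w \<in> carrier Q" for v w
      using that a b linear_closed[OF p] linear_closed[OF q]
      by (simp add: tensor_map_pure[OF P Q DA DB p q] contract_pure[OF A DB] pairing_pure[OF P Q pa qb])
  qed
qed

text \<open>Transposition moves \<open>p' \<otimes> q'\<close> from functionals to
  \<open>p \<otimes> q\<close> on elements. Being a transpose is asked only pointwise, so that
  \<open>id\<close> qualifies as well as a restricted map like \<open>dual_map A p\<close>.\<close>

lemma canonical_map_tensor_map:
  assumes A: "semimodule S A" and p: "p \<in> linear_maps S A A" and q: "q \<in> linear_maps S A A"
    and p': "p' \<in> linear_maps S (dual S A) (dual S A)" and q': "q' \<in> linear_maps S (dual S A) (dual S A)"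
    and p'_apply: "\<And>f x. f \<in> carrier (dual S A) \<Longrightarrow> x \<in> carrier A \<Longrightarrow> p' f x = f (p x)"
    and q'_apply: "\<And>f x. f \<in> carrier (dual S A) \<Longrightarrow> x \<in> carrier A \<Longrightarrow> q' f x = f (q x)"
    and X: "X \<in> carrier (tensor S (dual S A) (dual S A))" and Y: "Y \<in> carrier (tensor S A A)"
  shows "canonical_map S A A (tensor_map S (dual S A) (dual S A) p' q' X) Y =
    canonical_map S A A X (tensor_map S A A p q Y)"
proof -
  note D = semimodule_dual[OF A]
  note R = semimodule_regular[OF semimodule_scalars[OF A]]
  have pqY: "tensor_map S A A p q Y \<in> carrier (tensor S A A)"
    by (rule linear_closed[OF linear_tensor_map[OF linear_ident A A A A p q] Y])
  show ?thesis
  proof (rule tensor_ext[OF D D R _ _ _ X])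
    show "(\<lambda>X. canonical_map S A A (tensor_map S (dual S A) (dual S A) p' q' X) Y)
        \<in> linear_maps S (tensor S (dual S A) (dual S A)) (regular S)"
      by (rule linear_canonical_map_apply[OF A A linear_tensor_map[OF linear_ident D D D D p' q'] Y])
    show "(\<lambda>X. canonical_map S A A X (tensor_map S A A p q Y))
        \<in> linear_maps S (tensor S (dual S A) (dual S A)) (regular S)"
      by (rule linear_canonical_map_apply[OF A A linear_ident pqY])
    fix f g assume f: "f \<in> carrier (dual S A)" and g: "g \<in> carrier (dual S A)"
    note fg = dual_linear[OF f] dual_linear[OF g]
    have "canonical_map S A A (tensor_map S (dual S A) (dual S A) p' q' (pure_tensor S (dual S A) (dual S A) f g)) Y =
        pairing S (p' f) (q' g) Y"
      using f g linear_closed[OF p' f] linear_closed[OF q' g] Y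
      by (simp add: tensor_map_pure[OF D D D D p' q'] canonical_map_pure[OF A A])
    also have "\<dots> = pairing S (\<lambda>x. f (p x)) (\<lambda>x. g (q x)) Y"
      using f g
      by (intro pairing_cong[OF A A _ _ linear_compose[OF p fg(1)] linear_compose[OF q fg(2)] Y])
        (simp_all add: p'_apply q'_apply)
    also have "\<dots> = pairing S f g (tensor_map S A A p q Y)"
      by (rule pairing_tensor_map[OF A A A A fg p q Y, symmetric])
    finally show "canonical_map S A A (tensor_map S (dual S A) (dual S A) p' q' (pure_tensor S (dual S A) (dual S A) f g)) Y =
        canonical_map S A A (pure_tensor S (dual S A) (dual S A) f g) (tensor_map S A A p q Y)"
      by (simp add: canonical_map_pure[OF A A f g pqY])
  qed
qed

section \<open>The dual semialgebra, bisemialgebra and Hopf semialgebra\<close>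

context dual_basis_semimodule begin

text \<open>The product of \<open>f\<close> and \<open>g\<close> at \<open>a\<close> is their
  pairing with \<open>\<Delta> a\<close>. A threefold product therefore evaluates functionals on an
  iterated coproduct of \<open>a\<close>, and the two bracketings agree by coassociativity.\<close>

lemma dual_semialgebra:
  assumes coalg: "semicoalgebra S A \<Delta> \<epsilon>"
  shows "semialgebra S D (dual_mult \<Delta>) (dual_unit \<epsilon>)"
proof -
  have \<Delta>: "\<Delta> \<in> linear_maps S A AA" and \<epsilon>: "\<epsilon> \<in> linear_maps S A (regular S)"
    using coalg by (simp_all add: semicoalgebra_def)
  let ?m = "dual_mult \<Delta>" and ?u = "dual_unit \<epsilon>"
  note \<mu>' = linear_dual_mult[OF \<Delta>] and \<eta>' = linear_dual_unit[OF \<epsilon>]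
  note \<Delta>_closed = linear_closed[OF \<Delta>]
  note lin = S D DD R \<mu>' \<eta>' linear_intros linear_compose[OF _ \<mu>']
  note mult_pure = dual_mult_pure[OF \<Delta>]
  have mult_closed: "?m (pure_tensor S D D f g) \<in> carrier D" if "f \<in> carrier D" "g \<in> carrier D" for f g
    using that by (intro linear_closed[OF \<mu>'] pure_tensor_carrier[OF D D])
  have assoc_pure: "?m (pure_tensor S D D (?m (pure_tensor S D D f g)) h) =
      ?m (pure_tensor S D D f (?m (pure_tensor S D D g h)))"
    if f: "f \<in> carrier D" and g: "g \<in> carrier D" and h: "h \<in> carrier D" for f g h
  proof (rule dual_eqI)
    fix a assume a: "a \<in> carrier A"
    note f' = dual_linear[OF f] and g' = dual_linear[OF g] and h' = dual_linear[OF h]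
    have fg: "pairing S f g \<in> linear_maps S AA (regular S)" and gh: "pairing S g h \<in> linear_maps S AA (regular S)"
      by (rule f' g' h' A linear_intros)+
    have "?m (pure_tensor S D D (?m (pure_tensor S D D f g)) h) a =
        pairing S (?m (pure_tensor S D D f g)) h (\<Delta> a)"
      by (rule mult_pure[OF mult_closed[OF f g] h a])
    \<comment> \<open>\<open>h\<close> is written as \<open>h\<close> after \<open>id\<close> to
      expose the shape \<open>\<Delta> \<otimes> id\<close> that naturality of the pairing asks
      for.\<close>
    also have "\<dots> = pairing S (\<lambda>x. pairing S f g (\<Delta> x)) (\<lambda>y. h (id y)) (\<Delta> a)"
      by (rule pairing_cong[OF A A _ _ linear_compose[OF \<Delta> fg] linear_compose[OF linear_id h'] \<Delta>_closed[OF a]])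
        (simp_all only: mult_pure[OF f g] id_apply)
    also have "\<dots> = pairing S (pairing S f g) h (tensor_map S AA A \<Delta> id (\<Delta> a))"
      by (rule pairing_tensor_map[OF A A AA A fg h' \<Delta> linear_id \<Delta>_closed[OF a], symmetric])
    also have "\<dots> = pairing S f (pairing S g h) (associator S A A A (tensor_map S AA A \<Delta> id (\<Delta> a)))"
      by (rule pairing_associator[OF A A A f' g' h', symmetric])
        (rule linear_closed[OF linear_tensor_map[OF linear_ident A A AA A \<Delta> linear_id] \<Delta>_closed[OF a]])
    also have "\<dots> = pairing S f (pairing S g h) (tensor_map S A AA id \<Delta> (\<Delta> a))"
      using coalg a by (simp add: semicoalgebra_def)
    also have "\<dots> = pairing S (\<lambda>x. f (id x)) (\<lambda>y. pairing S g h (\<Delta> y)) (\<Delta> a)"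
      by (rule pairing_tensor_map[OF A A A AA f' gh linear_id \<Delta> \<Delta>_closed[OF a]])
    also have "\<dots> = pairing S f (?m (pure_tensor S D D g h)) (\<Delta> a)"
      by (rule pairing_cong[OF A A _ _ f' dual_linear[OF mult_closed[OF g h]] \<Delta>_closed[OF a]])
        (simp_all only: mult_pure[OF g h] id_apply)
    also have "\<dots> = ?m (pure_tensor S D D f (?m (pure_tensor S D D g h))) a"
      by (rule mult_pure[OF f mult_closed[OF g h] a, symmetric])
    finally show "?m (pure_tensor S D D (?m (pure_tensor S D D f g)) h) a =
      ?m (pure_tensor S D D f (?m (pure_tensor S D D g h))) a" .
  qed (rule mult_closed that)+
  have assoc: "?m (tensor_map S D D ?m id t) = ?m (tensor_map S D D id ?m (associator S D D D t))"
    if t: "t \<in> carrier (tensor S DD D)" for t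
  proof (rule tensor_ext[OF DD D D _ _ _ t])
    show "(\<lambda>t. ?m (tensor_map S D D ?m id t)) \<in> linear_maps S (tensor S DD D) D"
      by (rule linear_compose[OF _ \<mu>']) (rule lin)+
    show "(\<lambda>t. ?m (tensor_map S D D id ?m (associator S D D D t))) \<in> linear_maps S (tensor S DD D) D"
      by (rule linear_compose[OF _ \<mu>']) (rule lin)+
    fix F h assume F: "F \<in> carrier DD" and h: "h \<in> carrier D"
    show "?m (tensor_map S D D ?m id (pure_tensor S DD D F h)) =
        ?m (tensor_map S D D id ?m (associator S D D D (pure_tensor S DD D F h)))"
    proof (rule tensor_ext[OF D D D _ _ _ F])
      show "(\<lambda>F. ?m (tensor_map S D D ?m id (pure_tensor S DD D F h))) \<in> linear_maps S DD D"
        by (rule linear_compose[OF _ \<mu>']) (rule h lin)+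
      show "(\<lambda>F. ?m (tensor_map S D D id ?m (associator S D D D (pure_tensor S DD D F h)))) \<in> linear_maps S DD D"
        by (rule linear_compose[OF _ \<mu>']) (rule h lin)+
      show "?m (tensor_map S D D ?m id (pure_tensor S DD D (pure_tensor S D D f g) h)) =
          ?m (tensor_map S D D id ?m (associator S D D D (pure_tensor S DD D (pure_tensor S D D f g) h)))"
        if "f \<in> carrier D" "g \<in> carrier D" for f g
        using that h assoc_pure[OF that h]
        by (simp only: tensor_map_pure[OF DD D D D \<mu>' linear_id] tensor_map_pure[OF D DD D D linear_id \<mu>']
            associator_pure[OF D D D] pure_tensor_carrier[OF D D] id_apply)
    qed
  qed
  have left_unit: "?m (tensor_map S D D ?u id t) = left_unitor D t"
    if t: "t \<in> carrier (tensor S (regular S) D)" for t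
  proof (rule tensor_ext[OF R D D _ _ _ t])
    show "(\<lambda>t. ?m (tensor_map S D D ?u id t)) \<in> linear_maps S (tensor S (regular S) D) D"
      by (rule linear_compose[OF _ \<mu>']) (rule lin)+
    show "left_unitor D \<in> linear_maps S (tensor S (regular S) D) D"
      by (rule lin)+
    fix s f assume s: "s \<in> carrier (regular S)" and f: "f \<in> carrier D"
    then have s': "s \<in> carrier S" by simp
    note us = linear_closed[OF \<eta>' s] and f' = dual_linear[OF f]
    have ms: "(\<lambda>r. s \<otimes>\<^bsub>S\<^esub> r) \<in> linear_maps S (regular S) (regular S)"
      by (rule S s' linear_intros)+
    \<comment> \<open>The unit axiom lives on \<open>S \<otimes> D\<close>, hence a general scalar
      \<open>s\<close>; the functional \<open>?u s\<close> is \<open>s\<close> times the counit of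
      \<open>A\<close>.\<close>
    have "?m (pure_tensor S D D (?u s) f) = s \<odot>\<^bsub>D\<^esub> f"
    proof (rule dual_eqI[OF mult_closed[OF us f] D.smult_closed[OF s' f]])
      fix a assume a: "a \<in> carrier A"
      have "?m (pure_tensor S D D (?u s) f) a = pairing S (?u s) f (\<Delta> a)"
        by (rule mult_pure[OF us f a])
      also have "\<dots> = pairing S (\<lambda>x. s \<otimes>\<^bsub>S\<^esub> \<epsilon> x) (\<lambda>y. f (id y)) (\<Delta> a)"
        by (rule pairing_cong[OF A A _ _ linear_compose[OF \<epsilon> ms] linear_compose[OF linear_id f'] \<Delta>_closed[OF a]])
          (simp_all only: dual_unit_apply[OF \<epsilon> s'] id_apply)
      also have "\<dots> = pairing S (\<lambda>r. s \<otimes>\<^bsub>S\<^esub> r) f (tensor_map S (regular S) A \<epsilon> id (\<Delta> a))"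
        by (rule pairing_tensor_map[OF A A R A ms f' \<epsilon> linear_id \<Delta>_closed[OF a], symmetric])
      also have "\<dots> = s \<otimes>\<^bsub>S\<^esub> f (left_unitor A (tensor_map S (regular S) A \<epsilon> id (\<Delta> a)))"
        by (rule pairing_left_unitor[OF A f' s'])
          (rule linear_closed[OF linear_tensor_map[OF linear_ident A A R A \<epsilon> linear_id] \<Delta>_closed[OF a]])
      also have "\<dots> = s \<otimes>\<^bsub>S\<^esub> f a"
        using coalg a by (simp add: semicoalgebra_def)
      finally show "?m (pure_tensor S D D (?u s) f) a = (s \<odot>\<^bsub>D\<^esub> f) a"
        using a by simp
    qed
    then show "?m (tensor_map S D D ?u id (pure_tensor S (regular S) D s f)) =
        left_unitor D (pure_tensor S (regular S) D s f)"
      using s s' f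
      by (simp only: tensor_map_pure[OF R D D D \<eta>' linear_id] left_unitor_pure[OF D] id_apply)
  qed
  have right_unit: "?m (tensor_map S D D id ?u t) = right_unitor D t"
    if t: "t \<in> carrier (tensor S D (regular S))" for t
  proof (rule tensor_ext[OF D R D _ _ _ t])
    show "(\<lambda>t. ?m (tensor_map S D D id ?u t)) \<in> linear_maps S (tensor S D (regular S)) D"
      by (rule linear_compose[OF _ \<mu>']) (rule lin)+
    show "right_unitor D \<in> linear_maps S (tensor S D (regular S)) D"
      by (rule lin)+
    fix f s assume f: "f \<in> carrier D" and s: "s \<in> carrier (regular S)"
    then have s': "s \<in> carrier S" by simp
    note us = linear_closed[OF \<eta>' s] and f' = dual_linear[OF f]
    have ms: "(\<lambda>r. s \<otimes>\<^bsub>S\<^esub> r) \<in> linear_maps S (regular S) (regular S)"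
      by (rule S s' linear_intros)+
    have "?m (pure_tensor S D D f (?u s)) = s \<odot>\<^bsub>D\<^esub> f"
    proof (rule dual_eqI[OF mult_closed[OF f us] D.smult_closed[OF s' f]])
      fix a assume a: "a \<in> carrier A"
      have "?m (pure_tensor S D D f (?u s)) a = pairing S f (?u s) (\<Delta> a)"
        by (rule mult_pure[OF f us a])
      also have "\<dots> = pairing S (\<lambda>x. f (id x)) (\<lambda>y. s \<otimes>\<^bsub>S\<^esub> \<epsilon> y) (\<Delta> a)"
        by (rule pairing_cong[OF A A _ _ linear_compose[OF linear_id f'] linear_compose[OF \<epsilon> ms] \<Delta>_closed[OF a]])
          (simp_all only: dual_unit_apply[OF \<epsilon> s'] id_apply)
      also have "\<dots> = pairing S f (\<lambda>r. s \<otimes>\<^bsub>S\<^esub> r) (tensor_map S A (regular S) id \<epsilon> (\<Delta> a))"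
        by (rule pairing_tensor_map[OF A A A R f' ms linear_id \<epsilon> \<Delta>_closed[OF a], symmetric])
      also have "\<dots> = s \<otimes>\<^bsub>S\<^esub> f (right_unitor A (tensor_map S A (regular S) id \<epsilon> (\<Delta> a)))"
        by (rule pairing_right_unitor[OF A f' s'])
          (rule linear_closed[OF linear_tensor_map[OF linear_ident A A A R linear_id \<epsilon>] \<Delta>_closed[OF a]])
      also have "\<dots> = s \<otimes>\<^bsub>S\<^esub> f a"
        using coalg a by (simp add: semicoalgebra_def)
      finally show "?m (pure_tensor S D D f (?u s)) a = (s \<odot>\<^bsub>D\<^esub> f) a"
        using a by simp
    qed
    then show "?m (tensor_map S D D id ?u (pure_tensor S D (regular S) f s)) =
        right_unitor D (pure_tensor S D (regular S) f s)"
      using s s' f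
      by (simp only: tensor_map_pure[OF D R D D linear_id \<eta>'] right_unitor_pure[OF D] id_apply)
  qed
  show ?thesis
    unfolding semialgebra_def using D \<mu>' \<eta>' assoc left_unit right_unit by blast
qed

text \<open>Transposition permutes the four compatibility axioms. Product against coproduct and unit
  against counit are carried to themselves; multiplicativity of the counit becomes preservation of
  the unit by the coproduct, and conversely.\<close>

lemma dual_bisemialgebra:
  assumes bialg: "bisemialgebra S A \<mu> \<eta> \<Delta> \<epsilon>"
  shows "bisemialgebra S D (dual_mult \<Delta>) (dual_unit \<epsilon>) (dual_comult \<mu>) (dual_counit \<eta>)"
proof -
  have alg: "semialgebra S A \<mu> \<eta>" and coalg: "semicoalgebra S A \<Delta> \<epsilon>"
    using bialg by (simp_all add: bisemialgebra_def)
  note \<mu> = linear_semialgebra_mult[OF alg] and \<eta> = linear_semialgebra_unit[OF alg]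
  have \<Delta>: "\<Delta> \<in> linear_maps S A AA" and \<epsilon>: "\<epsilon> \<in> linear_maps S A (regular S)"
    using coalg by (simp_all add: semicoalgebra_def)
  let ?m = "dual_mult \<Delta>" and ?u = "dual_unit \<epsilon>" and ?c = "dual_comult \<mu>" and ?e = "dual_counit \<eta>"
  note \<mu>' = linear_dual_mult[OF \<Delta>] and \<eta>' = linear_dual_unit[OF \<epsilon>]
  note \<Delta>' = linear_dual_comult[OF \<mu>] and \<epsilon>' = linear_dual_counit[OF \<eta>]
  note lin = S D DD R \<mu>' \<eta>' \<Delta>' \<epsilon>' linear_intros
  note pA = pure_tensor_carrier[OF A A] and pD = pure_tensor_carrier[OF D D]
  note \<Delta>_closed = linear_closed[OF \<Delta>] and comult_closed = dual_comult_closed[OF \<mu>]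
  have \<eta>1: "\<eta> \<one>\<^bsub>S\<^esub> \<in> carrier A"
    by (rule linear_closed[OF \<eta>]) simp
  have \<Delta>_mult: "\<Delta> (\<mu> (pure_tensor S A A a b)) =
      tensor_map S A A \<mu> \<mu> (interchange S A A (pure_tensor S AA AA (\<Delta> a) (\<Delta> b)))"
    if "a \<in> carrier A" "b \<in> carrier A" for a b
    using bialg pA[OF that] that
    by (simp add: bisemialgebra_def semialgebra_morphism_def tensor_square_mult_def
        tensor_map_pure[OF A A AA AA \<Delta> \<Delta>])
  have \<Delta>_one: "\<Delta> (\<eta> \<one>\<^bsub>S\<^esub>) = pure_tensor S A A (\<eta> \<one>\<^bsub>S\<^esub>) (\<eta> \<one>\<^bsub>S\<^esub>)"
    using bialg
    by (simp add: bisemialgebra_def semialgebra_morphism_def tensor_square_unit_def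
        tensor_map_pure[OF R R A A \<eta> \<eta>])
  have \<epsilon>_closed: "\<epsilon> a \<in> carrier S" if "a \<in> carrier A" for a
    using linear_closed[OF \<epsilon> that] by simp
  have \<epsilon>_mult: "\<epsilon> (\<mu> (pure_tensor S A A a b)) = \<epsilon> a \<otimes>\<^bsub>S\<^esub> \<epsilon> b"
    if "a \<in> carrier A" "b \<in> carrier A" for a b
    using bialg pA[OF that] that \<epsilon>_closed
    by (simp add: bisemialgebra_def semialgebra_morphism_def tensor_map_pure[OF A A R R \<epsilon> \<epsilon>]
        left_unitor_pure[OF R])
  have \<epsilon>_one: "\<epsilon> (\<eta> \<one>\<^bsub>S\<^esub>) = \<one>\<^bsub>S\<^esub>"
    using bialg by (simp add: bisemialgebra_def semialgebra_morphism_def)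
  have comult_mult: "?c (?m t) = tensor_square_mult S D ?m (tensor_map S DD DD ?c ?c t)"
    if t: "t \<in> carrier DD" for t
  proof (rule tensor_ext[OF D D DD _ _ _ t])
    show "(\<lambda>t. ?c (?m t)) \<in> linear_maps S DD DD"
      by (rule linear_compose[OF \<mu>' \<Delta>'])
    have sq: "tensor_square_mult S D ?m \<in> linear_maps S (tensor S DD DD) DD"
      unfolding tensor_square_mult_def comp_def[of "tensor_map S D D ?m ?m"] by (rule lin)+
    show "(\<lambda>t. tensor_square_mult S D ?m (tensor_map S DD DD ?c ?c t)) \<in> linear_maps S DD DD"
      by (rule linear_compose[OF _ sq]) (rule lin)+
    fix f g assume f: "f \<in> carrier D" and g: "g \<in> carrier D"
    note f' = dual_linear[OF f] and g' = dual_linear[OF g]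
    note cf = comult_closed[OF f] and cg = comult_closed[OF g]
    let ?V = "interchange S D D (pure_tensor S DD DD (?c f) (?c g))"
    have V: "?V \<in> carrier (tensor S DD DD)"
      by (rule linear_closed[OF linear_interchange[OF D D linear_ident] pure_tensor_carrier[OF DD DD cf cg]])
    have "?c (?m (pure_tensor S D D f g)) = tensor_map S D D ?m ?m ?V"
    proof (rule DD_eqI)
      show "?c (?m (pure_tensor S D D f g)) \<in> carrier DD"
        using f g by (intro comult_closed linear_closed[OF \<mu>'] pD)
      show "tensor_map S D D ?m ?m ?V \<in> carrier DD"
        by (rule linear_closed[OF linear_tensor_map[OF linear_ident DD DD D D \<mu>' \<mu>'] V])
      fix a b assume a: "a \<in> carrier A" and b: "b \<in> carrier A"
      note ab = linear_closed[OF \<mu> pA[OF a b]]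
      let ?W = "interchange S A A (pure_tensor S AA AA (\<Delta> a) (\<Delta> b))"
      have W: "?W \<in> carrier (tensor S AA AA)"
        by (rule linear_closed[OF linear_interchange[OF A A linear_ident]
              pure_tensor_carrier[OF AA AA \<Delta>_closed[OF a] \<Delta>_closed[OF b]]])
      \<comment> \<open>The left side is \<open>f \<otimes> g\<close> evaluated at
        \<open>\<Delta>\<close> of the product of \<open>a\<close> and \<open>b\<close>, where
        multiplicativity of \<open>\<Delta>\<close> applies.\<close>
      have "contract D a (?c (?m (pure_tensor S D D f g))) b = pairing S f g (tensor_map S A A \<mu> \<mu> ?W)"
        using f g a b ab
        by (simp only: contract_dual_comult[OF \<mu>] linear_closed[OF \<mu>'] pD dual_mult_pure[OF \<Delta>] \<Delta>_mult)
      also have "\<dots> = pairing S (\<lambda>X. f (\<mu> X)) (\<lambda>X. g (\<mu> X)) ?W"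
        by (rule pairing_tensor_map[OF AA AA A A f' g' \<mu> \<mu> W])
      also have "\<dots> = pairing S (canonical_map S A A (?c f)) (canonical_map S A A (?c g)) ?W"
        by (rule pairing_cong[OF AA AA _ _ dual_linear[OF canonical_map_closed[OF A A cf]]
              dual_linear[OF canonical_map_closed[OF A A cg]] W])
          (simp_all only: canonical_map_dual_comult[OF \<mu>] f g)
      \<comment> \<open>The crossing point: the middle exchange passes from the coproducts of
        \<open>a\<close> and \<open>b\<close> to those of \<open>f\<close> and
        \<open>g\<close>.\<close>
      also have "\<dots> = pairing S (\<lambda>V. canonical_map S A A V (\<Delta> a)) (\<lambda>V. canonical_map S A A V (\<Delta> b)) ?V"
        by (rule interchange_canonical_map[OF A cf cg \<Delta>_closed[OF a] \<Delta>_closed[OF b], symmetric])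
      also have "\<dots> = contract D a (tensor_map S D D ?m ?m ?V) b"
        by (simp only: contract_tensor_map[OF A A DD DD \<mu>' \<mu>' a b V] dual_mult_apply a b)
      finally show "contract D a (?c (?m (pure_tensor S D D f g))) b =
          contract D a (tensor_map S D D ?m ?m ?V) b" .
    qed
    then show "?c (?m (pure_tensor S D D f g)) =
        tensor_square_mult S D ?m (tensor_map S DD DD ?c ?c (pure_tensor S D D f g))"
      by (simp only: tensor_map_pure[OF D D DD DD \<Delta>' \<Delta>' f g] tensor_square_mult_def
          comp_apply[of "tensor_map S D D ?m ?m"])
  qed
  have comult_unit: "?c (?u s) = tensor_square_unit S D ?u s" if s: "s \<in> carrier S" for s
  proof -
    have us: "?u r \<in> carrier D" if "r \<in> carrier S" for r
      by (rule linear_closed[OF \<eta>']) (simp add: that)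
    \<comment> \<open>As in \<open>tensor_square_unit\<close>, the scalar sits in the first factor
      and one in the second. At \<open>a\<close> and \<open>b\<close> both sides are
      \<open>s\<close> times \<open>\<epsilon> a\<close> times \<open>\<epsilon> b\<close>, the left
      one because \<open>\<epsilon>\<close> is multiplicative.\<close>
    have "?c (?u s) = pure_tensor S D D (?u s) (?u \<one>\<^bsub>S\<^esub>)"
    proof (rule DD_eqI)
      fix a b assume a: "a \<in> carrier A" and b: "b \<in> carrier A"
      note ab = linear_closed[OF \<mu> pA[OF a b]]
      have "contract D a (?c (?u s)) b = s \<otimes>\<^bsub>S\<^esub> (\<epsilon> a \<otimes>\<^bsub>S\<^esub> \<epsilon> b)"
        using s a b ab by (simp only: contract_dual_comult[OF \<mu> us] dual_unit_apply[OF \<epsilon>] \<epsilon>_mult)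
      moreover have "contract D a (pure_tensor S D D (?u s) (?u \<one>\<^bsub>S\<^esub>)) b =
          (s \<otimes>\<^bsub>S\<^esub> \<epsilon> a) \<otimes>\<^bsub>S\<^esub> (\<one>\<^bsub>S\<^esub> \<otimes>\<^bsub>S\<^esub> \<epsilon> b)"
        using s a b by (simp only: contract_pure[OF A D] us dual_unit_apply[OF \<epsilon>] dual_apply S.one_closed)
      ultimately show "contract D a (?c (?u s)) b = contract D a (pure_tensor S D D (?u s) (?u \<one>\<^bsub>S\<^esub>)) b"
        using s \<epsilon>_closed[OF a] \<epsilon>_closed[OF b] by (simp only: S.m_assoc S.l_one)
    qed (rule comult_closed us pD s S.one_closed)+
    then show ?thesis
      using s unfolding tensor_square_unit_def
      by (subst tensor_map_pure[OF R R D D \<eta>' \<eta>']) simp_all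
  qed
  \<comment> \<open>Evaluation at the unit of \<open>A\<close> is multiplicative because
    \<open>\<Delta>\<close> sends the unit to its tensor square
    (\<open>\<Delta>_one\<close>).\<close>
  have counit_mult: "?e (?m t) = left_unitor (regular S) (tensor_map S (regular S) (regular S) ?e ?e t)"
    if t: "t \<in> carrier DD" for t
  proof (rule tensor_ext[OF D D R _ _ _ t])
    show "(\<lambda>t. ?e (?m t)) \<in> linear_maps S DD (regular S)"
      by (rule linear_compose[OF \<mu>' \<epsilon>'])
    show "(\<lambda>t. left_unitor (regular S) (tensor_map S (regular S) (regular S) ?e ?e t))
        \<in> linear_maps S DD (regular S)"
      by (rule lin)+
    fix f g assume f: "f \<in> carrier D" and g: "g \<in> carrier D"
    have "f (\<eta> \<one>\<^bsub>S\<^esub>) \<in> carrier S" "g (\<eta> \<one>\<^bsub>S\<^esub>) \<in> carrier S"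
      using f g \<eta>1 by (auto intro: dual_closed)
    then show "?e (?m (pure_tensor S D D f g)) = left_unitor (regular S)
        (tensor_map S (regular S) (regular S) ?e ?e (pure_tensor S D D f g))"
      using f g \<eta>1
      by (simp only: dual_counit_apply dual_mult_pure[OF \<Delta>] \<Delta>_one pairing_pure[OF A A] dual_linear
          tensor_map_pure[OF D D R R \<epsilon>' \<epsilon>'] left_unitor_pure[OF R] regular_simps)
  qed
  have counit_unit: "?e (?u s) = id s" if "s \<in> carrier S" for s
    using that by (simp only: dual_counit_apply dual_unit_apply[OF \<epsilon> that \<eta>1] \<epsilon>_one S.r_one id_apply)
  show ?thesis
    unfolding bisemialgebra_def semialgebra_morphism_def
    using dual_semialgebra[OF coalg] dual_semicoalgebra[OF alg] \<Delta>' \<epsilon>'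
      comult_mult comult_unit counit_mult counit_unit
    by blast
qed

text \<open>The antipode identities are their own transposes: at \<open>x\<close>, the convolution
  of \<open>p'\<close> and \<open>q'\<close> applied to \<open>\<phi>\<close> is
  \<open>\<phi>\<close> of the convolution of \<open>p\<close> and \<open>q\<close> applied to
  \<open>x\<close>.\<close>

lemma dual_hopf_semialgebra:
  assumes hopf: "hopf_semialgebra S A \<mu> \<eta> \<Delta> \<epsilon> \<aa>"
  shows "hopf_semialgebra S D (dual_mult \<Delta>) (dual_unit \<epsilon>) (dual_comult \<mu>) (dual_counit \<eta>) (dual_map A \<aa>)"
proof -
  have bialg: "bisemialgebra S A \<mu> \<eta> \<Delta> \<epsilon>" and \<aa>: "\<aa> \<in> linear_maps S A A"
    using hopf by (simp_all add: hopf_semialgebra_def)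
  have alg: "semialgebra S A \<mu> \<eta>" and coalg: "semicoalgebra S A \<Delta> \<epsilon>"
    using bialg by (simp_all add: bisemialgebra_def)
  note \<mu> = linear_semialgebra_mult[OF alg] and \<eta> = linear_semialgebra_unit[OF alg]
  have \<Delta>: "\<Delta> \<in> linear_maps S A AA" and \<epsilon>: "\<epsilon> \<in> linear_maps S A (regular S)"
    using coalg by (simp_all add: semicoalgebra_def)
  let ?m = "dual_mult \<Delta>" and ?u = "dual_unit \<epsilon>" and ?c = "dual_comult \<mu>" and ?e = "dual_counit \<eta>"
  let ?a = "dual_map A \<aa>"
  note \<mu>' = linear_dual_mult[OF \<Delta>] and \<eta>' = linear_dual_unit[OF \<epsilon>]
  note \<epsilon>' = linear_dual_counit[OF \<eta>]
  have \<aa>': "?a \<in> linear_maps S D D"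
    by (rule linear_dual_map[OF A A \<aa> linear_ident D])
  \<comment> \<open>General \<open>p\<close> and \<open>q\<close> let one computation serve both
    sides: the antipode on the left factor with \<open>id\<close> on the right, and the
    reverse.\<close>
  have main: "?m (tensor_map S D D p' q' (?c \<phi>)) = ?u (?e \<phi>)"
    if \<phi>: "\<phi> \<in> carrier D"
      and p: "p \<in> linear_maps S A A" and q: "q \<in> linear_maps S A A"
      and p': "p' \<in> linear_maps S D D" and q': "q' \<in> linear_maps S D D"
      and p'_apply: "\<And>f x. f \<in> carrier D \<Longrightarrow> x \<in> carrier A \<Longrightarrow> p' f x = f (p x)"
      and q'_apply: "\<And>f x. f \<in> carrier D \<Longrightarrow> x \<in> carrier A \<Longrightarrow> q' f x = f (q x)"
      and antipode: "\<And>x. x \<in> carrier A \<Longrightarrow> \<mu> (tensor_map S A A p q (\<Delta> x)) = \<eta> (\<epsilon> x)"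
    for \<phi> p q p' q'
  proof (rule dual_eqI)
    note c\<phi> = dual_comult_closed[OF \<mu> \<phi>]
    note e\<phi> = linear_closed[OF \<epsilon>' \<phi>]
    show "?m (tensor_map S D D p' q' (?c \<phi>)) \<in> carrier D"
      by (rule linear_closed[OF \<mu>' linear_closed[OF linear_tensor_map[OF linear_ident D D D D p' q'] c\<phi>]])
    show "?u (?e \<phi>) \<in> carrier D"
      by (rule linear_closed[OF \<eta>' e\<phi>])
    fix x assume x: "x \<in> carrier A"
    note \<Delta>x = linear_closed[OF \<Delta> x]
    have \<epsilon>x: "\<epsilon> x \<in> carrier S"
      using linear_closed[OF \<epsilon> x] by simp
    have "?m (tensor_map S D D p' q' (?c \<phi>)) x = canonical_map S A A (?c \<phi>) (tensor_map S A A p q (\<Delta> x))"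
      by (simp only: dual_mult_apply[OF x]
          canonical_map_tensor_map[OF A p q p' q' p'_apply q'_apply c\<phi> \<Delta>x])
    also have "\<dots> = \<phi> (\<eta> (\<epsilon> x))"
      using linear_closed[OF linear_tensor_map[OF linear_ident A A A A p q] \<Delta>x]
      by (simp only: canonical_map_dual_comult[OF \<mu> \<phi>] antipode[OF x])
    \<comment> \<open>The unit map sends \<open>\<epsilon> x\<close> to that multiple of the unit of
      \<open>A\<close>, so linearity of \<open>\<phi>\<close> after \<open>\<eta>\<close> extracts
      the scalar; commutativity then matches it with the dual unit.\<close>
    also have "\<dots> = \<epsilon> x \<otimes>\<^bsub>S\<^esub> \<phi> (\<eta> \<one>\<^bsub>S\<^esub>)"
      using linear_smult[OF linear_compose[OF \<eta> dual_linear[OF \<phi>]] \<epsilon>x, of "\<one>\<^bsub>S\<^esub>"] \<epsilon>x by simp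
    also have "\<dots> = ?u (?e \<phi>) x"
      using e\<phi> \<epsilon>x dual_unit_apply[OF \<epsilon> _ x, of "?e \<phi>"]
      by (simp only: regular_simps dual_counit_apply S.m_comm)
    finally show "?m (tensor_map S D D p' q' (?c \<phi>)) x = ?u (?e \<phi>) x" .
  qed
  have "?m (tensor_map S D D ?a id (?c \<phi>)) = ?u (?e \<phi>)" if \<phi>: "\<phi> \<in> carrier D" for \<phi>
    by (rule main[OF \<phi> \<aa> linear_id \<aa>' linear_id])
      (use hopf in \<open>simp_all add: hopf_semialgebra_def dual_map_apply\<close>)
  moreover have "?m (tensor_map S D D id ?a (?c \<phi>)) = ?u (?e \<phi>)" if \<phi>: "\<phi> \<in> carrier D" for \<phi>
    by (rule main[OF \<phi> linear_id \<aa> linear_id \<aa>'])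
      (use hopf in \<open>simp_all add: hopf_semialgebra_def dual_map_apply\<close>)
  ultimately show ?thesis
    unfolding hopf_semialgebra_def using dual_bisemialgebra[OF bialg] \<aa>' by blast
qed

end

lemma uniformly_finitely_presented_imp_finitely_generated:
  "uniformly_finitely_presented S A \<Longrightarrow> finitely_generated S A"
  by (auto simp: uniformly_finitely_presented_def uniformly_finitely_generated_def finitely_generated_def)

theorem proposition5p2:
  fixes S :: "('s, 'r) ring_scheme" and A :: "('s, 'a, 'm) module_scheme"
  assumes "commutative_semiring S"
    and "\<one>\<^bsub>S\<^esub> \<noteq> \<zero>\<^bsub>S\<^esub>"
    and "semimodule S A"
    and "uniformly_finitely_presented S A"
    and "projective TYPE('i) S A"
  shows
    "(\<forall>\<mu> \<eta>. semialgebra S A \<mu> \<eta> \<longrightarrow>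
       semicoalgebra S (dual S A)
         (canonical_map_inv S A A \<circ> dual_map (tensor S A A) \<mu>)
         (eval_one S \<circ> dual_map (regular S) \<eta>)) \<and>
     (\<forall>\<mu> \<eta> \<Delta> \<epsilon>. bisemialgebra S A \<mu> \<eta> \<Delta> \<epsilon> \<longrightarrow>
       bisemialgebra S (dual S A)
         (dual_map A \<Delta> \<circ> canonical_map S A A)
         (dual_map A \<epsilon> \<circ> eval_one_inv S)
         (canonical_map_inv S A A \<circ> dual_map (tensor S A A) \<mu>)
         (eval_one S \<circ> dual_map (regular S) \<eta>)) \<and>
     (\<forall>\<mu> \<eta> \<Delta> \<epsilon> \<aa>. hopf_semialgebra S A \<mu> \<eta> \<Delta> \<epsilon> \<aa> \<longrightarrow>
       hopf_semialgebra S (dual S A)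
         (dual_map A \<Delta> \<circ> canonical_map S A A)
         (dual_map A \<epsilon> \<circ> eval_one_inv S)
         (canonical_map_inv S A A \<circ> dual_map (tensor S A A) \<mu>)
         (eval_one S \<circ> dual_map (regular S) \<eta>)
         (dual_map A \<aa>))"
proof -
  obtain J :: "'i set" and e \<xi> where "dual_basis S A J e \<xi>"
    using exists_dual_basis[OF assms(3) uniformly_finitely_presented_imp_finitely_generated[OF assms(4)] assms(5)]
    by blast
  \<comment> \<open>The structures on the dual do not mention the basis, so any choice of it
    serves.\<close>
  with assms(3) interpret dual_basis_semimodule S A J e \<xi>
    by (intro dual_basis_semimodule.intro)
  show ?thesis
    using dual_semicoalgebra dual_bisemialgebra dual_hopf_semialgebra by blast
qed

end
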